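(* Let $E\subset\mathbb{C}$ be a compact set containing more than one point, with $0\in E$ and $\overline{\mathbb{C}}\setminus E$ simply connected. Let $\mathbf{F}=(F_1,\ldots,F_d)\in\mathcal{H}(E)^d$ and let $\mathbf{m}\in\mathbb{N}^d$ be a fixed multi-index. Suppose that the (monic) polynomials $Q_{n,\mathbf{m}}$ are uniquely determined for all sufficiently large $n$ and that there exists a polynomial $Q_{|\mathbf{m}|}$ of degree $|\mathbf{m}|$ such that $$\limsup_{n\to\infty}\|Q_{n,\mathbf{m}}-Q_{|\mathbf{m}|}\|^{1/n}=\theta<1,$$ where $\|\cdot\|$ denotes the coefficient norm in the space of polynomials. Then $\mathbf{F}$ has exactly $|\mathbf{m}|$ system poles with respect to $\mathbf{m}$ counting multiplicities, and $Q_{|\mathbf{m}|}=Q^{\mathbf{F}}_{\mathbf{m}}$.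
   Context: Conventions: $\mathbb{N}=\{1,2,\ldots\}$; $\mathbf{m}=(m_1,\ldots,m_d)$, $|\mathbf{m}|=m_1+\cdots+m_d$. $\Phi$ is the unique conformal map of $\overline{\mathbb{C}}\setminus E$ onto $\overline{\mathbb{C}}\setminus\{|w|\le1\}$ with $\Phi(\infty)=\infty$ and $\Phi'(\infty)=\lim_{z\to\infty}\Phi(z)/z>0$. For $\rho>1$, $\Gamma_\rho=\{z\in\mathbb{C}:|\Phi(z)|=\rho\}$ and the canonical domain of index $\rho$ is $D_\rho=E\cup\{z\in\mathbb{C}\setminus E:|\Phi(z)|<\rho\}$. $\mathcal{H}(E)$ is the space of functions holomorphic in some neighborhood of $E$, and $\mathcal{H}(E)^d$ is the set of $d$-tuples of such functions. For $G\in\mathcal{H}(E)$, $\rho_0(G)$ is the index of the largest canonical domain to which $G$ extends as a holomorphic function, and the $n$-th Faber coefficient of $G$ is $$[G]_n=\frac{1}{2\pi i}\int_{\Gamma_\rho}\frac{G(t)\Phi'(t)}{\Phi^{n+1}(t)}\,dt,\qquad 1<\rho<\rho_0(G).$$ Simultaneous Padé–Faber approximants: for $n\in\mathbb{N}$ there exist polynomials $Q_{n,\mathbf{m}}\not\equiv0$ and $P_{n,\mathbf{m},k,\alpha}$ with $\deg Q_{n,\mathbf{m}}\le|\mathbf{m}|$, $\deg P_{n,\mathbf{m},k,\alpha}\le n-1$, and $$[Q_{n,\mathbf{m}}z^kF_\alpha-P_{n,\mathbf{m},k,\alpha}]_j=0,\qquad j=0,1,\ldots,n,$$ for all $k=0,\ldots,m_\alpha-1$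 and $\alpha=1,\ldots,d$. $Q_{n,\mathbf{m}}$ is normalized to be monic; for each $n$ one solution is chosen. "$Q_{n,\mathbf{m}}$ is uniquely determined" means that there is only one monic polynomial $Q_{n,\mathbf{m}}$ satisfying these conditions (for some polynomials $P_{n,\mathbf{m},k,\alpha}$). System poles: $\xi\in\mathbb{C}$ (necessarily $\xi\notin E$) is a system pole of order $\tau$ of $\mathbf{F}$ with respect to $\mathbf{m}$ if $\tau$ is the largest positive integer such that for each $t=1,\ldots,\tau$ there is at least one polynomial combination $$\sum_{\alpha=1}^d v_\alpha F_\alpha,\qquad \deg v_\alpha<m_\alpha,\ \alpha=1,\ldots,d,$$ which is holomorphic on a neighborhood of $\overline{D}_{|\Phi(\xi)|}$ except for a pole at $z=\xi$ of exact order $t$. System poles are counted with their order. $Q^{\mathbf{F}}_{\mathbf{m}}$ is the monic polynomial whose zeros are the system poles of $\mathbf{F}$ with respect to $\mathbf{m}$, with multiplicity equal to their order. *)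

theory Defs
  imports "HOL-Complex_Analysis.Complex_Analysis"
begin

definition riemann_sphere :: "complex option topology" where
  "riemann_sphere = Alexandroff_compactification euclidean"

(* The library defines simple connectedness for sets in a type class only; this is the same
   definition for an abstract topology. *)
definition simply_connected_space :: "'a topology \<Rightarrow> bool" where
  "simply_connected_space X \<longleftrightarrow>
     (\<forall>p q. pathin X p \<and> p 1 = p 0 \<and> pathin X q \<and> q 1 = q 0 \<longrightarrow>
        homotopic_with (\<lambda>r. r 1 = r 0) (top_of_set {0..1}) X p q)"

lemma simply_connected_space_top_of_set:
  "simply_connected_space (top_of_set S) \<longleftrightarrow> simply_connected S"
  unfolding simply_connected_space_def simply_connected_def homotopic_loops_def
    pathin_def path_def pathstart_def pathfinish_def path_image_def
  by (simp add: image_subset_iff_funcset conj_ac)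

(* Only the values of Phi on the complement of E matter. The limit condition says that the map,
   extended by Phi(infinity) = infinity, is conformal at infinity with positive derivative there. *)
definition exterior_conformal_map :: "complex set \<Rightarrow> (complex \<Rightarrow> complex) \<Rightarrow> bool" where
  "exterior_conformal_map E \<Phi> \<longleftrightarrow>
     \<Phi> holomorphic_on (- E) \<and> bij_betw \<Phi> (- E) {w. 1 < norm w} \<and>
     (\<exists>c::real. c > 0 \<and> ((\<lambda>z. \<Phi> z / z) \<longlongrightarrow> of_real c) at_infinity)"

(* The index may be infinite: the domain is then the whole plane. *)
definition canonical_domain :: "complex set \<Rightarrow> (complex \<Rightarrow> complex) \<Rightarrow> ereal \<Rightarrow> complex set" where
  "canonical_domain E \<Phi> \<rho> = E \<union> {z \<in> - E. ereal (norm (\<Phi> z)) < \<rho>}"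

(* The level curve of index rho, traversed once counterclockwise. *)
definition level_curve :: "complex set \<Rightarrow> (complex \<Rightarrow> complex) \<Rightarrow> real \<Rightarrow> real \<Rightarrow> complex" where
  "level_curve E \<Phi> \<rho> = inv_into (- E) \<Phi> \<circ> circlepath 0 \<rho>"

(* A member of H(E) is a germ along E: only its values near E count, and saying that it extends
   to a larger set means that some holomorphic function there agrees with it near E. *)
definition agree_near :: "complex set \<Rightarrow> (complex \<Rightarrow> complex) \<Rightarrow> (complex \<Rightarrow> complex) \<Rightarrow> bool" where
  "agree_near E g G \<longleftrightarrow> (\<exists>U. open U \<and> E \<subseteq> U \<and> (\<forall>z\<in>U. g z = G z))"

definition extends_to ::
    "complex set \<Rightarrow> (complex \<Rightarrow> complex) \<Rightarrow> (complex \<Rightarrow> complex) \<Rightarrow> ereal \<Rightarrow> (complex \<Rightarrow> complex) \<Rightarrow> bool" where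
  "extends_to E \<Phi> G \<rho> g \<longleftrightarrow> g holomorphic_on canonical_domain E \<Phi> \<rho> \<and> agree_near E g G"

definition rho0 :: "complex set \<Rightarrow> (complex \<Rightarrow> complex) \<Rightarrow> (complex \<Rightarrow> complex) \<Rightarrow> ereal" where
  "rho0 E \<Phi> G = Sup {\<rho>. 1 < \<rho> \<and> (\<exists>g. extends_to E \<Phi> G \<rho> g)}"

(* For G in H(E) the value does not depend on the choice of g and rho. *)
definition faber_coeff ::
    "complex set \<Rightarrow> (complex \<Rightarrow> complex) \<Rightarrow> (complex \<Rightarrow> complex) \<Rightarrow> nat \<Rightarrow> complex" where
  "faber_coeff E \<Phi> G n =
     (let g = (SOME g. extends_to E \<Phi> G (rho0 E \<Phi> G) g);
          \<rho> = (SOME \<rho>::real. 1 < \<rho> \<and> ereal \<rho> < rho0 E \<Phi> G)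
      in 1 / (2 * of_real pi * \<i>) *
           contour_integral (level_curve E \<Phi> \<rho>) (\<lambda>t. g t * deriv \<Phi> t / \<Phi> t ^ (n + 1)))"

(* Multi-indices and d-tuples of functions are indexed by 1..d; values at other indices
   are irrelevant. *)
definition mi_size :: "nat \<Rightarrow> (nat \<Rightarrow> nat) \<Rightarrow> nat" where
  "mi_size d m = (\<Sum>\<alpha>=1..d. m \<alpha>)"

definition pade_faber_solution ::
    "complex set \<Rightarrow> (complex \<Rightarrow> complex) \<Rightarrow> nat \<Rightarrow> (nat \<Rightarrow> complex \<Rightarrow> complex) \<Rightarrow> (nat \<Rightarrow> nat) \<Rightarrow>
     nat \<Rightarrow> complex poly \<Rightarrow> (nat \<Rightarrow> nat \<Rightarrow> complex poly) \<Rightarrow> bool" where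
  "pade_faber_solution E \<Phi> d F m n Q P \<longleftrightarrow>
     Q \<noteq> 0 \<and> degree Q \<le> mi_size d m \<and>
     (\<forall>\<alpha>\<in>{1..d}. \<forall>k<m \<alpha>. degree (P k \<alpha>) \<le> n - 1 \<and>
        (\<forall>j\<le>n. faber_coeff E \<Phi> (\<lambda>z. poly Q z * z ^ k * F \<alpha> z - poly (P k \<alpha>) z) j = 0))"

definition monic_pade_faber_denominator ::
    "complex set \<Rightarrow> (complex \<Rightarrow> complex) \<Rightarrow> nat \<Rightarrow> (nat \<Rightarrow> complex \<Rightarrow> complex) \<Rightarrow> (nat \<Rightarrow> nat) \<Rightarrow>
     nat \<Rightarrow> complex poly \<Rightarrow> bool" where
  "monic_pade_faber_denominator E \<Phi> d F m n Q \<longleftrightarrow>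
     lead_coeff Q = 1 \<and> (\<exists>P. pade_faber_solution E \<Phi> d F m n Q P)"

(* The sum of the moduli of the coefficients. *)
definition coeff_norm :: "complex poly \<Rightarrow> real" where
  "coeff_norm p = (\<Sum>i\<le>degree p. norm (coeff p i))"

definition has_pole_combination ::
    "complex set \<Rightarrow> (complex \<Rightarrow> complex) \<Rightarrow> nat \<Rightarrow> (nat \<Rightarrow> complex \<Rightarrow> complex) \<Rightarrow> (nat \<Rightarrow> nat) \<Rightarrow>
     complex \<Rightarrow> nat \<Rightarrow> bool" where
  "has_pole_combination E \<Phi> d F m \<xi> t \<longleftrightarrow>
     (\<exists>v :: nat \<Rightarrow> complex poly. (\<forall>\<alpha>\<in>{1..d}. degree (v \<alpha>) < m \<alpha>) \<and>
       (\<exists>U g. open U \<and> closure (canonical_domain E \<Phi> (ereal (norm (\<Phi> \<xi>)))) \<subseteq> U \<and>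
          g holomorphic_on U - {\<xi>} \<and> agree_near E g (\<lambda>z. \<Sum>\<alpha>=1..d. poly (v \<alpha>) z * F \<alpha> z) \<and>
          is_pole g \<xi> \<and> zorder g \<xi> = - int t))"

(* No point of E can be a system pole; the condition on xi keeps the arbitrary values
   of Phi on E out of the definition. *)
definition is_system_pole ::
    "complex set \<Rightarrow> (complex \<Rightarrow> complex) \<Rightarrow> nat \<Rightarrow> (nat \<Rightarrow> complex \<Rightarrow> complex) \<Rightarrow> (nat \<Rightarrow> nat) \<Rightarrow>
     complex \<Rightarrow> nat \<Rightarrow> bool" where
  "is_system_pole E \<Phi> d F m \<xi> \<tau> \<longleftrightarrow>
     \<xi> \<notin> E \<and> 1 \<le> \<tau> \<and> (\<forall>t\<in>{1..\<tau>}. has_pole_combination E \<Phi> d F m \<xi> t) \<and>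
     (\<forall>\<tau>'. (\<forall>t\<in>{1..\<tau>'}. has_pole_combination E \<Phi> d F m \<xi> t) \<longrightarrow> \<tau>' \<le> \<tau>)"

definition system_poles ::
    "complex set \<Rightarrow> (complex \<Rightarrow> complex) \<Rightarrow> nat \<Rightarrow> (nat \<Rightarrow> complex \<Rightarrow> complex) \<Rightarrow> (nat \<Rightarrow> nat) \<Rightarrow>
     complex set" where
  "system_poles E \<Phi> d F m = {\<xi>. \<exists>\<tau>. is_system_pole E \<Phi> d F m \<xi> \<tau>}"

definition system_pole_order ::
    "complex set \<Rightarrow> (complex \<Rightarrow> complex) \<Rightarrow> nat \<Rightarrow> (nat \<Rightarrow> complex \<Rightarrow> complex) \<Rightarrow> (nat \<Rightarrow> nat) \<Rightarrow>
     complex \<Rightarrow> nat" where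
  "system_pole_order E \<Phi> d F m \<xi> = (THE \<tau>. is_system_pole E \<Phi> d F m \<xi> \<tau>)"

definition system_pole_poly ::
    "complex set \<Rightarrow> (complex \<Rightarrow> complex) \<Rightarrow> nat \<Rightarrow> (nat \<Rightarrow> complex \<Rightarrow> complex) \<Rightarrow> (nat \<Rightarrow> nat) \<Rightarrow>
     complex poly" where
  "system_pole_poly E \<Phi> d F m =
     (\<Prod>\<xi>\<in>system_poles E \<Phi> d F m. [:- \<xi>, 1:] ^ system_pole_order E \<Phi> d F m \<xi>)"

end

theory Submission
  imports Defs "HOL-Computational_Algebra.Fundamental_Theorem_Algebra"
begin

text \<open>
  Composition with the inverse \<open>\<Psi>\<close> of \<open>\<Phi>\<close> turns Faber coefficients into Laurent coefficients on an
  annulus \<open>1 < |w| < \<rho>\<close>, so a function extends to \<open>D\<^sub>\<rho>\<close> as soon as its Faber coefficients are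
  \<open>O(\<rho>\<^sup>-\<^sup>n)\<close>. Let \<open>V\<close> be the space of the combinations \<open>f = \<Sum> v\<^sub>\<alpha> F\<^sub>\<alpha>\<close> with \<open>deg v\<^sub>\<alpha> < m\<^sub>\<alpha>\<close>; the
  denominators are characterised by \<open>[Q\<^sub>n f]\<^sub>n = 0\<close> on \<open>V\<close>. Uniqueness of \<open>Q\<^sub>n\<close> shows that \<open>V\<close> has dimension
  \<open>N = |m|\<close> and contains no entire function except 0. Since \<open>[Q f]\<^sub>n = [(Q - Q\<^sub>n) f]\<^sub>n\<close> for the limit \<open>Q\<close>, the
  function \<open>Q f\<close> extends to a strictly larger canonical domain than \<open>f\<close>; hence the obstacle to extending
  \<open>f\<close> beyond the level curve of index \<open>\<rho>\<^sub>0(f)\<close> consists of poles at zeros of \<open>Q\<close> on that curve, of order at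
  most the multiplicity of the zero. For each zero \<open>\<zeta>\<close> of \<open>Q\<close> outside \<open>E\<close>, of multiplicity \<open>\<tau>\<close>, the first
  \<open>\<tau>\<close> Taylor coefficients of \<open>Q f\<close> at \<open>\<zeta>\<close> are linear in those \<open>f\<close> that extend to the canonical domain of
  index \<open>|\<Phi>(\<zeta>)|\<close>. Extend these functionals linearly to \<open>V\<close>. No nonzero \<open>f\<close> is annihilated by all of
  them, and there are at most \<open>deg Q = N\<close>; so there are exactly \<open>N\<close>, all zeros of \<open>Q\<close> lie outside \<open>E\<close>, and one can
  make all functionals but a prescribed one vanish, which produces a pole of any prescribed order
  \<open>t \<le> \<tau>\<close> at \<open>\<zeta>\<close>.
\<close>

subsection \<open>Laurent coefficients on annuli\<close>

text \<open>Two difficulties shape the proof. The index of a combination \<open>f\<close> is not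
  known in advance, while a Taylor coefficient of \<open>Q f\<close> at a zero has a meaning only if
  \<open>f\<close> reaches the level of that zero. The arbitrary extension of the functionals is
  harmless because they are evaluated at one place: on the level curve of the actual index of
  \<open>f\<close> some functional is nonzero, and there \<open>f\<close> lies in the subspace. If
  all functionals but one vanish, the surviving one must sit on that curve, which determines the
  index after the fact. This needs a finite index, hence the separate treatment of entire
  \<open>f\<close>, for which only one equation per n is available. There convergence enters through
  bounds: the \<open>Q_n\<close> have exact degree N, leading coefficient 1 and bounded
  coefficients, so on one large circle they behave like (c w)^N for all n, and
  \<open>[Q_n f]_n = 0\<close> bounds the coefficient of index n - N by the later ones. That there
  are no further system poles and no larger orders holds because a pole of \<open>f\<close> of order
  above the multiplicity would remain a pole of \<open>Q f\<close>.\<close>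

definition annulus :: "real \<Rightarrow> ereal \<Rightarrow> complex set" where
  "annulus a b = {w. a < norm w \<and> ereal (norm w) < b}"

text \<open>The radius is a parameter, as independence of it is a lemma. Only indices n \<ge> 0
  occur; the principal part is always handled as a single function.\<close>

definition laurent_coeff :: "real \<Rightarrow> (complex \<Rightarrow> complex) \<Rightarrow> nat \<Rightarrow> complex" where
  "laurent_coeff r h n =
     contour_integral (circlepath 0 r) (\<lambda>w. h w / w ^ (n + 1)) / (2 * of_real pi * \<i>)"

lemma mem_annulus: "w \<in> annulus a b \<longleftrightarrow> a < norm w \<and> ereal (norm w) < b"
  by (simp add: annulus_def)

lemma annulus_infinity: "annulus a \<infinity> = {w. a < norm w}"
  by (auto simp: annulus_def)

lemma open_annulus: "open (annulus a b)"
proof -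
  have "open {w::complex. ereal (norm w) < b}"
    by (intro open_Collect_less continuous_intros)
  moreover have "open {w::complex. a < norm w}"
    by (intro open_Collect_less continuous_intros)
  moreover have "annulus a b = {w. a < norm w} \<inter> {w. ereal (norm w) < b}"
    by (auto simp: annulus_def)
  ultimately show ?thesis by auto
qed

lemma sphere_subset_annulus: "\<lbrakk>a < r; ereal r < b\<rbrakk> \<Longrightarrow> sphere 0 r \<subseteq> annulus a b"
  by (auto simp: annulus_def)

lemma path_image_circlepath_annulus:
  "\<lbrakk>0 \<le> a; a < r; ereal r < b\<rbrakk> \<Longrightarrow> path_image (circlepath 0 r) \<subseteq> annulus a b"
  using sphere_subset_annulus by (auto simp: annulus_def)

lemma contour_integral_circlepath_annulus:
  assumes "\<phi> holomorphic_on annulus a b" "0 \<le> a" "a < r" "ereal r < b" "a < s" "ereal s < b"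
  shows "contour_integral (circlepath 0 r) \<phi> = contour_integral (circlepath 0 s) \<phi>"
proof (rule Cauchy_theorem_homotopic_loops[OF _ open_annulus assms(1)])
  show "homotopic_loops (annulus a b) (circlepath 0 r) (circlepath 0 s)"
  proof (rule homotopic_loops_linear)
    fix t x :: real assume t: "t \<in> {0..1}"
    define e where "e = exp (2 * of_real pi * \<i> * of_real t)"
    have e: "norm e = 1" by (simp add: e_def norm_exp_eq_Re)
    \<comment> \<open>At equal parameters the two circles have equal arguments, so the segment is
      radial and its moduli stay between r and s.\<close>
    show "closed_segment (circlepath 0 r t) (circlepath 0 s t) \<subseteq> annulus a b"
    proof
      fix z assume "z \<in> closed_segment (circlepath 0 r t) (circlepath 0 s t)"
      then obtain u where u: "0 \<le> u" "u \<le> 1"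
        and z: "z = (1 - u) *\<^sub>R (r * e) + u *\<^sub>R (s * e)"
        unfolding closed_segment_def by (auto simp: circlepath e_def)
      define q where "q = (1 - u) * r + u * s"
      have "z = of_real q * e"
        unfolding z q_def by (simp add: scaleR_conv_of_real algebra_simps)
      moreover have "min r s \<le> q" "q \<le> max r s"
        using segment_bound_lemma[of "min r s" r s u] convex_bound_le[of r "max r s" s "1-u" u] u
        unfolding q_def by auto
      ultimately show "z \<in> annulus a b"
        using assms e by (auto simp: mem_annulus norm_mult min_le_iff_disj le_max_iff_disj
            intro: le_less_trans[of _ "ereal r"] le_less_trans[of _ "ereal s"])
    qed
  qed auto
qed auto

text \<open>The difference quotient \<open>q\<close> has a removable singularity at w, so its
  integrals over the two circles agree. What remains is \<open>h w\<close> times the integral of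
  1/(u - w), which is 2 pi i on the outer circle and 0 on the inner one.\<close>

lemma Cauchy_integral_formula_annulus:
  assumes h: "h holomorphic_on annulus a b" and "0 \<le> a" "a < r" "r < norm w" "norm w < s" "ereal s < b"
  shows "contour_integral (circlepath 0 s) (\<lambda>u. h u / (u - w)) -
         contour_integral (circlepath 0 r) (\<lambda>u. h u / (u - w)) = 2 * of_real pi * \<i> * h w"
proof -
  define q where "q = (\<lambda>u. if u = w then deriv h w else (h u - h w) / (u - w))"
  have q: "q holomorphic_on annulus a b"
    unfolding q_def by (rule pole_lemma_open[OF h open_annulus])
  have sb: "ereal t < b" if "t \<le> s" for t
    using that assms(6) by (metis ereal_less_eq(3) le_less_trans)
  have "0 < r" "0 < s" using assms norm_ge_zero[of w] by linarith+
  have eq: "contour_integral (circlepath 0 t) (\<lambda>u. h u / (u - w)) =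
        contour_integral (circlepath 0 t) q + h w * contour_integral (circlepath 0 t) (\<lambda>u. 1 / (u - w))"
    if t: "a < t" "t \<le> s" "t \<noteq> norm w" for t
  proof -
    have "0 < t" using t assms by linarith
    have sub: "path_image (circlepath 0 t) \<subseteq> annulus a b"
      using path_image_circlepath_annulus[of a t b] t assms sb by blast
    have ne: "u \<noteq> w" if "u \<in> path_image (circlepath 0 t)" for u
      using that t \<open>0 < t\<close> by auto
    have i1: "q contour_integrable_on circlepath 0 t"
      using sub q contour_integrable_holomorphic_simple open_annulus valid_path_circlepath by blast
    have i2: "(\<lambda>u. 1 / (u - w)) contour_integrable_on circlepath 0 t"
      by (intro contour_integrable_continuous_circlepath continuous_intros) (use ne in auto)
    have "contour_integral (circlepath 0 t) (\<lambda>u. h u / (u - w)) =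
          contour_integral (circlepath 0 t) (\<lambda>u. q u + h w * (1 / (u - w)))"
    proof (rule contour_integral_cong[OF refl])
      fix u assume "u \<in> path_image (circlepath 0 t)"
      with ne have "u \<noteq> w" by blast
      then show "h u / (u - w) = q u + h w * (1 / (u - w))"
        by (simp add: q_def diff_divide_distrib)
    qed
    also have "\<dots> = contour_integral (circlepath 0 t) q + h w * contour_integral (circlepath 0 t) (\<lambda>u. 1 / (u - w))"
      using i1 i2 by (simp only: contour_integral_add contour_integrable_lmul contour_integral_lmul)
    finally show ?thesis .
  qed
  have c1: "contour_integral (circlepath 0 s) (\<lambda>u. 1 / (u - w)) = 2 * of_real pi * \<i>"
    using Cauchy_integral_circlepath_simple[of "\<lambda>_. 1" 0 s w] assms
    by (auto intro: contour_integral_unique)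
  have c2: "contour_integral (circlepath 0 r) (\<lambda>u. 1 / (u - w)) = 0"
    by (rule contour_integral_unique, rule Cauchy_theorem_convex_simple[of _ "ball 0 (norm w)"])
       (use assms \<open>0 < r\<close> in \<open>auto intro!: holomorphic_intros\<close>)
  have "contour_integral (circlepath 0 s) q = contour_integral (circlepath 0 r) q"
    by (rule contour_integral_circlepath_annulus[OF q]) (use assms sb in auto)
  then show ?thesis
    using eq[of r] eq[of s] c1 c2 assms by simp
qed

text \<open>On the circle of radius s the kernel 1/(u - w) is a geometric series in w/u whose ratio
  has modulus |w|/s < 1; uniform convergence allows termwise integration.\<close>

lemma outer_integral_sums:
  assumes h: "h holomorphic_on annulus a b" and "0 \<le> a" "a < s" "ereal s < b" "norm w < s"
  shows "(\<lambda>n. laurent_coeff s h n * w ^ n) sums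
     (contour_integral (circlepath 0 s) (\<lambda>u. h u / (u - w)) / (2 * of_real pi * \<i>))"
proof -
  have "0 < s" using assms by linarith
  have sub: "path_image (circlepath 0 s) \<subseteq> annulus a b"
    by (rule path_image_circlepath_annulus) (use assms in auto)
  have sph: "path_image (circlepath 0 s) = sphere 0 s" using \<open>0 < s\<close> by simp
  have cont: "continuous_on (sphere 0 s) h"
    using h sub sph by (metis continuous_on_subset holomorphic_on_imp_continuous_on)
  then have "compact (h ` sphere 0 s)" by (intro compact_continuous_image) auto
  then obtain B where B: "B > 0" "\<And>u. norm u = s \<Longrightarrow> norm (h u) \<le> B"
    using compact_imp_bounded[of "h ` sphere 0 s"] unfolding bounded_pos by auto
  have int: "(\<lambda>u. h u / u ^ (n+1)) contour_integrable_on circlepath 0 s" for n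
    unfolding sph by (intro contour_integrable_continuous_circlepath continuous_intros)
       (use cont sph \<open>0 < s\<close> in auto)
  have int': "(\<lambda>u. h u / u ^ (n+1) * w ^ n) contour_integrable_on circlepath 0 s" for n
    using int contour_integrable_rmul by blast
  have "uniform_limit (sphere 0 s) (\<lambda>n u. \<Sum>k<n. h u / u ^ (k+1) * w ^ k)
      (\<lambda>u. \<Sum>k. h u / u ^ (k+1) * w ^ k) sequentially"
  proof (rule Weierstrass_m_test)
    show "norm (h u / u ^ (n+1) * w ^ n) \<le> B / s * (norm w / s) ^ n" if "u \<in> sphere 0 s" for n u
    proof -
      have "norm (h u / u ^ (n+1) * w ^ n) = norm (h u) * (norm w ^ n / s ^ (n+1))"
        using that by (simp add: norm_mult norm_divide norm_power)
      also have "\<dots> \<le> B * (norm w ^ n / s ^ (n+1))"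
        using B(2)[of u] that \<open>0 < s\<close> by (intro mult_right_mono) auto
      finally show ?thesis by (simp add: power_divide)
    qed
    show "summable (\<lambda>n. B / s * (norm w / s) ^ n)"
      by (intro summable_mult summable_geometric) (use assms \<open>0 < s\<close> in auto)
  qed
  moreover have "(\<Sum>k. h u / u ^ (k+1) * w ^ k) = h u / (u - w)" if "u \<in> sphere 0 s" for u
  proof -
    have u: "norm u = s" "u \<noteq> 0" "u \<noteq> w" using that \<open>0 < s\<close> assms by auto
    have "(\<lambda>k. (w / u) ^ k) sums (1 / (1 - w / u))"
      by (rule geometric_sums) (use u assms in \<open>auto simp: norm_divide\<close>)
    then have "(\<lambda>k. h u / u * (w / u) ^ k) sums (h u / u * (1 / (1 - w / u)))"
      by (rule sums_mult)
    moreover have "h u / u * (1 / (1 - w / u)) = h u / (u - w)"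
      using u by (simp add: field_simps)
    moreover have "(\<lambda>k. h u / u * (w / u) ^ k) = (\<lambda>k. h u / u ^ (k+1) * w ^ k)"
      by (simp add: power_divide fun_eq_iff)
    ultimately show ?thesis by (metis sums_unique)
  qed
  ultimately have ul: "uniform_limit (sphere 0 s) (\<lambda>n u. \<Sum>k<n. h u / u ^ (k+1) * w ^ k)
      (\<lambda>u. h u / (u - w)) sequentially"
    by (subst uniform_limit_cong'[of _ _ _ _ "\<lambda>u. \<Sum>k. h u / u ^ (k+1) * w ^ k"]) auto
  have "(\<lambda>n. contour_integral (circlepath 0 s) (\<lambda>u. \<Sum>k<n. h u / u ^ (k+1) * w ^ k))
     \<longlonglongrightarrow> contour_integral (circlepath 0 s) (\<lambda>u. h u / (u - w))"
    by (rule contour_integral_uniform_limit_circlepath[OF _ ul _ \<open>0 < s\<close>])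
       (auto intro!: always_eventually contour_integrable_sum int'[simplified])
  moreover have "contour_integral (circlepath 0 s) (\<lambda>u. \<Sum>k<n. h u / u ^ (k+1) * w ^ k) =
     (\<Sum>k<n. contour_integral (circlepath 0 s) (\<lambda>u. h u / u ^ (k+1)) * w ^ k)" for n
    using int int' by (simp only: contour_integral_sum[OF finite_lessThan] contour_integral_rmul)
  ultimately have "(\<lambda>k. contour_integral (circlepath 0 s) (\<lambda>u. h u / u ^ (k+1)) * w ^ k) sums
      contour_integral (circlepath 0 s) (\<lambda>u. h u / (u - w))"
    unfolding sums_def by simp
  from sums_divide[OF this, of "2 * of_real pi * \<i>"] show ?thesis
    by (simp add: laurent_coeff_def)
qed

text \<open>Up to a constant factor this is the principal part of a Laurent expansion, kept as one
  function: its holomorphy outside the circle and its decay at infinity are what later arguments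
  use.\<close>

lemma inner_integral:
  assumes cont: "continuous_on (sphere 0 r) h" and "0 < r"
  defines "H \<equiv> \<lambda>w. contour_integral (circlepath 0 r) (\<lambda>u. h u / (u - w))"
  shows "H holomorphic_on {w. r < norm w}"
    and "\<exists>C\<ge>0. \<forall>w. 2 * r \<le> norm w \<longrightarrow> norm (H w) \<le> C / norm w"
proof -
  have sph: "path_image (circlepath 0 r) = sphere 0 r" using \<open>0 < r\<close> by simp
  have int: "((\<lambda>u. h u / (u - w)) has_contour_integral H w) (circlepath 0 r)" if "norm w \<noteq> r" for w
    unfolding H_def
    by (intro has_contour_integral_integral contour_integrable_continuous_circlepath
        continuous_intros) (use cont sph that in auto)
  have "(H has_field_derivative (of_nat 1 * contour_integral (circlepath 0 r) (\<lambda>u. h u / (u - w) ^ Suc 1))) (at w)"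
    if "r < norm w" for w
    by (rule Cauchy_next_derivative(2)[where S = UNIV and B = "2 * pi * \<bar>r\<bar>"])
       (use cont sph that int \<open>0 < r\<close> in \<open>auto simp: vector_derivative_circlepath norm_mult\<close>)
  then show "H holomorphic_on {w. r < norm w}"
    by (auto simp: holomorphic_on_def field_differentiable_def intro: has_field_derivative_at_within)
  have "compact (h ` sphere 0 r)" using cont by (intro compact_continuous_image) auto
  then obtain B where B: "B > 0" "\<And>u. norm u = r \<Longrightarrow> norm (h u) \<le> B"
    using compact_imp_bounded[of "h ` sphere 0 r"] unfolding bounded_pos by auto
  \<comment> \<open>For |w| \<ge> 2 r one has |u - w| \<ge> |w|/2, and the circle has length 2 pi
    r.\<close>
  have "norm (H w) \<le> (4 * pi * r * B) / norm w" if "2 * r \<le> norm w" for w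
  proof -
    have "norm w > 0" "norm w > r" using that \<open>0 < r\<close> by linarith+
    have "norm (H w) \<le> (B * (2 / norm w)) * (2 * pi * r)"
    proof (rule has_contour_integral_bound_circlepath[OF int])
      fix u :: complex assume "norm (u - 0) = r"
      then have u: "norm u = r" by simp
      have "norm w / 2 \<le> norm (u - w)"
        using norm_triangle_ineq2[of w u] u that by (simp add: norm_minus_commute)
      then have "1 / norm (u - w) \<le> 2 / norm w"
        using \<open>norm w > 0\<close> frac_le[of 1 1 "norm w / 2" "norm (u - w)"] by simp
      then have "norm (h u) * (1 / norm (u - w)) \<le> B * (2 / norm w)"
        using B u by (intro mult_mono) auto
      then show "norm (h u / (u - w)) \<le> B * (2 / norm w)"
        by (simp add: norm_divide)
    qed (use B \<open>0 < r\<close> \<open>norm w > r\<close> in auto)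
    then show ?thesis by (simp add: algebra_simps)
  qed
  then show "\<exists>C\<ge>0. \<forall>w. 2 * r \<le> norm w \<longrightarrow> norm (H w) \<le> C / norm w"
    using B \<open>0 < r\<close> by (intro exI[of _ "4 * pi * r * B"]) auto
qed

lemma laurent_coeff_radius:
  assumes "h holomorphic_on annulus a b" "0 \<le> a" "a < r" "ereal r < b" "a < s" "ereal s < b"
  shows "laurent_coeff r h n = laurent_coeff s h n"
proof -
  have "(\<lambda>w. h w / w ^ (n+1)) holomorphic_on annulus a b"
    using assms by (intro holomorphic_intros) (auto simp: mem_annulus)
  then show ?thesis
    unfolding laurent_coeff_def using contour_integral_circlepath_annulus assms by metis
qed

text \<open>The Cauchy formula splits h into an outer integral, which is the power series, and minus
  an inner integral, which is H. The radius s of the coefficients and the radius r beyond which H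
  lives are independent.\<close>

lemma laurent_decomposition:
  assumes h: "h holomorphic_on annulus a b" and "0 \<le> a" "a < s" "ereal s < b" "a < r" "ereal r < b"
  obtains H C where "H holomorphic_on {w. r < norm w}" "C \<ge> 0"
    "\<And>w. 2 * r \<le> norm w \<Longrightarrow> norm (H w) \<le> C / norm w"
    "\<And>w. w \<in> annulus r b \<Longrightarrow> (\<lambda>n. laurent_coeff s h n * w ^ n) sums (h w - H w)"
proof -
  have "0 < r" using assms by linarith
  have cont: "continuous_on (sphere 0 r) h"
    using h sphere_subset_annulus[of a r b] assms holomorphic_on_imp_continuous_on continuous_on_subset
    by blast
  define K where "K = (\<lambda>w. contour_integral (circlepath 0 r) (\<lambda>u. h u / (u - w)))"
  define H where "H = (\<lambda>w. - K w / (2 * of_real pi * \<i>))"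
  obtain C where C: "C \<ge> 0" "\<And>w. 2 * r \<le> norm w \<Longrightarrow> norm (K w) \<le> C / norm w"
    using inner_integral(2)[OF cont \<open>0 < r\<close>] unfolding K_def by auto
  show ?thesis
  proof
    show "H holomorphic_on {w. r < norm w}"
      unfolding H_def K_def by (intro holomorphic_intros inner_integral(1)[OF cont \<open>0 < r\<close>]) auto
    show "0 \<le> C / (2 * pi)" using C by simp
    show "norm (H w) \<le> C / (2 * pi) / norm w" if "2 * r \<le> norm w" for w
      using C(2)[OF that] by (simp add: H_def norm_divide norm_mult field_simps)
    show "(\<lambda>n. laurent_coeff s h n * w ^ n) sums (h w - H w)" if w: "w \<in> annulus r b" for w
    proof -
      \<comment> \<open>The circle of radius s may fail to enclose w, so the series is obtained on a
        circle of radius t beyond w and its coefficients are moved back to s.\<close>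
      obtain t where t: "ereal (norm w) < ereal t" "ereal t < b"
        using w ereal_dense2[of "ereal (norm w)" b] by (auto simp: mem_annulus)
      have t': "a < t" "norm w < t" using t w assms by (auto simp: mem_annulus)
      have "(\<lambda>n. laurent_coeff t h n * w ^ n) sums
         (contour_integral (circlepath 0 t) (\<lambda>u. h u / (u - w)) / (2 * of_real pi * \<i>))"
        using outer_integral_sums[OF h] t t' assms by simp
      moreover have "contour_integral (circlepath 0 t) (\<lambda>u. h u / (u - w)) = K w + 2 * of_real pi * \<i> * h w"
        using Cauchy_integral_formula_annulus[OF h, of r w t] assms w t t'
        by (simp add: K_def mem_annulus algebra_simps)
      then have "contour_integral (circlepath 0 t) (\<lambda>u. h u / (u - w)) / (2 * of_real pi * \<i>) = h w - H w"
        by (simp add: H_def field_simps)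
      ultimately show ?thesis
        using laurent_coeff_radius[OF h, of t s] assms t t' by simp
    qed
  qed
qed

lemma laurent_coeff_bound:
  assumes h: "h holomorphic_on annulus a b" and "0 \<le> a" "a < s" "ereal s < b" "a < r" "ereal r < b"
  shows "\<exists>C\<ge>0. \<forall>n. norm (laurent_coeff s h n) \<le> C / r ^ n"
proof -
  have "0 < r" using assms by linarith
  have cont: "continuous_on (sphere 0 r) h"
    using h sphere_subset_annulus[of a r b] assms holomorphic_on_imp_continuous_on continuous_on_subset
    by blast
  have sph: "path_image (circlepath 0 r) = sphere 0 r" using \<open>0 < r\<close> by simp
  have "compact (h ` sphere 0 r)" using cont by (intro compact_continuous_image) auto
  then obtain B where B: "B > 0" "\<And>u. norm u = r \<Longrightarrow> norm (h u) \<le> B"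
    using compact_imp_bounded[of "h ` sphere 0 r"] unfolding bounded_pos by auto
  have "norm (laurent_coeff s h n) \<le> B / r ^ n" for n
  proof -
    have "norm (contour_integral (circlepath 0 r) (\<lambda>w. h w / w ^ (n + 1))) \<le> B / r ^ (n+1) * (2 * pi * r)"
    proof (rule has_contour_integral_bound_circlepath)
      show "((\<lambda>w. h w / w ^ (n + 1)) has_contour_integral
          contour_integral (circlepath 0 r) (\<lambda>w. h w / w ^ (n + 1))) (circlepath 0 r)"
        by (intro has_contour_integral_integral contour_integrable_continuous_circlepath
            continuous_intros) (use cont sph \<open>0 < r\<close> in auto)
    qed (use B \<open>0 < r\<close> in \<open>auto simp: norm_divide norm_mult norm_power divide_simps\<close>)
    then have "norm (laurent_coeff r h n) \<le> B / r ^ n"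
      using \<open>0 < r\<close> by (simp add: laurent_coeff_def norm_divide norm_mult field_simps)
    then show ?thesis using laurent_coeff_radius[OF h, of r s] assms by simp
  qed
  then show ?thesis using B by (intro exI[of _ B]) auto
qed

text \<open>This is a residue at infinity: the integral does not depend on the radius, and on a
  large circle of radius s the integrand differs from L/w by at most \<epsilon>/s, which contributes
  at most 2 pi \<epsilon>.\<close>

lemma contour_integral_at_infinity:
  assumes \<phi>: "\<phi> holomorphic_on {w. a < norm w}" and lim: "((\<lambda>w. w * \<phi> w) \<longlongrightarrow> L) at_infinity"
    and "0 \<le> a" "a < r"
  shows "contour_integral (circlepath 0 r) \<phi> = 2 * of_real pi * \<i> * L"
proof -
  have "norm (contour_integral (circlepath 0 r) \<phi> - 2 * of_real pi * \<i> * L) \<le> \<epsilon> * (2 * pi)"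
    if \<epsilon>: "\<epsilon> > 0" for \<epsilon>
  proof -
    from lim \<epsilon> have "\<forall>\<^sub>F w in at_infinity. dist (w * \<phi> w) L < \<epsilon>"
      by (simp add: tendsto_iff)
    then obtain M where M: "\<And>w. M \<le> norm w \<Longrightarrow> dist (w * \<phi> w) L < \<epsilon>"
      by (auto simp: eventually_at_infinity)
    define s where "s = max (a + 1) M"
    have s: "a < s" "M \<le> s" "0 < s" using assms by (auto simp: s_def)
    have eq: "contour_integral (circlepath 0 r) \<phi> = contour_integral (circlepath 0 s) \<phi>"
      using contour_integral_circlepath_annulus[of \<phi> a \<infinity> r s] assms s by (simp add: annulus_infinity)
    have sub: "path_image (circlepath 0 s) \<subseteq> {w. a < norm w}"
      using s by auto
    have op: "open {w::complex. a < norm w}"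
      using open_annulus[of a \<infinity>] by (simp add: annulus_infinity)
    have 1: "(\<phi> has_contour_integral contour_integral (circlepath 0 s) \<phi>) (circlepath 0 s)"
      using has_contour_integral_integral contour_integrable_holomorphic_simple[OF \<phi> op _ sub] by simp
    have 2: "((\<lambda>u. L / (u - 0)) has_contour_integral 2 * of_real pi * \<i> * L) (circlepath 0 s)"
      using Cauchy_integral_circlepath_simple[of "\<lambda>_. L" 0 s 0] s by simp
    have "norm (contour_integral (circlepath 0 s) \<phi> - 2 * of_real pi * \<i> * L) \<le> (\<epsilon> / s) * (2 * pi * s)"
    proof (rule has_contour_integral_bound_circlepath[OF has_contour_integral_diff[OF 1 2]])
      fix u :: complex assume "norm (u - 0) = s"
      then have u: "norm u = s" "u \<noteq> 0" using s by auto
      have "\<phi> u - L / (u - 0) = (u * \<phi> u - L) / u" using u by (simp add: field_simps)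
      then have "norm (\<phi> u - L / (u - 0)) = dist (u * \<phi> u) L / s"
        using u by (simp add: norm_divide dist_norm)
      also have "\<dots> \<le> \<epsilon> / s" using M[of u] u s by (intro divide_right_mono) auto
      finally show "norm (\<phi> u - L / (u - 0)) \<le> \<epsilon> / s" .
    qed (use s \<epsilon> in auto)
    then show ?thesis using eq s by simp
  qed
  then have "norm (contour_integral (circlepath 0 r) \<phi> - 2 * of_real pi * \<i> * L) \<le> 0 + e" if "e > 0" for e
    using that by (metis add_0 divide_pos_pos nonzero_eq_divide_eq pi_neq_zero zero_less_mult_iff
        mult_eq_0_iff zero_neq_numeral pi_gt_zero zero_less_numeral)
  then show ?thesis using field_le_epsilon[of _ 0] by (metis norm_le_zero_iff right_minus_eq add_0)
qed

lemma contour_integrable_circlepath_annulus: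
  assumes "f holomorphic_on annulus a b" "0 \<le> a" "a < r" "ereal r < b"
  shows "f contour_integrable_on circlepath 0 r"
  using contour_integrable_holomorphic_simple[OF assms(1) open_annulus _
      path_image_circlepath_annulus[OF assms(2-4)]] by simp

lemma laurent_coeff_add:
  assumes "f holomorphic_on annulus a b" "g holomorphic_on annulus a b" "0 \<le> a" "a < r" "ereal r < b"
  shows "laurent_coeff r (\<lambda>w. f w + g w) n = laurent_coeff r f n + laurent_coeff r g n"
proof -
  have i: "(\<lambda>w. f w / w ^ (n+1)) contour_integrable_on circlepath 0 r"
    "(\<lambda>w. g w / w ^ (n+1)) contour_integrable_on circlepath 0 r"
    by (rule contour_integrable_circlepath_annulus[of _ a b];
        use assms in \<open>auto intro!: holomorphic_intros simp: mem_annulus\<close>)+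
  show ?thesis
    unfolding laurent_coeff_def add_divide_distrib contour_integral_add[OF i] ..
qed

lemma laurent_coeff_cmult:
  assumes "f holomorphic_on annulus a b" "0 \<le> a" "a < r" "ereal r < b"
  shows "laurent_coeff r (\<lambda>w. c * f w) n = c * laurent_coeff r f n"
proof -
  have i: "(\<lambda>w. f w / w ^ (n+1)) contour_integrable_on circlepath 0 r"
    by (rule contour_integrable_circlepath_annulus[of _ a b];
        use assms in \<open>auto intro!: holomorphic_intros simp: mem_annulus\<close>)
  show ?thesis
    using contour_integral_lmul[OF i, of c] by (simp add: laurent_coeff_def)
qed

lemma tendsto_inverse_at_infinity: "((\<lambda>w::complex. 1 / w) \<longlongrightarrow> 0) at_infinity"
  using tendsto_inverse_0[where 'a = complex] unfolding inverse_eq_divide .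

text \<open>Losing at most half per step is incompatible with decay like 4^-p: iteration gives
  \<open>T p \<le> 2 ^ k * T (p + k)\<close>, hence a bound C * 2^-k for every k.\<close>

lemma vanishing_tail_sequence:
  fixes T :: "nat \<Rightarrow> real"
  assumes "\<And>p. T p \<ge> 0" "\<And>p. p \<ge> p0 \<Longrightarrow> T p \<le> 2 * T (Suc p)" "\<And>p. T p \<le> C / 4 ^ p"
    and "p \<ge> p0"
  shows "T p = 0"
proof -
  have 1: "T p \<le> 2 ^ k * T (p + k)" for k
  proof (induction k)
    case (Suc k)
    have "2 ^ k * T (p + k) \<le> 2 ^ k * (2 * T (Suc (p + k)))"
      by (intro mult_left_mono assms(2)) (use \<open>p \<ge> p0\<close> in auto)
    with Suc have "T p \<le> 2 ^ k * (2 * T (Suc (p + k)))" by (rule order_trans)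
    then show ?case by (simp add: mult_ac)
  qed simp
  have "C \<ge> 0" using assms(1)[of 0] assms(3)[of 0] by simp
  have 2: "T p \<le> C * (1 / 2) ^ k" for k
  proof -
    have "T p \<le> 2 ^ k * (C / 4 ^ (p + k))"
      using 1[of k] mult_left_mono[OF assms(3)[of "p + k"], of "2 ^ k"] by simp
    also have "\<dots> \<le> 2 ^ k * (C / 4 ^ k)"
      using \<open>C \<ge> 0\<close> by (intro mult_left_mono divide_left_mono) (auto simp: power_add)
    also have "\<dots> = C * (1 / 2) ^ k"
    proof -
      have "(4::real) ^ k = 2 ^ k * 2 ^ k" by (simp flip: power_mult_distrib)
      then show ?thesis by (simp add: power_divide)
    qed
    finally show ?thesis .
  qed
  have "(\<lambda>k. C * (1 / 2) ^ k) \<longlonglongrightarrow> C * 0"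
    by (intro tendsto_intros LIMSEQ_realpow_zero) auto
  then have "T p \<le> 0" using 2 LIMSEQ_le_const by fastforce
  with assms(1)[of p] show ?thesis by simp
qed

lemma inner_part_tendsto_0:
  assumes "\<And>w::complex. M \<le> norm w \<Longrightarrow> norm (H w :: complex) \<le> C / norm w"
  shows "(H \<longlongrightarrow> 0) at_infinity"
proof (rule Lim_null_comparison)
  show "\<forall>\<^sub>F w in at_infinity. norm (H w) \<le> C * norm (1 / w)"
    unfolding eventually_at_infinity using assms by (auto simp: norm_divide)
  have "((\<lambda>w::complex. C * norm (1 / w)) \<longlongrightarrow> C * norm (0::complex)) at_infinity"
    by (intro tendsto_intros tendsto_inverse_at_infinity)
  then show "((\<lambda>w::complex. C * norm (1 / w)) \<longlongrightarrow> 0) at_infinity" by simp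
qed

text \<open>Divided by w^n, the powers below n become positive powers of 1/w; as H tends to 0,
  nothing survives, even for n = 0.\<close>

lemma low_part_lim:
  assumes H: "(H \<longlongrightarrow> 0) at_infinity"
  shows "((\<lambda>w::complex. (H w + (\<Sum>l<n. a l * w ^ l)) / w ^ n) \<longlongrightarrow> 0) at_infinity"
proof -
  have "((\<lambda>w::complex. H w * (1 / w) ^ n + (\<Sum>l<n. a l * (1 / w) ^ (n - l))) \<longlongrightarrow>
         0 * 0 ^ n + (\<Sum>l<n. a l * 0 ^ (n - l))) at_infinity"
    by (intro tendsto_intros H tendsto_inverse_at_infinity)
  moreover have lim: "0 * 0 ^ n + (\<Sum>l<n. a l * 0 ^ (n - l)) = 0"
    by (auto intro!: sum.neutral)
  moreover have "\<forall>\<^sub>F w in at_infinity. H w * (1 / w) ^ n + (\<Sum>l<n. a l * (1 / w) ^ (n - l)) =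
        (H w + (\<Sum>l<n. a l * w ^ l)) / w ^ n"
    using eventually_not_equal_at_infinity[of 0]
  proof eventually_elim
    case (elim w)
    have "(1 / w) ^ (n - l) = w ^ l / w ^ n" if "l < n" for l
    proof -
      have "w ^ n = w ^ l * w ^ (n - l)" using that by (simp flip: power_add)
      then show ?thesis using elim by (simp add: power_divide)
    qed
    then show ?case
      by (simp add: add_divide_distrib sum_divide_distrib power_divide)
  qed
  ultimately have "((\<lambda>w::complex. (H w + (\<Sum>l<n. a l * w ^ l)) / w ^ n) \<longlongrightarrow>
      0 * 0 ^ n + (\<Sum>l<n. a l * 0 ^ (n - l))) at_infinity"
    by (blast intro: Lim_transform_eventually)
  then show ?thesis unfolding lim .
qed

subsection \<open>Polynomials, Taylor coefficients and linear systems\<close>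

lemma poly_eq_sum_le:
  fixes p :: "'a::comm_semiring_1 poly"
  assumes "degree p \<le> n"
  shows "poly p x = (\<Sum>i\<le>n. coeff p i * x ^ i)"
  unfolding poly_altdef
  by (rule sum.mono_neutral_left) (use assms in \<open>auto simp: coeff_eq_0\<close>)

lemma analytic_on_poly_fun [analytic_intros]: "poly (p :: complex poly) analytic_on S"
proof -
  have "poly p holomorphic_on UNIV" by (intro holomorphic_intros)
  then show ?thesis
    by (metis analytic_on_open analytic_on_subset open_UNIV subset_UNIV)
qed

lemma sum_order_eq_degree:
  fixes p :: "complex poly"
  assumes "p \<noteq> 0"
  shows "(\<Sum>z | poly p z = 0. order z p) = degree p"
proof -
  have "degree p = degree (smult (lead_coeff p) (\<Prod>z | poly p z = 0. [:- z, 1:] ^ order z p))"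
    by (simp only: complex_poly_decompose)
  also have "\<dots> = degree (\<Prod>z | poly p z = 0. [:- z, 1:] ^ order z p)"
    using assms by simp
  also have "\<dots> = (\<Sum>z | poly p z = 0. degree ([:- z, 1:] ^ order z p))"
    by (rule degree_prod_eq_sum_degree) auto
  finally show ?thesis by (simp add: degree_linear_power)
qed

text \<open>Elimination: an equation with a nonzero coefficient at p is solved for the unknown p,
  which leaves one equation and one unknown less.\<close>

lemma homogeneous_system_nontrivial:
  fixes a :: "'j \<Rightarrow> 'i \<Rightarrow> 'a::field"
  assumes "finite J" "finite I" "card J < card I"
  shows "\<exists>x. (\<exists>i\<in>I. x i \<noteq> 0) \<and> (\<forall>i. i \<notin> I \<longrightarrow> x i = 0) \<and> (\<forall>j\<in>J. (\<Sum>i\<in>I. a j i * x i) = 0)"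
  using assms
proof (induction J arbitrary: I a rule: finite_induct)
  case empty
  then obtain p where "p \<in> I" by fastforce
  then show ?case by (intro exI[of _ "\<lambda>i. if i = p then 1 else 0"]) auto
next
  case (insert j J)
  show ?case
  proof (cases "\<forall>i\<in>I. a j i = 0")
    case True
    have "card J < card I" using insert by simp
    from insert.IH[OF \<open>finite I\<close> this, of a] True show ?thesis by auto
  next
    case False
    then obtain p where p: "p \<in> I" "a j p \<noteq> 0" by blast
    define a' where "a' = (\<lambda>j' i. a j' i - a j' p * a j i / a j p)"
    have "card J < card (I - {p})" using insert p by simp
    with insert.IH[of "I - {p}" a'] insert.prems obtain x where
      x: "\<exists>i\<in>I - {p}. x i \<noteq> 0" "\<forall>i. i \<notin> I - {p} \<longrightarrow> x i = 0"
        "\<forall>j'\<in>J. (\<Sum>i\<in>I - {p}. a' j' i * x i) = 0" by auto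
    define s where "s = (\<Sum>i\<in>I - {p}. a j i * x i)"
    define y where "y = x(p := - s / a j p)"
    have sum: "(\<Sum>i\<in>I. a j' i * y i) = (\<Sum>i\<in>I - {p}. a j' i * x i) - a j' p * s / a j p" for j'
    proof -
      have "(\<Sum>i\<in>I. a j' i * y i) = a j' p * y p + (\<Sum>i\<in>I - {p}. a j' i * y i)"
        by (rule sum.remove) (use insert.prems p in auto)
      also have "(\<Sum>i\<in>I - {p}. a j' i * y i) = (\<Sum>i\<in>I - {p}. a j' i * x i)"
        by (rule sum.cong) (auto simp: y_def)
      finally show ?thesis by (simp add: y_def)
    qed
    have "(\<Sum>i\<in>I. a j' i * y i) = 0" if "j' \<in> insert j J" for j'
    proof (cases "j' = j")
      case True
      then show ?thesis using sum[of j] p by (simp add: s_def)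
    next
      case False
      have "(\<Sum>i\<in>I - {p}. a' j' i * x i) = (\<Sum>i\<in>I - {p}. a j' i * x i) - a j' p * s / a j p"
        by (simp add: a'_def s_def algebra_simps sum_subtractf sum_distrib_left sum_divide_distrib)
      then show ?thesis using sum x(3) that False by simp
    qed
    moreover have "\<exists>i\<in>I. y i \<noteq> 0" using x(1) by (auto simp: y_def)
    moreover have "\<forall>i. i \<notin> I \<longrightarrow> y i = 0" using x(2) p by (auto simp: y_def)
    ultimately show ?thesis by blast
  qed
qed

text \<open>This extends a linear form from a subspace to the whole coordinate space. Coordinates
  are added one at a time: if some \<open>x0\<close> in S has a nonzero entry at p, subtracting a
  multiple of it reduces x to the support I.\<close>

lemma subspace_functional_coefficients:
  fixes S :: "('i \<Rightarrow> 'a::field) set" and L :: "('i \<Rightarrow> 'a) \<Rightarrow> 'a"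
  assumes "finite I"
    and S: "\<And>x y u v. \<lbrakk>x \<in> S; y \<in> S\<rbrakk> \<Longrightarrow> (\<lambda>i. u * x i + v * y i) \<in> S"
    and L: "\<And>x y u v. \<lbrakk>x \<in> S; y \<in> S\<rbrakk> \<Longrightarrow> L (\<lambda>i. u * x i + v * y i) = u * L x + v * L y"
  shows "\<exists>a. \<forall>x\<in>S. (\<forall>i. i \<notin> I \<longrightarrow> x i = 0) \<longrightarrow> L x = (\<Sum>i\<in>I. a i * x i)"
  using assms(1)
proof (induction I rule: finite_induct)
  case empty
  have "L x = 0" if "x \<in> S" "\<forall>i. x i = 0" for x
  proof -
    have "(\<lambda>i. 0 * x i + 0 * x i) = x" using that(2) by auto
    then show ?thesis using L[OF that(1) that(1), of 0 0] by simp
  qed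
  then show ?case by (unfold sum.empty) blast
next
  case (insert p I)
  then obtain a where a: "\<And>x. \<lbrakk>x \<in> S; \<forall>i. i \<notin> I \<longrightarrow> x i = 0\<rbrakk> \<Longrightarrow> L x = (\<Sum>i\<in>I. a i * x i)" by blast
  show ?case
  proof (cases "\<exists>x0\<in>S. (\<forall>i. i \<notin> insert p I \<longrightarrow> x0 i = 0) \<and> x0 p \<noteq> 0")
    case False
    have "L x = (\<Sum>i\<in>insert p I. a i * x i)" if x: "x \<in> S" "\<forall>i. i \<notin> insert p I \<longrightarrow> x i = 0" for x
    proof -
      have "x p = 0" using False x by blast
      then have "\<forall>i. i \<notin> I \<longrightarrow> x i = 0" using x(2) by (metis insertE)
      from a[OF x(1) this] show ?thesis using insert.hyps \<open>x p = 0\<close> by simp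
    qed
    then show ?thesis by blast
  next
    case True
    then obtain x0 where x0: "x0 \<in> S" "\<forall>i. i \<notin> insert p I \<longrightarrow> x0 i = 0" "x0 p \<noteq> 0" by blast
    \<comment> \<open>The coefficient at p is the one that makes the formula exact at
      \<open>x0\<close>.\<close>
    define b where "b = a(p := (L x0 - (\<Sum>i\<in>I. a i * x0 i)) / x0 p)"
    have b: "(\<Sum>i\<in>I. b i * f i) = (\<Sum>i\<in>I. a i * f i)" for f
      by (rule sum.cong) (use insert.hyps in \<open>auto simp: b_def\<close>)
    have "L x = (\<Sum>i\<in>insert p I. b i * x i)" if x: "x \<in> S" "\<forall>i. i \<notin> insert p I \<longrightarrow> x i = 0" for x
    proof -
      define c where "c = x p / x0 p"
      have "(\<lambda>i. 1 * x i + (- c) * x0 i) \<in> S" by (rule S) (use x x0 in auto)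
      moreover have "\<forall>i. i \<notin> I \<longrightarrow> 1 * x i + (- c) * x0 i = 0"
      proof (intro allI impI)
        fix i assume "i \<notin> I"
        then show "1 * x i + (- c) * x0 i = 0"
          using x(2) x0(2,3) by (cases "i = p") (simp_all add: c_def)
      qed
      ultimately have "L (\<lambda>i. 1 * x i + (- c) * x0 i) = (\<Sum>i\<in>I. a i * (1 * x i + (- c) * x0 i))"
        by (rule a)
      moreover have "L (\<lambda>i. 1 * x i + (- c) * x0 i) = 1 * L x + (- c) * L x0"
        by (rule L) (use x x0 in auto)
      moreover have "(\<Sum>i\<in>I. a i * (1 * x i + (- c) * x0 i)) = (\<Sum>i\<in>I. a i * x i) - c * (\<Sum>i\<in>I. a i * x0 i)"
        by (simp add: algebra_simps sum_subtractf sum_distrib_left)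
      ultimately have "1 * L x + (- c) * L x0 = (\<Sum>i\<in>I. a i * x i) - c * (\<Sum>i\<in>I. a i * x0 i)"
        by (simp only:)
      then have "L x = (\<Sum>i\<in>I. a i * x i) + c * (L x0 - (\<Sum>i\<in>I. a i * x0 i))"
        by (simp add: algebra_simps)
      also have "c * (L x0 - (\<Sum>i\<in>I. a i * x0 i)) = b p * x p"
        by (simp add: b_def c_def)
      finally show ?thesis using insert.hyps b by (simp add: add.commute)
    qed
    then show ?thesis by blast
  qed
qed

lemma poly_order_factor:
  fixes q :: "'a::idom poly"
  assumes "q \<noteq> 0"
  obtains R where "\<And>w. poly q w = (w - \<zeta>) ^ order \<zeta> q * poly R w" "poly R \<zeta> \<noteq> 0"
proof -
  obtain R where R: "q = [:- \<zeta>, 1:] ^ order \<zeta> q * R" "\<not> [:- \<zeta>, 1:] dvd R"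
    using order_decomp[OF assms] by blast
  have "poly q w = (w - \<zeta>) ^ order \<zeta> q * poly R w" for w
    by (subst R(1)) simp
  moreover have "poly R \<zeta> \<noteq> 0" using R(2) by (simp add: poly_eq_0_iff_dvd)
  ultimately show ?thesis using that by blast
qed

definition taylor_coeff :: "(complex \<Rightarrow> complex) \<Rightarrow> complex \<Rightarrow> nat \<Rightarrow> complex" where
  "taylor_coeff h z j = fps_nth (fps_expansion h z) j"

lemma fps_expansion_shift_eqI:
  "(\<lambda>x. h (z + x)) has_fps_expansion P \<Longrightarrow> fps_expansion h z = P"
  using fps_expansion_unique_complex[OF analytic_at_imp_has_fps_expansion] has_fps_expansion_imp_analytic
  by blast

lemma taylor_coeff_linear:
  assumes "f analytic_on {z}" "g analytic_on {z}" and ev: "\<forall>\<^sub>F w in nhds z. h w = u * f w + v * g w"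
  shows "taylor_coeff h z j = u * taylor_coeff f z j + v * taylor_coeff g z j"
proof -
  have "(\<lambda>x. u * f (z + x) + v * g (z + x)) has_fps_expansion
      fps_const u * fps_expansion f z + fps_const v * fps_expansion g z"
    by (intro fps_expansion_intros analytic_at_imp_has_fps_expansion assms)
  moreover have "\<forall>\<^sub>F x in nhds 0. u * f (z + x) + v * g (z + x) = h (z + x)"
  proof -
    have "filterlim (\<lambda>x. z + x) (nhds z) (nhds 0)"
      using tendsto_add[OF tendsto_const, of "\<lambda>x. x" 0 "nhds 0" z] by (simp add: tendsto_ident_at filterlim_ident)
    from filterlim_iff[THEN iffD1, OF this, rule_format, OF ev] show ?thesis
      by eventually_elim simp
  qed
  ultimately have "(\<lambda>x. h (z + x)) has_fps_expansion
      fps_const u * fps_expansion f z + fps_const v * fps_expansion g z"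
    by (subst (asm) has_fps_expansion_cong) auto
  then show ?thesis by (simp add: taylor_coeff_def fps_expansion_shift_eqI)
qed

text \<open>Division by (w - z)^n shifts the expansion by n. The constant term of the shifted series
  is the n-th coefficient, so \<open>K z\<close> tells whether the zero has order exactly n.\<close>

lemma taylor_factor:
  assumes h: "h analytic_on {z}" and zero: "\<And>j. j < n \<Longrightarrow> taylor_coeff h z j = 0"
  obtains K where "K analytic_on {z}" "\<forall>\<^sub>F w in nhds z. h w = (w - z) ^ n * K w"
    "K z = taylor_coeff h z n"
proof -
  define P where "P = fps_expansion h z"
  have P: "(\<lambda>x. h (z + x)) has_fps_expansion P"
    unfolding P_def using h by (rule analytic_at_imp_has_fps_expansion)
  have nth: "fps_nth P j = taylor_coeff h z j" for j by (simp add: P_def taylor_coeff_def)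
  have lim: "filterlim (\<lambda>w. w - z) (nhds 0) (nhds z)"
    using tendsto_diff[of "\<lambda>w. w" z "nhds z" "\<lambda>_. z" z] by (simp add: filterlim_ident)
  show ?thesis
  proof (cases "P = 0")
    \<comment> \<open>The zero series is treated apart because its \<open>subdegree\<close> is 0 and
      gives no bound for n.\<close>
    case True
    then have "\<forall>\<^sub>F x in nhds 0. h (z + x) = 0" using P by (simp add: has_fps_expansion_0_iff)
    from filterlim_iff[THEN iffD1, OF lim, rule_format, OF this]
    have "\<forall>\<^sub>F w in nhds z. h w = (w - z) ^ n * 0" by simp
    then show ?thesis using that[of "\<lambda>_. 0"] True nth[of n] by simp
  next
    case False
    have sub: "n \<le> subdegree P" by (rule subdegree_geI) (use False zero nth in auto)
    define K0 where "K0 = (\<lambda>x. if x = 0 then fps_nth P n else h (z + x) / x ^ n)"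
    have "K0 has_fps_expansion fps_shift n P"
      unfolding K0_def by (rule has_fps_expansion_shift[OF P sub]) simp
    then have K0: "K0 analytic_on {0}" by (rule has_fps_expansion_imp_analytic_0)
    have "K0 \<circ> (\<lambda>w. w - z) analytic_on {z}"
      by (rule analytic_on_compose_gen[OF _ K0]) (auto intro!: analytic_intros)
    moreover have "h w = (w - z) ^ n * (K0 \<circ> (\<lambda>w. w - z)) w" if "w \<noteq> z" for w
      using that by (simp add: K0_def)
    moreover have "h z = (z - z) ^ n * (K0 \<circ> (\<lambda>w. w - z)) z"
    proof (cases "n = 0")
      case True
      have "fps_nth P 0 = h (z + 0)" using P has_fps_expansion_imp_0_eq_fps_nth_0 by metis
      then show ?thesis using True by (simp add: K0_def)
    next
      case False
      have "fps_nth P 0 = h (z + 0)" using P has_fps_expansion_imp_0_eq_fps_nth_0 by metis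
      then show ?thesis using False zero[of 0] nth[of 0] by simp
    qed
    ultimately have "\<forall>\<^sub>F w in nhds z. h w = (w - z) ^ n * (K0 \<circ> (\<lambda>w. w - z)) w"
      by (intro always_eventually) metis
    moreover have "(K0 \<circ> (\<lambda>w. w - z)) z = taylor_coeff h z n" by (simp add: K0_def nth)
    ultimately show ?thesis using that \<open>K0 \<circ> (\<lambda>w. w - z) analytic_on {z}\<close> by blast
  qed
qed

lemma remove_sings_eventually_analytic:
  assumes g: "g analytic_on {z}" and ev: "\<forall>\<^sub>F w in at z. f w = g w"
  shows "remove_sings f analytic_on {z}" "remove_sings f z = g z"
proof -
  have "isolated_singularity_at f z"
    using isolated_singularity_at_cong[OF ev refl] isolated_singularity_at_analytic[OF g] by blast
  moreover have "f \<midarrow>z\<rightarrow> g z"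
  proof (rule Lim_transform_eventually)
    show "g \<midarrow>z\<rightarrow> g z" using g by (simp add: analytic_at_imp_isCont isContD)
    show "\<forall>\<^sub>F w in at z. g w = f w" using ev by eventually_elim simp
  qed
  ultimately show "remove_sings f analytic_on {z}" "remove_sings f z = g z"
    using remove_sings_analytic_at by auto
qed

subsection \<open>Canonical domains and Faber coefficients\<close>

locale exterior_map =
  fixes E :: "complex set" and \<Phi> :: "complex \<Rightarrow> complex"
  assumes compact_E: "compact E"
    and exterior: "exterior_conformal_map E \<Phi>"
begin

text \<open>The same inverse as in \<open>level_curve\<close>, so that a level curve is literally
  the image of a circle under \<Psi>.\<close>

definition \<Psi> :: "complex \<Rightarrow> complex" where "\<Psi> = inv_into (- E) \<Phi>"

abbreviation D :: "ereal \<Rightarrow> complex set" where "D \<equiv> canonical_domain E \<Phi>"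

section \<open>The exterior map, its inverse, and their behaviour at infinity\<close>

lemma open_compl_E: "open (- E)"
  using compact_E by (simp add: compact_imp_closed open_Compl)

lemma Phi_holomorphic: "\<Phi> holomorphic_on (- E)"
  and Phi_inj: "inj_on \<Phi> (- E)"
  and Phi_image: "\<Phi> ` (- E) = {w. 1 < norm w}"
  using exterior by (auto simp: exterior_conformal_map_def bij_betw_def)

lemma norm_Phi: "z \<notin> E \<Longrightarrow> 1 < norm (\<Phi> z)"
  using Phi_image by blast

lemma Psi_Phi [simp]: "z \<notin> E \<Longrightarrow> \<Psi> (\<Phi> z) = z"
  unfolding \<Psi>_def using Phi_inj by (simp add: inv_into_f_f)

lemma Phi_Psi [simp]: "1 < norm w \<Longrightarrow> \<Phi> (\<Psi> w) = w"
  unfolding \<Psi>_def using Phi_image by (intro f_inv_into_f) auto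

lemma Psi_notin [simp]: "1 < norm w \<Longrightarrow> \<Psi> w \<notin> E"
  unfolding \<Psi>_def using Phi_image by (metis (mono_tags) ComplD inv_into_into mem_Collect_eq)

lemma Psi_holomorphic: "\<Psi> holomorphic_on {w. 1 < norm w}"
  and deriv_Phi_Psi: "1 < norm w \<Longrightarrow> deriv \<Phi> (\<Psi> w) * deriv \<Psi> w = 1"
proof -
  obtain g where g: "g holomorphic_on \<Phi> ` (- E)"
    "\<And>z. z \<in> - E \<Longrightarrow> deriv \<Phi> z * deriv g (\<Phi> z) = 1" "\<And>z. z \<in> - E \<Longrightarrow> g (\<Phi> z) = z"
    using holomorphic_has_inverse[OF Phi_holomorphic open_compl_E Phi_inj] by metis
  have eq: "g w = \<Psi> w" if "1 < norm w" for w
    using g(3)[of "\<Psi> w"] that by simp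
  then show "\<Psi> holomorphic_on {w. 1 < norm w}"
    using g(1) Phi_image by (metis (mono_tags, lifting) holomorphic_cong mem_Collect_eq)
  have op: "open {w::complex. 1 < norm w}"
    by (intro open_Collect_less continuous_intros)
  show "deriv \<Phi> (\<Psi> w) * deriv \<Psi> w = 1" if w: "1 < norm w" for w
  proof -
    have "deriv g w = deriv \<Psi> w"
      by (rule deriv_cong_ev)
         (use op w eq in \<open>auto intro!: eventually_mono[OF eventually_nhds_in_open[OF op]]\<close>)
    with g(2)[of "\<Psi> w"] w show ?thesis by simp
  qed
qed

lemma Phi_at_infinity: "filterlim \<Phi> at_infinity at_infinity"
proof -
  obtain c :: real where c: "c > 0" "((\<lambda>z. \<Phi> z / z) \<longlongrightarrow> of_real c) at_infinity"
    using exterior by (auto simp: exterior_conformal_map_def)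
  have "filterlim (\<lambda>z. \<Phi> z / z * z) at_infinity at_infinity"
    by (rule tendsto_mult_filterlim_at_infinity[OF c(2)]) (use c filterlim_ident in auto)
  moreover have "\<forall>\<^sub>F z in at_infinity. \<Phi> z / z * z = \<Phi> z"
    using eventually_not_equal_at_infinity[of 0] by eventually_elim simp
  ultimately show ?thesis
    using filterlim_cong[OF refl refl] by fast
qed

text \<open>In the coordinate u = 1/z the function 1/\<Phi> has a removable singularity with value 0
  at 0 and is injective on a small disc. Its image is an open neighbourhood of 0, so every w of
  large modulus is \<Phi> z with |z| > R, and this z is \<Psi> w.\<close>

lemma Psi_at_infinity: "filterlim \<Psi> at_infinity at_infinity"
proof -
  obtain R0 where R0: "R0 > 0" "\<And>z. z \<in> E \<Longrightarrow> norm z \<le> R0"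
    using compact_imp_bounded[OF compact_E] by (auto simp: bounded_pos)
  have "\<forall>\<^sub>F w in at_infinity. R \<le> norm (\<Psi> w)" if "R > R0" for R
  proof -
    define \<phi> where "\<phi> = (\<lambda>u. if u = 0 then 0 else inverse (\<Phi> (inverse u)))"
    define B where "B = ball (0::complex) (1 / R)"
    have "R > 0" using that R0 by linarith
    have inv: "inverse u \<notin> E" "R < norm (inverse u)" if u: "u \<in> B" "u \<noteq> 0" for u
    proof -
      show "R < norm (inverse u)"
        using u \<open>R > 0\<close> less_imp_inverse_less[of "norm u" "1 / R"] by (simp add: B_def norm_inverse)
      with R0(2)[of "inverse u"] \<open>R > R0\<close> show "inverse u \<notin> E" by auto
    qed
    have nz: "\<Phi> (inverse u) \<noteq> 0" if "u \<in> B" "u \<noteq> 0" for u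
      using norm_Phi[OF inv(1)[OF that]] by auto
    have "(\<lambda>u. inverse (\<Phi> (inverse u))) holomorphic_on B - {0}"
      using inv nz
      by (intro holomorphic_intros holomorphic_on_compose_gen[OF _ Phi_holomorphic, unfolded o_def]) auto
    then have "\<phi> holomorphic_on B - {0}"
      by (rule holomorphic_transform) (auto simp: \<phi>_def)
    moreover have "(\<phi> \<longlongrightarrow> \<phi> 0) (at 0 within B)"
    proof -
      have "filterlim (\<lambda>u. \<Phi> (inverse u)) at_infinity (at 0)"
        by (rule filterlim_compose[OF Phi_at_infinity filterlim_inverse_at_infinity])
      then have "((\<lambda>u. inverse (\<Phi> (inverse u))) \<longlongrightarrow> 0) (at 0)"
        by (rule filterlim_compose[OF tendsto_inverse_0])
      then have "(\<phi> \<longlongrightarrow> 0) (at 0)"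
        by (rule Lim_transform_eventually) (auto simp: \<phi>_def eventually_at_filter)
      then show ?thesis by (auto simp: \<phi>_def intro: tendsto_within_subset)
    qed
    ultimately have hol: "\<phi> holomorphic_on B"
      using no_isolated_singularity'[of "{0}" \<phi> B] by (auto simp: B_def)
    have "inj_on \<phi> B"
    proof (rule inj_onI)
      fix u v assume uv: "u \<in> B" "v \<in> B" "\<phi> u = \<phi> v"
      show "u = v"
      proof (cases "u = 0 \<or> v = 0")
        case True
        have "\<phi> x \<noteq> 0" if "x \<in> B" "x \<noteq> 0" for x using nz[OF that] that by (simp add: \<phi>_def)
        moreover have "\<phi> 0 = 0" by (simp add: \<phi>_def)
        ultimately show ?thesis using True uv by metis
      next
        case False
        then have "\<Phi> (inverse u) = \<Phi> (inverse v)" using uv by (auto simp: \<phi>_def)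
        then show ?thesis using Phi_inj inv(1) uv False by (metis ComplI inj_onD inverse_inverse_eq)
      qed
    qed
    then have "open (\<phi> ` B)" using open_mapping_thm3[OF hol] by (simp add: B_def)
    moreover have "0 \<in> \<phi> ` B" using \<open>R > 0\<close> by (auto simp: \<phi>_def B_def intro!: image_eqI[of _ _ 0])
    ultimately obtain \<delta> where \<delta>: "\<delta> > 0" "ball 0 \<delta> \<subseteq> \<phi> ` B"
      using open_contains_ball by blast
    have "R \<le> norm (\<Psi> w)" if w: "norm w \<ge> 1 / \<delta> + 1" for w
    proof -
      have w': "1 / \<delta> < norm w" "0 < 1 / \<delta>" using w \<delta> by auto
      then have "w \<noteq> 0" by auto
      from w' have "inverse w \<in> ball 0 \<delta>"
        using \<delta> less_imp_inverse_less[of "1 / \<delta>" "norm w"] by (simp add: norm_inverse)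
      then obtain u where u: "u \<in> B" "inverse w = \<phi> u" using \<delta> by blast
      then have "u \<noteq> 0" using \<open>w \<noteq> 0\<close> by (auto simp: \<phi>_def)
      then have "w = \<Phi> (inverse u)" using u by (simp add: \<phi>_def)
      then show ?thesis using inv[OF u(1) \<open>u \<noteq> 0\<close>] by simp
    qed
    then show ?thesis by (auto simp: eventually_at_infinity)
  qed
  then show ?thesis using filterlim_at_infinity[of R0] R0 by auto
qed

text \<open>The limit is the reciprocal of the derivative of \<Phi> at infinity; being nonzero, it
  makes \<Psi> w comparable to c w.\<close>

lemma Psi_lim: obtains c :: complex where "c \<noteq> 0" "((\<lambda>w. \<Psi> w / w) \<longlongrightarrow> c) at_infinity"
proof -
  obtain c :: real where c: "c > 0" "((\<lambda>z. \<Phi> z / z) \<longlongrightarrow> of_real c) at_infinity"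
    using exterior by (auto simp: exterior_conformal_map_def)
  have "((\<lambda>w. \<Phi> (\<Psi> w) / \<Psi> w) \<longlongrightarrow> of_real c) at_infinity"
    by (rule filterlim_compose[OF c(2) Psi_at_infinity])
  then have "((\<lambda>w. inverse (\<Phi> (\<Psi> w) / \<Psi> w)) \<longlongrightarrow> inverse (of_real c)) at_infinity"
    by (rule tendsto_inverse) (use c in auto)
  moreover have "\<forall>\<^sub>F w in at_infinity. inverse (\<Phi> (\<Psi> w) / \<Psi> w) = \<Psi> w / w"
    unfolding eventually_at_infinity by (rule exI[of _ 2]) auto
  ultimately have "((\<lambda>w. \<Psi> w / w) \<longlongrightarrow> inverse (of_real c)) at_infinity"
    by (rule Lim_transform_eventually)
  with c that[of "inverse (of_real c)"] show ?thesis by auto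
qed

section \<open>Topology of the canonical domains\<close>

lemma closed_Phi_ge:
  assumes "1 < \<rho>"
  shows "closed {z \<in> - E. \<rho> \<le> norm (\<Phi> z)}" (is "closed ?K")
proof -
  have "\<exists>T. open T \<and> z0 \<in> T \<and> T \<subseteq> - ?K" if z0: "z0 \<in> - ?K" for z0
  proof -
    define R where "R = norm z0 + 1"
    have "\<forall>\<^sub>F w in at_infinity. R \<le> norm (\<Psi> w)"
      using Psi_at_infinity filterlim_at_infinity[of 0 \<Psi>] by (auto simp: R_def add_nonneg_pos)
    then obtain M where M: "\<And>w. M \<le> norm w \<Longrightarrow> R \<le> norm (\<Psi> w)"
      by (auto simp: eventually_at_infinity)
    \<comment> \<open>Continuity of \<Phi> does not prevent accumulation at E. But |\<Psi>| is at
      least R beyond M, so inside the ball of radius R the set is contained in the compact image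
      \<open>L\<close>, which avoids E.\<close>
    define L where "L = \<Psi> ` (cball 0 M \<inter> {w. \<rho> \<le> norm w})"
    have "closed {w::complex. \<rho> \<le> norm w}"
      by (intro closed_Collect_le continuous_intros)
    then have "compact (cball 0 M \<inter> {w::complex. \<rho> \<le> norm w})"
      by (intro compact_Int_closed) auto
    then have "compact L"
      unfolding L_def using assms
      by (intro compact_continuous_image continuous_on_subset[OF
            holomorphic_on_imp_continuous_on[OF Psi_holomorphic]]) auto
    then have "open (ball 0 R - L)" by (simp add: compact_imp_closed open_Diff)
    moreover have "z0 \<in> ball 0 R - L"
      using z0 assms by (auto simp: R_def L_def)
    moreover have "ball 0 R - L \<subseteq> - ?K"
    proof
      fix z assume z: "z \<in> ball 0 R - L"
      show "z \<in> - ?K"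
      proof
        assume "z \<in> ?K"
        then have "z = \<Psi> (\<Phi> z)" "\<rho> \<le> norm (\<Phi> z)" by auto
        moreover have "norm (\<Phi> z) \<le> M"
          using M[of "\<Phi> z"] z \<open>z \<in> ?K\<close> by (cases "norm (\<Phi> z) \<le> M") auto
        ultimately have "z \<in> L" unfolding L_def by (intro image_eqI) auto
        with z show False by blast
      qed
    qed
    ultimately show ?thesis by blast
  qed
  then show ?thesis unfolding closed_def by (subst open_subopen) blast
qed

lemma open_Phi_gt: "open {z \<in> - E. \<rho> < norm (\<Phi> z)}"
proof -
  have "open (- E \<inter> \<Phi> -` {w. \<rho> < norm w})"
    by (rule continuous_open_preimage[OF holomorphic_on_imp_continuous_on[OF Phi_holomorphic] open_compl_E])
       (intro open_Collect_less continuous_intros)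
  moreover have "- E \<inter> \<Phi> -` {w. \<rho> < norm w} = {z \<in> - E. \<rho> < norm (\<Phi> z)}" by auto
  ultimately show ?thesis by simp
qed

lemma mem_D: "z \<in> D \<rho> \<longleftrightarrow> z \<in> E \<or> ereal (norm (\<Phi> z)) < \<rho>"
  by (auto simp: canonical_domain_def)

lemma E_subset_D: "E \<subseteq> D \<rho>"
  by (auto simp: canonical_domain_def)

lemma D_mono: "\<rho> \<le> \<rho>' \<Longrightarrow> D \<rho> \<subseteq> D \<rho>'"
  by (auto simp: canonical_domain_def)

lemma D_infinity: "D \<infinity> = UNIV"
  by (auto simp: canonical_domain_def)

lemma open_D: "1 < \<rho> \<Longrightarrow> open (D \<rho>)"
proof (cases \<rho>)
  case (real r)
  assume "1 < \<rho>"
  then have "D \<rho> = - {z \<in> - E. r \<le> norm (\<Phi> z)}" using real by (auto simp: canonical_domain_def)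
  with closed_Phi_ge[of r] real \<open>1 < \<rho>\<close> show ?thesis by auto
qed (auto simp: D_infinity)

lemma Psi_in_D: "\<lbrakk>1 < norm w; ereal (norm w) < \<rho>\<rbrakk> \<Longrightarrow> \<Psi> w \<in> D \<rho>"
  by (auto simp: canonical_domain_def)

lemma Psi_annulus: "\<Psi> ` annulus 1 \<rho> = D \<rho> - E"
proof
  show "D \<rho> - E \<subseteq> \<Psi> ` annulus 1 \<rho>"
  proof
    fix z assume "z \<in> D \<rho> - E"
    then have "\<Phi> z \<in> annulus 1 \<rho>" "z = \<Psi> (\<Phi> z)"
      using norm_Phi by (auto simp: canonical_domain_def mem_annulus)
    then show "z \<in> \<Psi> ` annulus 1 \<rho>" by blast
  qed
qed (auto simp: mem_annulus Psi_in_D)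

text \<open>Canonical domains form a neighbourhood base of E: on the part of the complement of U
  where |\<Phi>| \<le> 2, the function |\<Phi>| attains a minimum above 1, and every point of
  smaller level lies in U. The bound 2 serves to make that part compact.\<close>

lemma D_shrink:
  assumes "open U" "E \<subseteq> U"
  obtains \<rho> :: real where "1 < \<rho>" "D (ereal \<rho>) \<subseteq> U"
proof -
  define C where "C = - U \<inter> - {z \<in> - E. 2 < norm (\<Phi> z)}"
  have "closed C" unfolding C_def using assms open_Phi_gt[of 2] by (intro closed_Int) auto
  moreover have "bounded C"
  proof -
    obtain R0 where R0: "R0 > 0" "\<And>z. z \<in> E \<Longrightarrow> norm z \<le> R0"
      using compact_imp_bounded[OF compact_E] by (auto simp: bounded_pos)
    have "\<forall>\<^sub>F z in at_infinity. 3 \<le> norm (\<Phi> z)"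
      using Phi_at_infinity filterlim_at_infinity[of 0 \<Phi>] by auto
    then obtain M where M: "\<And>z. M \<le> norm z \<Longrightarrow> 3 \<le> norm (\<Phi> z)"
      by (auto simp: eventually_at_infinity)
    have "norm z \<le> max M R0" if "z \<in> C" for z
      using that M[of z] R0(2)[of z] by (cases "z \<in> E"; cases "norm z \<le> M") (auto simp: C_def)
    then show ?thesis by (auto simp: bounded_iff)
  qed
  ultimately have "compact C" using compact_eq_bounded_closed by blast
  have CE: "C \<subseteq> - E" using assms by (auto simp: C_def)
  show ?thesis
  proof (cases "C = {}")
    case True
    show ?thesis
    proof (rule that[of 2])
      show "1 < (2::real)" by simp
      show "D (ereal 2) \<subseteq> U"
      proof
        fix z assume "z \<in> D (ereal 2)"
        then have "z \<in> E \<or> norm (\<Phi> z) < 2" by (auto simp: canonical_domain_def)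
        moreover have "z \<notin> C" using True by blast
        ultimately show "z \<in> U" using assms(2) by (auto simp: C_def)
      qed
    qed
  next
    case False
    have "continuous_on C (\<lambda>z. norm (\<Phi> z))"
      using CE Phi_holomorphic
      by (intro continuous_intros) (meson continuous_on_subset holomorphic_on_imp_continuous_on)
    then obtain z0 where z0: "z0 \<in> C" "\<And>z. z \<in> C \<Longrightarrow> norm (\<Phi> z0) \<le> norm (\<Phi> z)"
      using continuous_attains_inf[OF \<open>compact C\<close> False] by blast
    show ?thesis
    proof (rule that[of "norm (\<Phi> z0)"])
      show "1 < norm (\<Phi> z0)" using z0(1) CE by (intro norm_Phi) auto
      show "D (ereal (norm (\<Phi> z0))) \<subseteq> U"
      proof
        fix z assume z: "z \<in> D (ereal (norm (\<Phi> z0)))"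
        show "z \<in> U"
        proof (rule ccontr)
          assume "z \<notin> U"
          then have "z \<notin> E" "norm (\<Phi> z) < norm (\<Phi> z0)"
            using z assms by (auto simp: canonical_domain_def)
          moreover have "norm (\<Phi> z0) \<le> 2" using z0(1) CE by (auto simp: C_def)
          ultimately have "z \<in> C" using \<open>z \<notin> U\<close> by (auto simp: C_def)
          then show False using z0(2)[of z] \<open>norm (\<Phi> z) < norm (\<Phi> z0)\<close> by simp
        qed
      qed
    qed
  qed
qed

section \<open>Uniqueness of extensions and the maximal index\<close>

lemma agree_near_unique:
  assumes g: "g holomorphic_on D \<rho>" "g' holomorphic_on D \<rho>"
    and "agree_near E g G" "agree_near E g' G" and "1 < \<rho>" and z: "z \<in> D \<rho>"
  shows "g z = g' z"
proof -
  obtain U U' where U: "open U" "E \<subseteq> U" "\<forall>z\<in>U. g z = G z" "open U'" "E \<subseteq> U'" "\<forall>z\<in>U'. g' z = G z"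
    using assms unfolding agree_near_def by blast
  have UU: "open (U \<inter> U')" "E \<subseteq> U \<inter> U'" using U by auto
  obtain \<rho>' where \<rho>': "1 < \<rho>'" "D (ereal \<rho>') \<subseteq> U \<inter> U'" by (rule D_shrink[OF UU])
  show ?thesis
  proof (cases "z \<in> E")
    case True then show ?thesis using U(2,3,5,6) by (metis subsetD)
  next
    case False
    then have "ereal (norm (\<Phi> z)) < \<rho>" "1 < norm (\<Phi> z)"
      using z norm_Phi by (auto simp: canonical_domain_def)
    then obtain s where s: "ereal (norm (\<Phi> z)) < ereal s" "ereal s < \<rho>" using ereal_dense2 by blast
    \<comment> \<open>\<open>A\<close> is the image of a ring and hence connected, so the identity
      theorem carries equality from the thinner ring \<open>A'\<close>, where both functions equal
      G, to the point z.\<close>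
    define A where "A = \<Psi> ` annulus 1 (ereal s)"
    define A' where "A' = \<Psi> ` annulus 1 (ereal (min s \<rho>'))"
    have "1 < s" using s \<open>1 < norm (\<Phi> z)\<close> by simp
    have sub: "A \<subseteq> D \<rho>" unfolding A_def Psi_annulus using s(2) D_mono[of "ereal s" \<rho>] by (simp add: less_imp_le) blast
    have "annulus 1 (ereal s) = {w. 1 < norm (w - 0) \<and> norm (w - 0) < s}"
      by (auto simp: mem_annulus)
    then have "connected (annulus 1 (ereal s))"
      using connected_annulus[of 1 "0::complex" s] by (simp add: DIM_complex)
    then have "connected A" unfolding A_def
      by (intro connected_continuous_image continuous_on_subset[OF
            holomorphic_on_imp_continuous_on[OF Psi_holomorphic]]) (auto simp: mem_annulus)
    moreover have "open A" "open A'"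
      unfolding A_def A'_def Psi_annulus using open_D \<open>1 < s\<close> \<rho>' compact_E
      by (auto intro!: open_Diff compact_imp_closed)
    moreover have "A' \<noteq> {}"
    proof -
      have "of_real ((1 + min s \<rho>') / 2) \<in> annulus 1 (ereal (min s \<rho>'))"
        using \<open>1 < s\<close> \<rho>'(1) unfolding mem_annulus norm_of_real by (auto simp: min_def abs_if)
      then show ?thesis unfolding A'_def by blast
    qed
    moreover have "A' \<subseteq> A" unfolding A'_def A_def by (auto simp: mem_annulus)
    moreover have "g y = g' y" if "y \<in> A'" for y
    proof -
      have "y \<in> D (ereal \<rho>')" using that
        unfolding A'_def by (auto simp: mem_annulus intro: Psi_in_D)
      then have "y \<in> U \<inter> U'" using \<rho>' by blast
      then show ?thesis using U(3,6) by (metis IntD1 IntD2)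
    qed
    moreover have "z \<in> A" unfolding A_def Psi_annulus using False s by (auto simp: canonical_domain_def)
    ultimately show ?thesis
      using analytic_continuation_open[of A' A g g' z] holomorphic_on_subset[OF g(1) sub]
        holomorphic_on_subset[OF g(2) sub] by blast
  qed
qed

lemma extends_to_unique:
  assumes "extends_to E \<Phi> G \<rho> g" "extends_to E \<Phi> G \<rho>' g'" "1 < \<rho>" "1 < \<rho>'"
    and "z \<in> D \<rho>" "z \<in> D \<rho>'"
  shows "g z = g' z"
proof -
  have "D (min \<rho> \<rho>') \<subseteq> D \<rho>" "D (min \<rho> \<rho>') \<subseteq> D \<rho>'" by (auto intro!: D_mono)
  moreover have "z \<in> D (min \<rho> \<rho>')" using assms(5,6) by (auto simp: min_def)
  ultimately show ?thesis
    using assms holomorphic_on_subset agree_near_unique[of g "min \<rho> \<rho>'" g' G z]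
    unfolding extends_to_def by auto
qed

lemma extends_to_mono:
  "\<lbrakk>extends_to E \<Phi> G \<rho> g; \<rho>' \<le> \<rho>\<rbrakk> \<Longrightarrow> extends_to E \<Phi> G \<rho>' g"
  unfolding extends_to_def using D_mono holomorphic_on_subset by blast

lemma agree_near_self [simp]: "agree_near E g g"
  unfolding agree_near_def by (rule exI[of _ UNIV]) auto

lemma analytic_extends:
  assumes "G analytic_on E"
  obtains \<rho> :: real where "1 < \<rho>" "extends_to E \<Phi> G (ereal \<rho>) G"
proof -
  obtain U where U: "open U" "E \<subseteq> U" "G holomorphic_on U"
    using assms analytic_on_holomorphic by metis
  obtain \<rho> where "1 < \<rho>" "D (ereal \<rho>) \<subseteq> U" using D_shrink[OF U(1,2)] by blast
  then show ?thesis using that[of \<rho>] U holomorphic_on_subset unfolding extends_to_def by auto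
qed

lemma rho0_ge: "\<lbrakk>extends_to E \<Phi> G \<rho> g; 1 < \<rho>\<rbrakk> \<Longrightarrow> \<rho> \<le> rho0 E \<Phi> G"
  unfolding rho0_def by (intro Sup_upper) auto

lemma rho0_gt_1: "G analytic_on E \<Longrightarrow> 1 < rho0 E \<Phi> G"
proof (erule analytic_extends)
  fix \<rho> :: real assume \<rho>: "1 < \<rho>" "extends_to E \<Phi> G (ereal \<rho>) G"
  then have "ereal \<rho> \<le> rho0 E \<Phi> G" by (intro rho0_ge) auto
  moreover have "1 < ereal \<rho>" using \<rho> by simp
  ultimately show "1 < rho0 E \<Phi> G" by (rule less_le_trans[rotated])
qed

text \<open>The supremum is attained: extensions agree on overlaps and glue together, and as
  membership in \<open>D\<close> is a strict inequality, the domain of the supremum is the union of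
  the domains.\<close>

lemma extends_to_rho0:
  assumes "extends_to E \<Phi> G \<rho>1 g1" "1 < \<rho>1"
  obtains g where "extends_to E \<Phi> G (rho0 E \<Phi> G) g"
proof -
  define S where "S = {\<rho>. 1 < \<rho> \<and> (\<exists>g. extends_to E \<Phi> G \<rho> g)}"
  have "\<rho>1 \<in> S" using assms by (auto simp: S_def)
  have "\<forall>\<rho>\<in>S. \<exists>g. extends_to E \<Phi> G \<rho> g" by (auto simp: S_def)
  from bchoice[OF this] obtain f where f: "\<And>\<rho>. \<rho> \<in> S \<Longrightarrow> extends_to E \<Phi> G \<rho> (f \<rho>)"
    by blast
  have S1: "1 < \<rho>" if "\<rho> \<in> S" for \<rho> using that by (auto simp: S_def)
  define g where "g = (\<lambda>z. f (SOME \<rho>. \<rho> \<in> S \<and> z \<in> D \<rho>) z)"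
  have g: "g z = f \<rho> z" if "\<rho> \<in> S" "z \<in> D \<rho>" for \<rho> z
  proof -
    define \<rho>' where "\<rho>' = (SOME \<rho>. \<rho> \<in> S \<and> z \<in> D \<rho>)"
    have "\<rho>' \<in> S \<and> z \<in> D \<rho>'" unfolding \<rho>'_def by (rule someI[of _ \<rho>]) (use that in auto)
    then show ?thesis
      unfolding g_def \<rho>'_def[symmetric] using that f S1 extends_to_unique by blast
  qed
  have eq: "D (rho0 E \<Phi> G) = (\<Union>\<rho>\<in>S. D \<rho>)"
  proof
    show "(\<Union>\<rho>\<in>S. D \<rho>) \<subseteq> D (rho0 E \<Phi> G)"
      using D_mono unfolding rho0_def S_def[symmetric] by (meson Sup_upper UN_least)
    show "D (rho0 E \<Phi> G) \<subseteq> (\<Union>\<rho>\<in>S. D \<rho>)"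
      unfolding rho0_def S_def[symmetric] using \<open>\<rho>1 \<in> S\<close>
      by (auto simp: canonical_domain_def less_Sup_iff)
  qed
  have "g holomorphic_on (\<Union>\<rho>\<in>S. D \<rho>)"
  proof (rule holomorphic_on_UN_open)
    fix \<rho> assume "\<rho> \<in> S"
    then have "f \<rho> holomorphic_on D \<rho>" using f unfolding extends_to_def by blast
    then show "g holomorphic_on D \<rho>"
      by (rule holomorphic_transform) (use g \<open>\<rho> \<in> S\<close> in auto)
    show "open (D \<rho>)" using \<open>\<rho> \<in> S\<close> S1 open_D by blast
  qed
  moreover have "agree_near E g G"
  proof -
    obtain U where "open U" "E \<subseteq> U" "\<forall>z\<in>U. f \<rho>1 z = G z"
      using f[OF \<open>\<rho>1 \<in> S\<close>] unfolding extends_to_def agree_near_def by blast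
    then show ?thesis
      unfolding agree_near_def using g[OF \<open>\<rho>1 \<in> S\<close>] open_D[OF assms(2)] E_subset_D
      by (intro exI[of _ "U \<inter> D \<rho>1"]) auto
  qed
  ultimately show ?thesis using that eq unfolding extends_to_def by metis
qed

section \<open>Faber coefficients as Laurent coefficients\<close>

lemma holomorphic_comp_Psi:
  assumes "g holomorphic_on D \<rho>"
  shows "(\<lambda>w. g (\<Psi> w)) holomorphic_on annulus 1 \<rho>"
  by (rule holomorphic_on_compose_gen[OF holomorphic_on_subset[OF Psi_holomorphic] assms, unfolded o_def])
     (auto simp: mem_annulus Psi_in_D)

text \<open>Substituting t = \<Psi> w turns \<Phi>'(t) dt into dw. This also disposes of the two
  choices inside \<open>faber_coeff\<close>: any extension and any radius below its index give the
  same value.\<close>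

lemma faber_coeff_eq:
  assumes g: "extends_to E \<Phi> G \<rho> g" and "1 < \<rho>" "1 < r" "ereal r < \<rho>"
  shows "faber_coeff E \<Phi> G n = laurent_coeff r (\<lambda>w. g (\<Psi> w)) n"
proof -
  define g' where "g' = (SOME g. extends_to E \<Phi> G (rho0 E \<Phi> G) g)"
  define s where "s = (SOME \<rho>::real. 1 < \<rho> \<and> ereal \<rho> < rho0 E \<Phi> G)"
  have "\<exists>g. extends_to E \<Phi> G (rho0 E \<Phi> G) g"
    using extends_to_rho0[OF g assms(2)] by blast
  from someI_ex[OF this] have g': "extends_to E \<Phi> G (rho0 E \<Phi> G) g'"
    by (simp add: g'_def)
  have \<rho>: "\<rho> \<le> rho0 E \<Phi> G" using g assms rho0_ge by blast
  have "1 < r \<and> ereal r < rho0 E \<Phi> G" using assms \<rho> by auto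
  then have s: "1 < s \<and> ereal s < rho0 E \<Phi> G" unfolding s_def by (rule someI)
  have sph: "path_image (circlepath 0 s) = sphere 0 s" using s by simp
  have "\<Psi> analytic_on {w. 1 < norm w}"
    using Psi_holomorphic open_annulus[of 1 \<infinity>] by (simp add: analytic_on_open annulus_infinity)
  then have "contour_integral (level_curve E \<Phi> s) (\<lambda>t. g' t * deriv \<Phi> t / \<Phi> t ^ (n + 1)) =
     contour_integral (circlepath 0 s)
       (\<lambda>w. deriv \<Psi> w * (g' (\<Psi> w) * deriv \<Phi> (\<Psi> w) / \<Phi> (\<Psi> w) ^ (n + 1)))"
    unfolding level_curve_def \<Psi>_def[symmetric]
    by (rule contour_integral_comp_analyticW) (use s in auto)
  also have "\<dots> = contour_integral (circlepath 0 s) (\<lambda>w. g' (\<Psi> w) / w ^ (n + 1))"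
  proof (rule contour_integral_cong[OF refl])
    fix w assume "w \<in> path_image (circlepath 0 s)"
    then have w: "1 < norm w" using s sph by auto
    have "deriv \<Psi> w * (g' (\<Psi> w) * deriv \<Phi> (\<Psi> w) / \<Phi> (\<Psi> w) ^ (n + 1)) =
       (deriv \<Phi> (\<Psi> w) * deriv \<Psi> w) * (g' (\<Psi> w) / w ^ (n + 1))"
      using w by (simp add: mult_ac)
    then show "deriv \<Psi> w * (g' (\<Psi> w) * deriv \<Phi> (\<Psi> w) / \<Phi> (\<Psi> w) ^ (n + 1)) = g' (\<Psi> w) / w ^ (n + 1)"
      using deriv_Phi_Psi[OF w] by simp
  qed
  finally have "faber_coeff E \<Phi> G n = laurent_coeff s (\<lambda>w. g' (\<Psi> w)) n"
    unfolding faber_coeff_def Let_def g'_def[symmetric] s_def[symmetric] laurent_coeff_def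
    by simp
  also have "\<dots> = laurent_coeff r (\<lambda>w. g' (\<Psi> w)) n"
    by (rule laurent_coeff_radius[OF holomorphic_comp_Psi[of g' "rho0 E \<Phi> G"]])
       (use g' s assms \<rho> in \<open>auto simp: extends_to_def\<close>)
  also have "\<dots> = laurent_coeff r (\<lambda>w. g (\<Psi> w)) n"
  proof -
    have "contour_integral (circlepath 0 r) (\<lambda>w. g' (\<Psi> w) / w ^ (n + 1)) =
          contour_integral (circlepath 0 r) (\<lambda>w. g (\<Psi> w) / w ^ (n + 1))"
    proof (rule contour_integral_cong[OF refl])
      fix w assume "w \<in> path_image (circlepath 0 r)"
      then have w: "norm w = r" using assms by auto
      have "g' (\<Psi> w) = g (\<Psi> w)"
        by (rule extends_to_unique[OF g' g]) (use assms \<rho> w Psi_in_D in auto)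
      then show "g' (\<Psi> w) / w ^ (n + 1) = g (\<Psi> w) / w ^ (n + 1)" by simp
    qed
    then show ?thesis by (simp only: laurent_coeff_def)
  qed
  finally show ?thesis .
qed

text \<open>The principal part H is holomorphic for all |w| > r, so only the power series limits
  continuation, and by the bound it converges for |w| < s. Composed with \<Phi>, their sum continues
  g to the ring r < |\<Phi>| < s, which overlaps \<open>D \<rho>\<close>.\<close>

lemma extends_to_of_coeff_bound:
  assumes g: "extends_to E \<Phi> G \<rho> g" and "1 < \<rho>" and "1 < s"
    and bound: "\<And>n. n \<ge> n0 \<Longrightarrow> norm (faber_coeff E \<Phi> G n) \<le> C / s ^ n"
  shows "\<exists>g'. extends_to E \<Phi> G (ereal s) g'"
proof (cases "ereal s \<le> \<rho>")
  case True then show ?thesis using g extends_to_mono by blast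
next
  case False
  obtain r where r: "1 < ereal r" "ereal r < \<rho>" using ereal_dense2[of 1 \<rho>] assms by auto
  then have "1 < r" by simp
  define h where "h = (\<lambda>w. g (\<Psi> w))"
  have h: "h holomorphic_on annulus 1 \<rho>"
    unfolding h_def using g holomorphic_comp_Psi unfolding extends_to_def by blast
  define a where "a = (\<lambda>n. faber_coeff E \<Phi> G n)"
  have a: "laurent_coeff r h n = a n" for n
    unfolding a_def h_def using faber_coeff_eq[OF g] assms r \<open>1 < r\<close> by simp
  obtain H K where H: "H holomorphic_on {w. r < norm w}"
    "\<And>w. w \<in> annulus r \<rho> \<Longrightarrow> (\<lambda>n. laurent_coeff r h n * w ^ n) sums (h w - H w)"
    by (rule laurent_decomposition[OF h, of r r]) (use r \<open>1 < r\<close> in auto)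
  define hp where "hp = (\<lambda>w. \<Sum>n. a n * w ^ n)"
  have sums: "(\<lambda>n. a n * w ^ n) sums hp w" if w: "norm w < s" for w
  proof -
    have "summable (\<lambda>n. C * (norm w / s) ^ n)"
      by (intro summable_mult summable_geometric) (use w \<open>1 < s\<close> in auto)
    moreover have "norm (a n * w ^ n) \<le> C * (norm w / s) ^ n" if "n \<ge> n0" for n
    proof -
      have "norm (a n * w ^ n) \<le> C / s ^ n * norm w ^ n"
        using mult_right_mono[OF bound[OF that], of "norm w ^ n"] by (simp add: norm_mult norm_power a_def)
      then show ?thesis by (simp add: power_divide)
    qed
    ultimately have "summable (\<lambda>n. a n * w ^ n)"
      by (rule summable_comparison_test'[where N = n0])
    then show ?thesis unfolding hp_def by (rule summable_sums)
  qed
  have "hp holomorphic_on ball 0 s"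
    by (rule power_series_holomorphic[where a = a]) (use sums in auto)
  define g' where "g' = (\<lambda>z. if z \<in> D \<rho> then g z else H (\<Phi> z) + hp (\<Phi> z))"
  define V where "V = {z \<in> - E. r < norm (\<Phi> z)} \<inter> D (ereal s)"
  have V: "open V" unfolding V_def using open_Phi_gt[of r] open_D[of "ereal s"] \<open>1 < s\<close> by auto
  have eq: "g' z = H (\<Phi> z) + hp (\<Phi> z)" if z: "z \<in> V" for z
  proof (cases "z \<in> D \<rho>")
    case True
    then have *: "\<Phi> z \<in> annulus r \<rho>" "norm (\<Phi> z) < s" "z \<notin> E"
      using z by (auto simp: V_def mem_annulus canonical_domain_def)
    then have "hp (\<Phi> z) = h (\<Phi> z) - H (\<Phi> z)"
      using H(2)[OF *(1)] sums[OF *(2)] unfolding a by (metis sums_unique2)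
    then show ?thesis using True * by (simp add: g'_def h_def)
  qed (simp add: g'_def)
  have "(\<lambda>z. H (\<Phi> z) + hp (\<Phi> z)) holomorphic_on V"
  proof (intro holomorphic_intros)
    have *: "\<Phi> holomorphic_on V" using Phi_holomorphic by (rule holomorphic_on_subset) (auto simp: V_def)
    show "(\<lambda>z. H (\<Phi> z)) holomorphic_on V"
      by (rule holomorphic_on_compose_gen[OF * H(1), unfolded o_def]) (auto simp: V_def)
    show "(\<lambda>z. hp (\<Phi> z)) holomorphic_on V"
      by (rule holomorphic_on_compose_gen[OF * \<open>hp holomorphic_on ball 0 s\<close>, unfolded o_def])
         (auto simp: V_def canonical_domain_def)
  qed
  then have "g' holomorphic_on V" by (rule holomorphic_transform) (use eq in auto)
  moreover have "g' holomorphic_on D \<rho>"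
    by (rule holomorphic_transform[of g]) (use g in \<open>auto simp: extends_to_def g'_def\<close>)
  ultimately have "g' holomorphic_on (D \<rho> \<union> V)"
    using holomorphic_on_Un open_D V assms by blast
  moreover have "D (ereal s) \<subseteq> D \<rho> \<union> V"
  proof
    fix z assume z: "z \<in> D (ereal s)"
    show "z \<in> D \<rho> \<union> V"
    proof (cases "z \<in> D \<rho>")
      case False
      then have "z \<notin> E" "\<rho> \<le> ereal (norm (\<Phi> z))" by (auto simp: mem_D)
      then have "ereal r < ereal (norm (\<Phi> z))" using r by (meson less_le_trans)
      then show ?thesis using z \<open>z \<notin> E\<close> by (simp add: V_def)
    qed simp
  qed
  ultimately have "g' holomorphic_on D (ereal s)" using holomorphic_on_subset by blast
  moreover have "agree_near E g' G"
  proof -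
    obtain U where "open U" "E \<subseteq> U" "\<forall>z\<in>U. g z = G z"
      using g unfolding extends_to_def agree_near_def by blast
    then show ?thesis
      unfolding agree_near_def using open_D[OF assms(2)] E_subset_D
      by (intro exI[of _ "U \<inter> D \<rho>"]) (auto simp: g'_def)
  qed
  ultimately show ?thesis unfolding extends_to_def by blast
qed

lemma faber_coeff_bound:
  assumes "extends_to E \<Phi> G \<rho> g" "1 < \<rho>" "1 < r" "ereal r < \<rho>"
  shows "\<exists>C\<ge>0. \<forall>n. norm (faber_coeff E \<Phi> G n) \<le> C / r ^ n"
  using laurent_coeff_bound[OF holomorphic_comp_Psi[of g \<rho>], of r r] faber_coeff_eq[OF assms] assms
  by (auto simp: extends_to_def)

lemma analytic_common_extension:
  assumes "f analytic_on E" "g analytic_on E"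
  obtains \<rho> :: real where "1 < \<rho>" "extends_to E \<Phi> f (ereal \<rho>) f" "extends_to E \<Phi> g (ereal \<rho>) g"
proof -
  obtain \<rho> :: real where 1: "1 < \<rho>" "extends_to E \<Phi> f (ereal \<rho>) f" using analytic_extends[OF assms(1)] by blast
  obtain \<rho>' :: real where 2: "1 < \<rho>'" "extends_to E \<Phi> g (ereal \<rho>') g" using analytic_extends[OF assms(2)] by blast
  show ?thesis
    by (rule that[of "min \<rho> \<rho>'"]) (use 1 2 in \<open>auto intro: extends_to_mono\<close>)
qed

lemma faber_coeff_add:
  assumes "f analytic_on E" "g analytic_on E"
  shows "faber_coeff E \<Phi> (\<lambda>z. f z + g z) n = faber_coeff E \<Phi> f n + faber_coeff E \<Phi> g n"
proof -
  obtain \<rho> :: real where \<rho>: "1 < \<rho>" "extends_to E \<Phi> f (ereal \<rho>) f" "extends_to E \<Phi> g (ereal \<rho>) g"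
    using analytic_common_extension[OF assms] by blast
  define r where "r = (1 + \<rho>) / 2"
  have r: "1 < r" "r < \<rho>" using \<rho> by (auto simp: r_def)
  have fg: "extends_to E \<Phi> (\<lambda>z. f z + g z) (ereal \<rho>) (\<lambda>z. f z + g z)"
    using \<rho> by (auto simp: extends_to_def intro!: holomorphic_intros)
  have "f holomorphic_on D (ereal \<rho>)" "g holomorphic_on D (ereal \<rho>)"
    using \<rho> by (auto simp: extends_to_def)
  then show ?thesis
    using faber_coeff_eq[OF fg, of r n] faber_coeff_eq[OF \<rho>(2), of r n] faber_coeff_eq[OF \<rho>(3), of r n] r \<rho>(1)
      laurent_coeff_add[OF holomorphic_comp_Psi holomorphic_comp_Psi, of f "ereal \<rho>" g r n] by simp
qed

lemma faber_coeff_cmult: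
  assumes "f analytic_on E"
  shows "faber_coeff E \<Phi> (\<lambda>z. c * f z) n = c * faber_coeff E \<Phi> f n"
proof -
  obtain \<rho> :: real where \<rho>: "1 < \<rho>" "extends_to E \<Phi> f (ereal \<rho>) f"
    using analytic_extends[OF assms] by blast
  define r where "r = (1 + \<rho>) / 2"
  have r: "1 < r" "r < \<rho>" using \<rho> by (auto simp: r_def)
  have fg: "extends_to E \<Phi> (\<lambda>z. c * f z) (ereal \<rho>) (\<lambda>z. c * f z)"
    using \<rho> by (auto simp: extends_to_def intro!: holomorphic_intros)
  have "f holomorphic_on D (ereal \<rho>)"
    using \<rho> by (auto simp: extends_to_def)
  then show ?thesis
    using faber_coeff_eq[OF fg, of r n] faber_coeff_eq[OF \<rho>(2), of r n] r \<rho>(1)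
      laurent_coeff_cmult[OF holomorphic_comp_Psi, of f "ereal \<rho>" r c n] by simp
qed

lemma faber_coeff_sum:
  assumes "finite A" "\<And>i. i \<in> A \<Longrightarrow> f i analytic_on E"
  shows "faber_coeff E \<Phi> (\<lambda>z. \<Sum>i\<in>A. c i * f i z) n = (\<Sum>i\<in>A. c i * faber_coeff E \<Phi> (f i) n)"
  using assms
proof (induction A rule: finite_induct)
  case empty
  then show ?case using faber_coeff_cmult[of "\<lambda>_. 0" 0 n] by simp
next
  case (insert i A)
  then show ?case
    using faber_coeff_add[of "\<lambda>z. c i * f i z" "\<lambda>z. \<Sum>i\<in>A. c i * f i z" n]
      faber_coeff_cmult[of "f i" "c i" n]
    by (simp add: analytic_intros)
qed

lemma faber_coeff_poly_mult:
  assumes "f analytic_on E" "degree q \<le> B"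
  shows "faber_coeff E \<Phi> (\<lambda>z. poly q z * f z) n =
     (\<Sum>i\<le>B. coeff q i * faber_coeff E \<Phi> (\<lambda>z. z ^ i * f z) n)"
proof -
  have "(\<lambda>z. poly q z * f z) = (\<lambda>z. \<Sum>i\<le>B. coeff q i * (z ^ i * f z))"
    by (simp add: poly_eq_sum_le[OF assms(2)] sum_distrib_right sum_distrib_left mult_ac fun_eq_iff)
  then show ?thesis
    using faber_coeff_sum[of "{..B}" "\<lambda>i z. z ^ i * f z" "coeff q" n] assms by (simp add: analytic_intros)
qed

section \<open>Faber coefficients of polynomials and the equations for the denominator\<close>

lemma poly_Psi_lim:
  assumes c: "((\<lambda>w. \<Psi> w / w) \<longlongrightarrow> c) at_infinity" and "degree p \<le> n"
  shows "((\<lambda>w. poly p (\<Psi> w) / w ^ n) \<longlongrightarrow> coeff p n * c ^ n) at_infinity"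
proof -
  have "((\<lambda>w. \<Sum>i\<le>n. coeff p i * ((\<Psi> w / w) ^ i * (1 / w) ^ (n - i))) \<longlongrightarrow>
        (\<Sum>i\<le>n. coeff p i * (c ^ i * 0 ^ (n - i)))) at_infinity"
    by (intro tendsto_intros c tendsto_inverse_at_infinity)
  moreover have lim: "(\<Sum>i\<le>n. coeff p i * (c ^ i * 0 ^ (n - i))) = coeff p n * c ^ n"
    by (subst sum.remove[of _ n]) (auto intro!: sum.neutral)
  moreover have "\<forall>\<^sub>F w in at_infinity. (\<Sum>i\<le>n. coeff p i * ((\<Psi> w / w) ^ i * (1 / w) ^ (n - i))) =
        poly p (\<Psi> w) / w ^ n"
    using eventually_not_equal_at_infinity[of 0]
  proof eventually_elim
    case (elim w)
    have "(\<Psi> w / w) ^ i * (1 / w) ^ (n - i) = \<Psi> w ^ i / w ^ n" if "i \<le> n" for i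
    proof -
      have "w ^ n = w ^ i * w ^ (n - i)" using that by (simp flip: power_add)
      then show ?thesis by (simp add: power_divide)
    qed
    then show ?case
      by (simp add: poly_eq_sum_le[OF assms(2)] sum_divide_distrib)
  qed
  ultimately have "((\<lambda>w. poly p (\<Psi> w) / w ^ n) \<longlongrightarrow>
      (\<Sum>i\<le>n. coeff p i * (c ^ i * 0 ^ (n - i)))) at_infinity"
    by (blast intro: Lim_transform_eventually)
  then show ?thesis unfolding lim .
qed

lemma poly_Psi_holomorphic: "(\<lambda>w. poly p (\<Psi> w)) holomorphic_on {w. 1 < norm w}"
  by (intro holomorphic_intros Psi_holomorphic)

text \<open>The value is read off at infinity. It is 0 for degree below n and \<open>c ^ n\<close>
  for the monomial of degree n, so prescribing the coefficients of a polynomial is a triangular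
  problem.\<close>

lemma faber_coeff_poly:
  assumes c: "((\<lambda>w. \<Psi> w / w) \<longlongrightarrow> c) at_infinity" and "degree p \<le> n"
  shows "faber_coeff E \<Phi> (poly p) n = coeff p n * c ^ n"
proof -
  have "extends_to E \<Phi> (poly p) \<infinity> (poly p)"
    by (auto simp: extends_to_def intro!: holomorphic_intros)
  then have "faber_coeff E \<Phi> (poly p) n = laurent_coeff 2 (\<lambda>w. poly p (\<Psi> w)) n"
    by (rule faber_coeff_eq) auto
  also have "contour_integral (circlepath 0 2) (\<lambda>w. poly p (\<Psi> w) / w ^ (n+1)) =
      2 * of_real pi * \<i> * (coeff p n * c ^ n)"
  proof (rule contour_integral_at_infinity[where a = 1])
    show "(\<lambda>w. poly p (\<Psi> w) / w ^ (n+1)) holomorphic_on {w. 1 < norm w}"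
      by (intro holomorphic_intros poly_Psi_holomorphic) auto
    have "\<forall>\<^sub>F w in at_infinity. poly p (\<Psi> w) / w ^ n = w * (poly p (\<Psi> w) / w ^ (n + 1))"
      using eventually_not_equal_at_infinity[of 0] by eventually_elim simp
    then show "((\<lambda>w. w * (poly p (\<Psi> w) / w ^ (n + 1))) \<longlongrightarrow> coeff p n * c ^ n) at_infinity"
      by (rule Lim_transform_eventually[OF poly_Psi_lim[OF assms]])
  qed auto
  then have "laurent_coeff 2 (\<lambda>w. poly p (\<Psi> w)) n = coeff p n * c ^ n"
    unfolding laurent_coeff_def by simp
  finally show ?thesis .
qed

lemma faber_coeff_diff_poly:
  assumes "G analytic_on E"
  shows "faber_coeff E \<Phi> (\<lambda>z. G z - poly p z) n = faber_coeff E \<Phi> G n - faber_coeff E \<Phi> (poly p) n"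
  using faber_coeff_add[OF assms, of "\<lambda>z. - 1 * poly p z" n] faber_coeff_cmult[of "poly p" "-1" n]
  by (simp add: analytic_intros)

text \<open>The triangular system is solved from the top: \<open>b\<close> cancels the coefficient
  of index n, and corrections of lower degree leave it alone. Bounding the degree through
  coefficients forces P = 0 when n = 0.\<close>

lemma faber_interpolation:
  assumes "G analytic_on E"
  shows "\<exists>P. (\<forall>i\<ge>n. coeff P i = 0) \<and> (\<forall>j<n. faber_coeff E \<Phi> (\<lambda>z. G z - poly P z) j = 0)"
  using assms
proof (induction n arbitrary: G)
  case 0
  then show ?case by (intro exI[of _ 0]) auto
next
  case (Suc n)
  obtain c where c: "c \<noteq> 0" "((\<lambda>w. \<Psi> w / w) \<longlongrightarrow> c) at_infinity" using Psi_lim by blast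
  define b where "b = faber_coeff E \<Phi> G n / c ^ n"
  have "(\<lambda>z. G z - poly (monom b n) z) analytic_on E"
    using Suc.prems by (intro analytic_intros)
  from Suc.IH[OF this] obtain P where P: "\<forall>i\<ge>n. coeff P i = 0"
    "\<forall>j<n. faber_coeff E \<Phi> (\<lambda>z. G z - poly (monom b n) z - poly P z) j = 0" by blast
  define P' where "P' = monom b n + P"
  have eq: "(\<lambda>z. G z - poly P' z) = (\<lambda>z. G z - poly (monom b n) z - poly P z)"
    by (simp add: P'_def fun_eq_iff)
  have deg: "degree P' \<le> n" using P(1) by (intro degree_le) (auto simp: P'_def)
  have "faber_coeff E \<Phi> (\<lambda>z. G z - poly P' z) n = faber_coeff E \<Phi> G n - coeff P' n * c ^ n"
    using faber_coeff_diff_poly[OF Suc.prems] faber_coeff_poly[OF c(2) deg] by simp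
  also have "\<dots> = 0" using P(1) c by (simp add: P'_def b_def)
  finally have "\<forall>j<Suc n. faber_coeff E \<Phi> (\<lambda>z. G z - poly P' z) j = 0"
    using P(2) eq less_Suc_eq by metis
  moreover have "\<forall>i\<ge>Suc n. coeff P' i = 0" using P(1) by (auto simp: P'_def)
  ultimately show ?case by blast
qed

lemma faber_coeff_poly_less: "degree p < n \<Longrightarrow> faber_coeff E \<Phi> (poly p) n = 0"
proof -
  assume p: "degree p < n"
  obtain c where "((\<lambda>w. \<Psi> w / w) \<longlongrightarrow> c) at_infinity" using Psi_lim by blast
  from faber_coeff_poly[OF this, of p n] p show ?thesis by (simp add: coeff_eq_0)
qed

text \<open>A numerator of degree at most n - 1 can cancel all coefficients below n and has no
  influence on the n-th, so one condition per product remains. For n = 0 the truncated n - 1 would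
  admit constants, which do influence coefficient 0.\<close>

lemma monic_denominator_iff:
  assumes F: "\<And>\<alpha>. \<alpha> \<in> {1..d} \<Longrightarrow> F \<alpha> analytic_on E" and "n \<ge> 1"
  shows "monic_pade_faber_denominator E \<Phi> d F m n q \<longleftrightarrow>
    lead_coeff q = 1 \<and> degree q \<le> mi_size d m \<and>
    (\<forall>\<alpha>\<in>{1..d}. \<forall>k<m \<alpha>. faber_coeff E \<Phi> (\<lambda>z. poly q z * z ^ k * F \<alpha> z) n = 0)"
proof -
  have an: "(\<lambda>z. poly q z * z ^ k * F \<alpha> z) analytic_on E" if "\<alpha> \<in> {1..d}" for k \<alpha>
    using F[OF that] by (intro analytic_intros)
  show ?thesis
  proof
    assume "monic_pade_faber_denominator E \<Phi> d F m n q"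
    then obtain P where P: "lead_coeff q = 1" "pade_faber_solution E \<Phi> d F m n q P"
      unfolding monic_pade_faber_denominator_def by blast
    have "faber_coeff E \<Phi> (\<lambda>z. poly q z * z ^ k * F \<alpha> z) n = 0" if "\<alpha> \<in> {1..d}" "k < m \<alpha>" for \<alpha> k
    proof -
      have "degree (P k \<alpha>) < n"
        "faber_coeff E \<Phi> (\<lambda>z. poly q z * z ^ k * F \<alpha> z - poly (P k \<alpha>) z) n = 0"
        using P(2) that \<open>n \<ge> 1\<close> unfolding pade_faber_solution_def by fastforce+
      then show ?thesis
        using faber_coeff_diff_poly[OF an[OF that(1)]] faber_coeff_poly_less by simp
    qed
    then show "lead_coeff q = 1 \<and> degree q \<le> mi_size d m \<and>
      (\<forall>\<alpha>\<in>{1..d}. \<forall>k<m \<alpha>. faber_coeff E \<Phi> (\<lambda>z. poly q z * z ^ k * F \<alpha> z) n = 0)"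
      using P unfolding pade_faber_solution_def by blast
  next
    assume *: "lead_coeff q = 1 \<and> degree q \<le> mi_size d m \<and>
      (\<forall>\<alpha>\<in>{1..d}. \<forall>k<m \<alpha>. faber_coeff E \<Phi> (\<lambda>z. poly q z * z ^ k * F \<alpha> z) n = 0)"
    have "\<forall>k \<alpha>. \<exists>P. \<alpha> \<in> {1..d} \<longrightarrow> (\<forall>i\<ge>n. coeff P i = 0) \<and>
       (\<forall>j<n. faber_coeff E \<Phi> (\<lambda>z. poly q z * z ^ k * F \<alpha> z - poly P z) j = 0)"
      using faber_interpolation[OF an] by blast
    then obtain P where P: "\<And>k \<alpha>. \<alpha> \<in> {1..d} \<Longrightarrow> (\<forall>i\<ge>n. coeff (P k \<alpha>) i = 0) \<and>
       (\<forall>j<n. faber_coeff E \<Phi> (\<lambda>z. poly q z * z ^ k * F \<alpha> z - poly (P k \<alpha>) z) j = 0)"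
      by metis
    have "pade_faber_solution E \<Phi> d F m n q P"
      unfolding pade_faber_solution_def
    proof (intro conjI ballI allI impI)
      show "q \<noteq> 0" "degree q \<le> mi_size d m" using * by auto
      fix \<alpha> k assume \<alpha>: "\<alpha> \<in> {1..d}" and k: "k < m \<alpha>"
      show deg: "degree (P k \<alpha>) \<le> n - 1"
        using P[OF \<alpha>] \<open>n \<ge> 1\<close> by (intro degree_le) auto
      fix j assume "j \<le> n"
      show "faber_coeff E \<Phi> (\<lambda>z. poly q z * z ^ k * F \<alpha> z - poly (P k \<alpha>) z) j = 0"
      proof (cases "j = n")
        case True
        have "degree (P k \<alpha>) < n" using deg \<open>n \<ge> 1\<close> by linarith
        then show ?thesis
          using True * \<alpha> k faber_coeff_diff_poly[OF an[OF \<alpha>]] faber_coeff_poly_less by simp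
      next
        case False then show ?thesis using P[OF \<alpha>] \<open>j \<le> n\<close> by auto
      qed
    qed
    then show "monic_pade_faber_denominator E \<Phi> d F m n q"
      using * unfolding monic_pade_faber_denominator_def by blast
  qed
qed

section \<open>Eventually vanishing coefficients, entire functions, and limits of
  denominators\<close>

lemma faber_coeff_poly_mult_eventually_0:
  assumes g: "G analytic_on E" and zero: "\<And>n. n \<ge> n0 \<Longrightarrow> faber_coeff E \<Phi> G n = 0"
    and q: "degree q \<le> B" and n: "n \<ge> n0 + B"
  shows "faber_coeff E \<Phi> (\<lambda>z. poly q z * G z) n = 0"
proof -
  obtain \<rho> :: real where \<rho>: "1 < \<rho>" and G: "extends_to E \<Phi> G (ereal \<rho>) G"
    using analytic_extends[OF g] by blast
  define r where "r = (1 + \<rho>) / 2"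
  \<comment> \<open>The decomposition of h holds only outside radius r, hence a second radius for
    the integral.\<close>
  define t where "t = (r + \<rho>) / 2"
  have r: "1 < r" "r < t" "t < \<rho>" using \<rho> by (auto simp: r_def t_def)
  define h where "h = (\<lambda>w. G (\<Psi> w))"
  have h: "h holomorphic_on annulus 1 (ereal \<rho>)"
    unfolding h_def using G holomorphic_comp_Psi unfolding extends_to_def by blast
  define a where "a = (\<lambda>n. faber_coeff E \<Phi> G n)"
  have a: "laurent_coeff r h n = a n" for n
    unfolding a_def h_def using faber_coeff_eq[OF G] r \<rho> by simp
  obtain H C where H: "H holomorphic_on {w. r < norm w}"
    "\<And>w. 2 * r \<le> norm w \<Longrightarrow> norm (H w) \<le> C / norm w"
    "\<And>w. w \<in> annulus r (ereal \<rho>) \<Longrightarrow> (\<lambda>n. laurent_coeff r h n * w ^ n) sums (h w - H w)"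
    by (rule laurent_decomposition[OF h, of r r]) (use r in auto)
  have hH: "h w = H w + (\<Sum>l<n0. a l * w ^ l)" if "w \<in> annulus r (ereal \<rho>)" for w
  proof -
    have "(\<lambda>n. a n * w ^ n) sums (h w - H w)" using H(3)[OF that] by (simp add: a)
    moreover have "(\<lambda>n. a n * w ^ n) sums (\<Sum>l<n0. a l * w ^ l)"
      by (rule sums_finite) (use zero in \<open>auto simp: a_def\<close>)
    ultimately have "h w - H w = (\<Sum>l<n0. a l * w ^ l)" by (rule sums_unique2)
    then show ?thesis by (simp add: algebra_simps)
  qed
  obtain c where c: "((\<lambda>w. \<Psi> w / w) \<longlongrightarrow> c) at_infinity" using Psi_lim by blast
  \<comment> \<open>G may be defined only near E, whereas principal part plus polynomial makes sense
    up to infinity; so the integrand is rebuilt from the latter and evaluated there.\<close>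
  define \<phi> where "\<phi> = (\<lambda>w. poly q (\<Psi> w) * (H w + (\<Sum>l<n0. a l * w ^ l)) / w ^ (n + 1))"
  have qG: "extends_to E \<Phi> (\<lambda>z. poly q z * G z) (ereal \<rho>) (\<lambda>z. poly q z * G z)"
    using G by (auto simp: extends_to_def intro!: holomorphic_intros)
  have "contour_integral (circlepath 0 t) (\<lambda>w. poly q (\<Psi> w) * G (\<Psi> w) / w ^ (n + 1)) =
        contour_integral (circlepath 0 t) \<phi>"
  proof (rule contour_integral_cong[OF refl])
    fix w assume "w \<in> path_image (circlepath 0 t)"
    then have "w \<in> annulus r (ereal \<rho>)" using r by (auto simp: mem_annulus)
    from hH[OF this] show "poly q (\<Psi> w) * G (\<Psi> w) / w ^ (n + 1) = \<phi> w"
      by (simp add: \<phi>_def h_def)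
  qed
  also have "\<dots> = 2 * of_real pi * \<i> * 0"
  proof (rule contour_integral_at_infinity[where a = r])
    have "\<Psi> holomorphic_on {w. r < norm w}"
      using Psi_holomorphic by (rule holomorphic_on_subset) (use r in auto)
    then show "\<phi> holomorphic_on {w. r < norm w}"
      unfolding \<phi>_def using r by (intro holomorphic_intros H) auto
    \<comment> \<open>Padding with zeros up to n - B, which is at least n0, matches the exponent
      left for the second factor after \<open>poly q (\<Psi> w)\<close> has been divided by
      w^B.\<close>
    define a' where "a' = (\<lambda>l. if l < n0 then a l else 0)"
    have "(\<Sum>l<n0. a l * w ^ l) = (\<Sum>l<n - B. a' l * w ^ l)" for w
      unfolding a'_def by (rule sum.mono_neutral_cong_left) (use n in auto)
    then have eq: "\<phi> w = poly q (\<Psi> w) * (H w + (\<Sum>l<n - B. a' l * w ^ l)) / w ^ (n + 1)" for w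
      by (simp add: \<phi>_def)
    have "((\<lambda>w. poly q (\<Psi> w) / w ^ B * ((H w + (\<Sum>l<n - B. a' l * w ^ l)) / w ^ (n - B)))
         \<longlongrightarrow> coeff q B * c ^ B * 0) at_infinity"
      by (intro tendsto_mult poly_Psi_lim c q low_part_lim inner_part_tendsto_0[OF H(2)])
    moreover have "\<forall>\<^sub>F w in at_infinity.
        poly q (\<Psi> w) / w ^ B * ((H w + (\<Sum>l<n - B. a' l * w ^ l)) / w ^ (n - B)) = w * \<phi> w"
      using eventually_not_equal_at_infinity[of 0]
    proof eventually_elim
      case (elim w)
      have "w ^ n = w ^ B * w ^ (n - B)" using n by (simp flip: power_add)
      then show ?case using elim by (simp add: eq)
    qed
    ultimately show "((\<lambda>w. w * \<phi> w) \<longlongrightarrow> 0) at_infinity"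
      using Lim_transform_eventually by fastforce
  qed (use r in auto)
  finally show ?thesis
    using faber_coeff_eq[OF qG, of t n] r \<rho> by (simp add: laurent_coeff_def)
qed

text \<open>With \<open>poly (q n) (\<Psi> w) = (c * w) ^ B * (1 + e n w)\<close>, the terms of degree at most \<open>p\<close> of the
  Laurent expansion of \<open>g \<circ> \<Psi>\<close> contribute nothing to the integral against \<open>e n\<close>, as \<open>e n\<close> vanishes at
  infinity. Hence the \<open>p\<close>-th term is dominated on a large circle by the sum of the later ones, which
  contradicts the superexponential decay of the coefficients unless they vanish eventually.\<close>
lemma entire_imp_eventually_0:
  assumes g: "extends_to E \<Phi> G \<infinity> g"
    and deg: "\<And>n. n \<ge> n0 \<Longrightarrow> degree (q n) \<le> B" and lead: "\<And>n. n \<ge> n0 \<Longrightarrow> coeff (q n) B = 1"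
    and bnd: "\<And>n i. n \<ge> n0 \<Longrightarrow> norm (coeff (q n) i) \<le> K"
    and zero: "\<And>n. n \<ge> n0 \<Longrightarrow> faber_coeff E \<Phi> (\<lambda>z. poly (q n) z * G z) n = 0"
  shows "\<exists>n1. \<forall>n\<ge>n1. faber_coeff E \<Phi> G n = 0"
proof -
  obtain c where c: "c \<noteq> 0" "((\<lambda>w. \<Psi> w / w) \<longlongrightarrow> c) at_infinity" using Psi_lim by blast
  define e where "e = (\<lambda>n w. poly (q n) (\<Psi> w) / (c * w) ^ B - 1)"
  have e_hol: "e n holomorphic_on {w. 1 < norm w}" for n
    unfolding e_def using c by (intro holomorphic_intros poly_Psi_holomorphic) auto
  have e_lim: "(e n \<longlongrightarrow> 0) at_infinity" if "n \<ge> n0" for n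
  proof -
    have "((\<lambda>w. poly (q n) (\<Psi> w) / w ^ B / c ^ B - 1) \<longlongrightarrow> coeff (q n) B * c ^ B / c ^ B - 1) at_infinity"
      by (intro tendsto_intros poly_Psi_lim c deg that) (use c in auto)
    then show ?thesis
      using lead[OF that] c by (simp add: e_def power_mult_distrib mult.commute)
  qed
  \<comment> \<open>A majorant common to all \<open>e n\<close>, obtained from the uniform bound K:
    the circle chosen below must serve every n.\<close>
  define b where "b = (\<lambda>w. norm ((\<Psi> w / w) ^ B / c ^ B - 1) +
      (\<Sum>i<B. K * norm (\<Psi> w ^ i / w ^ B / c ^ B)))"
  have b_lim: "(b \<longlongrightarrow> 0) at_infinity"
  proof -
    have "((\<lambda>w. \<Psi> w ^ i / w ^ B) \<longlongrightarrow> 0) at_infinity" if "i < B" for i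
      using poly_Psi_lim[OF c(2), of "monom 1 i" B] that
      by (simp add: poly_monom degree_monom_eq)
    then have "(b \<longlongrightarrow> norm (c ^ B / c ^ B - 1) + (\<Sum>i<B. K * norm (0 / c ^ B))) at_infinity"
      unfolding b_def by (intro tendsto_intros c) (use c in auto)
    then show ?thesis using c by simp
  qed
  have e_bound: "norm (e n w) \<le> b w" if "n \<ge> n0" "w \<noteq> 0" for n w
  proof -
    have "poly (q n) (\<Psi> w) = \<Psi> w ^ B + (\<Sum>i<B. coeff (q n) i * \<Psi> w ^ i)"
      using poly_eq_sum_le[OF deg[OF that(1)], of "\<Psi> w"] lead[OF that(1)]
      by (simp add: lessThan_Suc_atMost[symmetric])
    then have "e n w = ((\<Psi> w / w) ^ B / c ^ B - 1) + (\<Sum>i<B. coeff (q n) i * (\<Psi> w ^ i / w ^ B / c ^ B))"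
      by (simp add: e_def add_divide_distrib sum_divide_distrib power_mult_distrib power_divide mult.commute)
    also have "norm \<dots> \<le> norm ((\<Psi> w / w) ^ B / c ^ B - 1) + norm (\<Sum>i<B. coeff (q n) i * (\<Psi> w ^ i / w ^ B / c ^ B))"
      by (rule norm_triangle_ineq)
    also have "norm (\<Sum>i<B. coeff (q n) i * (\<Psi> w ^ i / w ^ B / c ^ B)) \<le>
        (\<Sum>i<B. K * norm (\<Psi> w ^ i / w ^ B / c ^ B))"
      by (rule order_trans[OF norm_sum], rule sum_mono, subst norm_mult)
         (intro mult_right_mono bnd that, simp)
    finally show ?thesis by (simp add: b_def)
  qed
  have "\<forall>\<^sub>F w in at_infinity. b w < 1 / 2"
    using order_tendstoD(2)[OF b_lim, of "1/2"] by simp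
  then obtain t0 where t0: "\<And>w. t0 \<le> norm w \<Longrightarrow> b w < 1 / 2"
    by (auto simp: eventually_at_infinity)
  \<comment> \<open>Radius 3 keeps the circle outside the radius 2 used for the principal part; on
    it |\<open>e n\<close>| is at most 1 for all n \<ge> n0.\<close>
  define t where "t = max t0 3"
  have t: "3 \<le> t" "\<And>w. norm w = t \<Longrightarrow> b w < 1 / 2" using t0 by (auto simp: t_def)
  define h where "h = (\<lambda>w. g (\<Psi> w))"
  have h: "h holomorphic_on annulus 1 \<infinity>"
    unfolding h_def using g holomorphic_comp_Psi unfolding extends_to_def by blast
  define a where "a = (\<lambda>n. faber_coeff E \<Phi> G n)"
  have a: "laurent_coeff t h n = a n" for n
    unfolding a_def h_def using faber_coeff_eq[OF g, of t n] t by simp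
  obtain H C where H: "H holomorphic_on {w. 2 < norm w}"
    "\<And>w. 2 * 2 \<le> norm w \<Longrightarrow> norm (H w) \<le> C / norm w"
    "\<And>w. w \<in> annulus 2 \<infinity> \<Longrightarrow> (\<lambda>n. laurent_coeff t h n * w ^ n) sums (h w - H w)"
    by (rule laurent_decomposition[OF h, of t 2]) (use t in auto)
  \<comment> \<open>As g is entire, Cauchy estimates are available on the circle of radius 4 t; the
    resulting decay 4^-p beats the factor 2 per step in
    \<open>vanishing_tail_sequence\<close>.\<close>
  obtain C' where C': "C' \<ge> 0" "\<And>n. norm (a n) \<le> C' / (4 * t) ^ n"
    using faber_coeff_bound[OF g, of "4 * t"] t unfolding a_def by auto
  have term_bound: "norm (a l) * t ^ l \<le> C' * (1 / 4) ^ l" for l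
  proof -
    have "norm (a l) * t ^ l \<le> C' / (4 * t) ^ l * t ^ l"
      using C'(2)[of l] t by (intro mult_right_mono) auto
    also have "\<dots> = C' * (1 / 4) ^ l"
    proof -
      have "t \<noteq> 0" using t by auto
      then show ?thesis by (simp add: power_mult_distrib power_divide)
    qed
    finally show ?thesis .
  qed
  have geo: "summable (\<lambda>l. c * (1 / 4 :: real) ^ l)" for c
    by (rule summable_mult[OF summable_geometric]) simp
  have summ: "summable (\<lambda>l. norm (a l) * t ^ l)"
    by (rule summable_comparison_test'[OF geo, of 0]) (use term_bound t in auto)
  define T where "T = (\<lambda>p. \<Sum>l. norm (a (l + p)) * t ^ (l + p))"
  have summ': "summable (\<lambda>l. norm (a (l + p)) * t ^ (l + p))" for p
    using summ by (subst summable_iff_shift)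
  have T0: "T p \<ge> 0" for p unfolding T_def by (rule suminf_nonneg[OF summ']) (use t in auto)
  have TSuc: "T p = norm (a p) * t ^ p + T (Suc p)" for p
    using suminf_split_head[OF summ'[of p]] by (simp add: T_def)
  have T4: "T p \<le> (C' * 4 / 3) / 4 ^ p" for p
  proof -
    have "(\<lambda>l. C' * (1 / 4) ^ p * (1 / 4 :: real) ^ l) sums (C' * (1 / 4) ^ p * (1 / (1 - 1 / 4)))"
      by (rule sums_mult[OF geometric_sums]) simp
    moreover have "T p \<le> (\<Sum>l. C' * (1 / 4) ^ p * (1 / 4 :: real) ^ l)"
      unfolding T_def
    proof (rule suminf_le[OF _ summ'])
      show "norm (a (l + p)) * t ^ (l + p) \<le> C' * (1 / 4) ^ p * (1 / 4) ^ l" for l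
        using term_bound[of "l + p"] by (simp add: power_add mult_ac)
      show "summable (\<lambda>l. C' * (1 / 4) ^ p * (1 / 4 :: real) ^ l)" by (rule geo)
    qed
    ultimately have "T p \<le> C' * (1 / 4) ^ p * (1 / (1 - 1 / 4))"
      using sums_unique by fastforce
    then show ?thesis by (simp add: power_divide)
  qed
  have key: "norm (a p) * t ^ p \<le> T (Suc p)" if p: "p \<ge> n0" for p
  proof -
    \<comment> \<open>Multiplication by \<open>q n\<close>, which behaves like (c w)^B, moves the
      coefficient of index p to index p + B; the equation of that index therefore speaks about
      \<open>a p\<close>.\<close>
    define n where "n = p + B"
    have n: "n \<ge> n0" using p by (simp add: n_def)
    \<comment> \<open>The term of degree p is included, so that \<open>hi\<close> is exactly the
      tail measured by \<open>T (Suc p)\<close>.\<close>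
    define lo where "lo = (\<lambda>w. H w + (\<Sum>l<Suc p. a l * w ^ l))"
    define hi where "hi = (\<lambda>w. h w - lo w)"
    define I where "I = contour_integral (circlepath 0 t)"
    have hol: "e n holomorphic_on annulus 2 \<infinity>" "h holomorphic_on annulus 2 \<infinity>" "lo holomorphic_on annulus 2 \<infinity>"
      "\<Psi> holomorphic_on annulus 2 \<infinity>"
      using e_hol[of n] h H(1) Psi_holomorphic unfolding lo_def annulus_infinity
      by (auto intro!: holomorphic_intros elim!: holomorphic_on_subset)
    have nz: "w \<noteq> 0" if "w \<in> annulus 2 \<infinity>" for w using that by (auto simp: mem_annulus)
    have int: "f contour_integrable_on circlepath 0 t" if "f holomorphic_on annulus 2 \<infinity>" for f
      by (rule contour_integrable_circlepath_annulus[OF that]) (use t in auto)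
    have i1: "(\<lambda>w. h w / w ^ (p + 1)) contour_integrable_on circlepath 0 t"
      by (intro int holomorphic_intros hol) (use nz in auto)
    have i2: "(\<lambda>w. e n w * lo w / w ^ (p + 1)) contour_integrable_on circlepath 0 t"
      by (intro int holomorphic_intros hol) (use nz in auto)
    have i3: "(\<lambda>w. e n w * hi w / w ^ (p + 1)) contour_integrable_on circlepath 0 t"
      unfolding hi_def by (intro int holomorphic_intros hol) (use nz in auto)
    have I1: "I (\<lambda>w. h w / w ^ (p + 1)) = 2 * of_real pi * \<i> * a p"
      using a[of p] by (simp add: laurent_coeff_def I_def field_simps)
    have I2: "I (\<lambda>w. e n w * lo w / w ^ (p + 1)) = 2 * of_real pi * \<i> * 0"
      unfolding I_def
    proof (rule contour_integral_at_infinity[where a = 2])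
      show "(\<lambda>w. e n w * lo w / w ^ (p + 1)) holomorphic_on {w. 2 < norm w}"
        using hol nz unfolding annulus_infinity[symmetric] by (intro holomorphic_intros hol) auto
      \<comment> \<open>After division by w^p the part \<open>lo\<close> tends to
        \<open>a p\<close>; being bounded, it is killed at infinity by the factor
        \<open>e n\<close>.\<close>
      have "((\<lambda>w. e n w * ((H w + (\<Sum>l<p. a l * w ^ l)) / w ^ p + a p)) \<longlongrightarrow> 0 * (0 + a p)) at_infinity"
        by (intro tendsto_intros e_lim n low_part_lim inner_part_tendsto_0[OF H(2)])
      moreover have "\<forall>\<^sub>F w in at_infinity. e n w * ((H w + (\<Sum>l<p. a l * w ^ l)) / w ^ p + a p) =
          w * (e n w * lo w / w ^ (p + 1))"
        using eventually_not_equal_at_infinity[of 0]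
        by eventually_elim (simp add: lo_def field_simps)
      ultimately show "((\<lambda>w. w * (e n w * lo w / w ^ (p + 1))) \<longlongrightarrow> 0) at_infinity"
        using Lim_transform_eventually by fastforce
    qed (use t in auto)
    have "norm (I (\<lambda>w. e n w * hi w / w ^ (p + 1))) \<le> (T (Suc p) / t ^ (p + 1)) * (2 * pi * t)"
      unfolding I_def
    proof (rule has_contour_integral_bound_circlepath[OF has_contour_integral_integral[OF i3]])
      show "0 < t" using t by simp
      show "0 \<le> T (Suc p) / t ^ (p + 1)" using T0 t by simp
      fix w :: complex assume "norm (w - 0) = t"
      then have w: "norm w = t" "w \<noteq> 0" "w \<in> annulus 2 \<infinity>" using t by (auto simp: mem_annulus)
      have "norm (e n w) \<le> 1" using e_bound[OF n w(2)] t(2)[OF w(1)] by simp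
      moreover have "norm (hi w) \<le> T (Suc p)"
      proof -
        have "(\<lambda>n. a n * w ^ n) sums (h w - H w)" using H(3)[OF w(3)] by (simp add: a)
        then have "(\<lambda>l. a (l + Suc p) * w ^ (l + Suc p)) sums (h w - H w - (\<Sum>l<Suc p. a l * w ^ l))"
          by (rule sums_split_initial_segment)
        then have "hi w = (\<Sum>l. a (l + Suc p) * w ^ (l + Suc p))"
          by (auto simp: hi_def lo_def sums_iff algebra_simps)
        moreover have "norm (\<Sum>l. a (l + Suc p) * w ^ (l + Suc p)) \<le> (\<Sum>l. norm (a (l + Suc p) * w ^ (l + Suc p)))"
          by (rule summable_norm) (use summ'[of "Suc p"] w in \<open>simp add: norm_mult norm_power\<close>)
        ultimately show ?thesis using w by (simp add: T_def norm_mult norm_power)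
      qed
      ultimately have "norm (e n w) * norm (hi w) \<le> 1 * T (Suc p)" by (intro mult_mono) auto
      then show "norm (e n w * hi w / w ^ (p + 1)) \<le> T (Suc p) / t ^ (p + 1)"
        using w t by (simp add: norm_mult norm_divide norm_power divide_right_mono)
    qed
    then have I3: "norm (I (\<lambda>w. e n w * hi w / w ^ (p + 1))) \<le> 2 * pi * (T (Suc p) / t ^ p)"
      using t by (simp add: mult_ac)
    have qg: "extends_to E \<Phi> (\<lambda>z. poly (q n) z * G z) \<infinity> (\<lambda>z. poly (q n) z * g z)"
      using g by (auto simp: extends_to_def agree_near_def intro!: holomorphic_intros)
    have "0 = laurent_coeff t (\<lambda>w. poly (q n) (\<Psi> w) * g (\<Psi> w)) n"
      using faber_coeff_eq[OF qg, of t n] zero[OF n] t by simp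
    then have "0 = I (\<lambda>w. poly (q n) (\<Psi> w) * h w / w ^ (n + 1))"
      by (simp add: laurent_coeff_def I_def h_def)
    also have "\<dots> = I (\<lambda>w. c ^ B * (h w / w ^ (p + 1) + e n w * lo w / w ^ (p + 1) + e n w * hi w / w ^ (p + 1)))"
      unfolding I_def
    proof (rule contour_integral_cong[OF refl])
      fix w assume "w \<in> path_image (circlepath 0 t)"
      then have w: "w \<noteq> 0" using t by auto
      have 1: "poly (q n) (\<Psi> w) = c ^ B * w ^ B * (1 + e n w)"
        using w c by (simp add: e_def power_mult_distrib)
      have "h w + e n w * lo w + e n w * hi w = (1 + e n w) * h w"
        by (simp add: hi_def algebra_simps)
      then have 2: "h w / w ^ (p + 1) + e n w * lo w / w ^ (p + 1) + e n w * hi w / w ^ (p + 1) =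
          (1 + e n w) * h w / w ^ (p + 1)"
        by (simp only: add_divide_distrib[symmetric])
      have 3: "w ^ (n + 1) = w ^ B * w ^ (p + 1)" by (simp add: n_def power_add)
      show "poly (q n) (\<Psi> w) * h w / w ^ (n + 1) =
         c ^ B * (h w / w ^ (p + 1) + e n w * lo w / w ^ (p + 1) + e n w * hi w / w ^ (p + 1))"
        unfolding 1 2 3 using w by simp
    qed
    also have "\<dots> = c ^ B * (I (\<lambda>w. h w / w ^ (p + 1)) + I (\<lambda>w. e n w * lo w / w ^ (p + 1)) +
        I (\<lambda>w. e n w * hi w / w ^ (p + 1)))"
      unfolding I_def using i1 i2 i3
      by (simp only: contour_integral_lmul contour_integral_add contour_integrable_add)
    finally have "I (\<lambda>w. e n w * hi w / w ^ (p + 1)) = - (2 * of_real pi * \<i> * a p)"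
      using c I1 I2 by (simp add: add_eq_0_iff)
    then have "2 * pi * norm (a p) \<le> 2 * pi * (T (Suc p) / t ^ p)"
      using I3 by (simp add: norm_mult)
    then show ?thesis using t by (simp add: field_simps)
  qed
  have Tz: "T p = 0" if "p \<ge> n0" for p
  proof (rule vanishing_tail_sequence[OF T0 _ T4 that])
    show "T p' \<le> 2 * T (Suc p')" if "p' \<ge> n0" for p'
      using TSuc[of p'] key[OF that] by simp
  qed
  have "a p = 0" if "p \<ge> n0" for p
  proof -
    have "T p = 0" "T (Suc p) = 0" using that Tz by auto
    then have "norm (a p) * t ^ p = 0" using TSuc[of p] by simp
    then show ?thesis using t by simp
  qed
  then show ?thesis unfolding a_def by blast
qed

text \<open>It matters below that the index \<open>s\<close> can be chosen independently of \<open>G\<close>.\<close>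
lemma limit_denominator_extends:
  assumes "1 < \<rho>" "0 < \<delta>" "\<delta> < 1"
  obtains s :: real where "\<rho> < s"
    "\<And>G g n0 qn q. \<lbrakk>G analytic_on E; extends_to E \<Phi> G (ereal \<rho>) g;
        \<And>n. n \<ge> n0 \<Longrightarrow> degree (qn n - q) \<le> B;
        \<And>n i. n \<ge> n0 \<Longrightarrow> norm (coeff (qn n - q) i) \<le> \<delta> ^ n;
        \<And>n. n \<ge> n0 \<Longrightarrow> faber_coeff E \<Phi> (\<lambda>z. poly (qn n) z * G z) n = 0\<rbrakk>
      \<Longrightarrow> \<exists>g'. extends_to E \<Phi> (\<lambda>z. poly q z * G z) (ereal s) g'"
proof -
  \<comment> \<open>As r < \<rho>, coefficients of G are O(r^-n); the factor \<delta>^n improves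
    this to O((r/\<delta>)^-n); and r > \<rho> \<delta> makes s = r/\<delta> exceed \<rho>. None of
    these choices involves G.\<close>
  define r where "r = (max 1 (\<rho> * \<delta>) + \<rho>) / 2"
  have \<rho>\<delta>: "\<rho> * \<delta> < \<rho>" using assms by simp
  have r: "1 < r" "r < \<rho>" "\<rho> * \<delta> < r" using assms \<rho>\<delta> by (auto simp: r_def max_def)
  show ?thesis
  proof (rule that[of "r / \<delta>"])
    show "\<rho> < r / \<delta>" using r assms by (simp add: field_simps)
    fix G g n0 qn q
    assume G: "G analytic_on E" "extends_to E \<Phi> G (ereal \<rho>) g"
      and deg: "\<And>n. n \<ge> n0 \<Longrightarrow> degree (qn n - q) \<le> B"
      and bnd: "\<And>n i. n \<ge> n0 \<Longrightarrow> norm (coeff (qn n - q) i) \<le> \<delta> ^ n"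
      and zero: "\<And>n. n \<ge> n0 \<Longrightarrow> faber_coeff E \<Phi> (\<lambda>z. poly (qn n) z * G z) n = 0"
    \<comment> \<open>The factor \<open>qn n - q\<close> varies with n, so the estimates are made
      for the fixed functions z^i G and combined through its coefficients.\<close>
    have "\<exists>C\<ge>0. \<forall>n. norm (faber_coeff E \<Phi> (\<lambda>z. z ^ i * G z) n) \<le> C / r ^ n" for i
    proof (rule faber_coeff_bound)
      show "extends_to E \<Phi> (\<lambda>z. z ^ i * G z) (ereal \<rho>) (\<lambda>z. z ^ i * g z)"
        using G by (auto simp: extends_to_def agree_near_def intro!: holomorphic_intros)
    qed (use r assms in auto)
    then obtain C where C: "\<And>i. C i \<ge> 0" "\<And>i n. norm (faber_coeff E \<Phi> (\<lambda>z. z ^ i * G z) n) \<le> C i / r ^ n"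
      by metis
    have qG: "(\<lambda>z. poly q z * G z) analytic_on E" for q using G by (intro analytic_intros)
    have "norm (faber_coeff E \<Phi> (\<lambda>z. poly q z * G z) n) \<le> (\<Sum>i\<le>B. C i) / (r / \<delta>) ^ n" if n: "n \<ge> n0" for n
    proof -
      have "faber_coeff E \<Phi> (\<lambda>z. poly (qn n) z * G z + - 1 * (poly q z * G z)) n =
         faber_coeff E \<Phi> (\<lambda>z. poly (qn n) z * G z) n + - 1 * faber_coeff E \<Phi> (\<lambda>z. poly q z * G z) n"
        using faber_coeff_add[OF qG, of "\<lambda>z. - 1 * (poly q z * G z)" "qn n"] faber_coeff_cmult[OF qG]
        by (simp only: analytic_intros qG)
      moreover have "(\<lambda>z. poly (qn n) z * G z + - 1 * (poly q z * G z)) = (\<lambda>z. poly (qn n - q) z * G z)"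
        by (simp add: fun_eq_iff algebra_simps)
      ultimately have "faber_coeff E \<Phi> (\<lambda>z. poly q z * G z) n = - faber_coeff E \<Phi> (\<lambda>z. poly (qn n - q) z * G z) n"
        using zero[OF n] by simp
      then have "norm (faber_coeff E \<Phi> (\<lambda>z. poly q z * G z) n) =
          norm (\<Sum>i\<le>B. coeff (qn n - q) i * faber_coeff E \<Phi> (\<lambda>z. z ^ i * G z) n)"
        using faber_coeff_poly_mult[OF G(1) deg[OF n]] by simp
      also have "\<dots> \<le> (\<Sum>i\<le>B. \<delta> ^ n * (C i / r ^ n))"
        by (rule order_trans[OF norm_sum], rule sum_mono, subst norm_mult)
           (intro mult_mono bnd n C, use assms in auto)
      also have "\<dots> = (\<Sum>i\<le>B. C i) / (r / \<delta>) ^ n"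
        by (simp add: sum_distrib_left sum_divide_distrib power_divide sum_distrib_right mult_ac)
      finally show ?thesis .
    qed
    moreover have "1 < r / \<delta>" using r assms \<open>\<rho> < r / \<delta>\<close> by linarith
    moreover have "extends_to E \<Phi> (\<lambda>z. poly q z * G z) (ereal \<rho>) (\<lambda>z. poly q z * g z)"
      using G by (auto simp: extends_to_def agree_near_def intro!: holomorphic_intros)
    ultimately show "\<exists>g'. extends_to E \<Phi> (\<lambda>z. poly q z * G z) (ereal (r / \<delta>)) g'"
      using extends_to_of_coeff_bound[of "\<lambda>z. poly q z * G z" "ereal \<rho>" _ "r / \<delta>" n0] assms(1) by auto
  qed
qed

section \<open>Continuation across a level curve\<close>

lemma poly_mult_extends:
  "extends_to E \<Phi> G \<rho> g \<Longrightarrow> extends_to E \<Phi> (\<lambda>z. poly q z * G z) \<rho> (\<lambda>z. poly q z * g z)"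
  by (auto simp: extends_to_def agree_near_def intro!: holomorphic_intros)

text \<open>The continuation is h/q. Below level \<rho> it equals g; on that level its singularities
  off B are removable by the vanishing Taylor coefficients; beyond it, \<rho>' does not exceed the
  lowest level above \<rho> that carries a zero of q.\<close>

lemma extend_quotient:
  assumes g: "extends_to E \<Phi> G (ereal \<rho>) g" and h: "extends_to E \<Phi> (\<lambda>z. poly q z * G z) (ereal s) h"
    and \<rho>: "1 < \<rho>" "\<rho> < s" and "q \<noteq> 0" and B: "\<And>\<zeta>. \<zeta> \<in> B \<Longrightarrow> \<zeta> \<notin> E \<and> norm (\<Phi> \<zeta>) = \<rho>"
    and zero: "\<And>\<zeta> j. \<lbrakk>\<zeta> \<notin> E; norm (\<Phi> \<zeta>) = \<rho>; \<zeta> \<notin> B; j < order \<zeta> q\<rbrakk> \<Longrightarrow> taylor_coeff h \<zeta> j = 0"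
  obtains \<rho>' k where "\<rho> < \<rho>'" "\<rho>' \<le> s" "k holomorphic_on D (ereal \<rho>') - B" "agree_near E k G"
    "\<And>z. \<lbrakk>z \<in> D (ereal \<rho>'); poly q z \<noteq> 0\<rbrakk> \<Longrightarrow> k z = h z / poly q z"
proof -
  define Z where "Z = {\<zeta>. poly q \<zeta> = 0}"
  have "finite Z" unfolding Z_def using \<open>q \<noteq> 0\<close> by (rule poly_roots_finite)
  define M where "M = insert s ((\<lambda>\<zeta>. norm (\<Phi> \<zeta>)) ` {\<zeta> \<in> Z. \<rho> < norm (\<Phi> \<zeta>)})"
  have M: "finite M" "M \<noteq> {}" using \<open>finite Z\<close> by (auto simp: M_def)
  define \<rho>' where "\<rho>' = Min M"
  have \<rho>': "\<rho> < \<rho>'" "\<rho>' \<le> s"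
    using M \<rho> by (auto simp: \<rho>'_def M_def)
  have Zout: "norm (\<Phi> \<zeta>) \<le> \<rho>" if "\<zeta> \<in> Z" "\<zeta> \<in> D (ereal \<rho>')" "\<zeta> \<notin> E" for \<zeta>
  proof (rule ccontr)
    assume "\<not> norm (\<Phi> \<zeta>) \<le> \<rho>"
    then have "norm (\<Phi> \<zeta>) \<in> M" using that by (auto simp: M_def)
    then have "\<rho>' \<le> norm (\<Phi> \<zeta>)" using M by (simp add: \<rho>'_def)
    then show False using that by (simp add: mem_D)
  qed
  define k0 where "k0 = (\<lambda>z. h z / poly q z)"
  \<comment> \<open>Division by 0 gives \<open>k0\<close> the value 0 at every zero of q;
    \<open>remove_sings\<close> restores the analytic value where the singularity is
    removable.\<close>
  define k where "k = remove_sings k0"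
  have opD: "open (D (ereal \<rho>))" "open (D (ereal s))" using \<rho> by (auto intro!: open_D)
  have D: "D (ereal \<rho>') \<subseteq> D (ereal s)" "D (ereal \<rho>) \<subseteq> D (ereal \<rho>')" using \<rho>' by (auto intro!: D_mono)
  have h_an: "h analytic_on {z}" if "z \<in> D (ereal s)" for z
    using h that opD analytic_at unfolding extends_to_def by blast
  have hqg: "h z = poly q z * g z" if "z \<in> D (ereal \<rho>)" for z
    by (rule extends_to_unique[OF h poly_mult_extends[OF g]]) (use \<rho> that D in auto)
  have nz: "\<forall>\<^sub>F w in at z. poly q w \<noteq> 0" for z
  proof -
    have "open (- (Z - {z}))" using \<open>finite Z\<close> by (intro open_Compl finite_imp_closed) auto
    then have "\<forall>\<^sub>F w in nhds z. w \<in> - (Z - {z})" by (rule eventually_nhds_in_open) auto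
    then show ?thesis by (auto simp: eventually_at_filter Z_def elim!: eventually_mono)
  qed
  have k_an0: "k analytic_on {z} \<and> k z = h z / poly q z" if "z \<in> D (ereal s)" "poly q z \<noteq> 0" for z
  proof -
    have "k0 analytic_on {z}"
      unfolding k0_def using that h_an by (intro analytic_intros) auto
    then show ?thesis
      unfolding k_def using remove_sings_eventually_analytic[of k0 z k0] by (auto simp: k0_def)
  qed
  have k_an1: "k analytic_on {z} \<and> k z = g z" if z: "z \<in> D (ereal \<rho>)" for z
  proof -
    have "g analytic_on {z}" using g z opD analytic_at unfolding extends_to_def by blast
    moreover have "\<forall>\<^sub>F w in at z. k0 w = g w"
    proof -
      have "\<forall>\<^sub>F w in at z. w \<in> D (ereal \<rho>)" using opD z eventually_at_in_open' by blast
      then show ?thesis using nz by eventually_elim (simp add: k0_def hqg)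
    qed
    ultimately show ?thesis unfolding k_def using remove_sings_eventually_analytic by blast
  qed
  have k_an2: "k analytic_on {z}" if z: "z \<in> D (ereal \<rho>') - B" for z
  proof (cases "z \<in> D (ereal \<rho>) \<or> poly q z \<noteq> 0")
    case True then show ?thesis using k_an0 k_an1 z D by blast
  next
    case False
    then have z': "z \<notin> E" "\<rho> \<le> norm (\<Phi> z)" "z \<in> Z" by (auto simp: mem_D Z_def)
    then have "norm (\<Phi> z) = \<rho>" using Zout[of z] z by auto
    then have "taylor_coeff h z j = 0" if "j < order z q" for j
      using zero[of z j] z z' that by blast
    then obtain K where K: "K analytic_on {z}" "\<forall>\<^sub>F w in nhds z. h w = (w - z) ^ order z q * K w"
      using taylor_factor[OF h_an, of z "order z q"] z D by blast
    obtain R where R: "\<And>w. poly q w = (w - z) ^ order z q * poly R w" "poly R z \<noteq> 0"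
      using poly_order_factor[OF \<open>q \<noteq> 0\<close>, of z] by blast
    have K': "\<forall>\<^sub>F w in at z. h w = (w - z) ^ order z q * K w"
      using K(2) by (auto simp: eventually_at_filter elim!: eventually_mono)
    have "(\<lambda>w. K w / poly R w) analytic_on {z}"
      using K R by (intro analytic_intros) auto
    moreover have "\<forall>\<^sub>F w in at z. k0 w = K w / poly R w"
      using nz K' eventually_neq_at_within[of z z UNIV]
      by eventually_elim (simp add: k0_def R(1))
    ultimately show ?thesis unfolding k_def using remove_sings_eventually_analytic(1) by blast
  qed
  show ?thesis
  proof
    show "\<rho> < \<rho>'" "\<rho>' \<le> s" by fact+
    show "k holomorphic_on D (ereal \<rho>') - B"
      using k_an2 analytic_on_analytic_at analytic_imp_holomorphic by blast
    obtain U where "open U" "E \<subseteq> U" "\<forall>z\<in>U. g z = G z"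
      using g unfolding extends_to_def agree_near_def by blast
    then show "agree_near E k G"
      unfolding agree_near_def using k_an1 opD E_subset_D
      by (intro exI[of _ "U \<inter> D (ereal \<rho>)"]) auto
    show "k z = h z / poly q z" if "z \<in> D (ereal \<rho>')" "poly q z \<noteq> 0" for z
      using k_an0 that D by blast
  qed
qed

lemma closure_D_subset:
  assumes "\<rho> < \<rho>'"
  shows "closure (D (ereal \<rho>)) \<subseteq> D (ereal \<rho>')"
proof -
  have "closure (D (ereal \<rho>)) \<subseteq> - {z \<in> - E. \<rho> < norm (\<Phi> z)}"
  proof (rule closure_minimal)
    show "closed (- {z \<in> - E. \<rho> < norm (\<Phi> z)})" using open_Phi_gt by (rule closed_Compl)
  qed (auto simp: mem_D)
  also have "\<dots> \<subseteq> D (ereal \<rho>')" using assms by (auto simp: mem_D)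
  finally show ?thesis .
qed

text \<open>Shrinking \<Phi> \<xi> radially by a factor close to 1 lowers the level, and the image
  of W under \<Phi>, being open, still contains the new point. So a level curve lies in the closure
  of its canonical domain.\<close>

lemma level_point_in_closure:
  assumes "\<xi> \<notin> E" "open W" "\<xi> \<in> W"
  obtains z where "z \<in> W" "z \<in> D (ereal (norm (\<Phi> \<xi>)))"
proof -
  define w where "w = \<Phi> \<xi>"
  have w: "1 < norm w" using norm_Phi assms by (simp add: w_def)
  have "open (\<Phi> ` (W \<inter> - E))"
  proof (rule open_mapping_thm3)
    show "\<Phi> holomorphic_on W \<inter> - E" using Phi_holomorphic by (rule holomorphic_on_subset) auto
    show "inj_on \<Phi> (W \<inter> - E)" using Phi_inj by (rule inj_on_subset) auto
  qed (use assms open_compl_E in auto)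
  moreover have "w \<in> \<Phi> ` (W \<inter> - E)" using assms by (auto simp: w_def)
  ultimately obtain e where e: "e > 0" "ball w e \<subseteq> \<Phi> ` (W \<inter> - E)"
    using open_contains_ball by blast
  define \<eta> where "\<eta> = min (1 / 2) (e / (2 * norm w))"
  have \<eta>: "0 < \<eta>" "\<eta> < 1" "norm w * \<eta> < e"
  proof -
    have "0 < norm w" using w by linarith
    then have "0 < e / (2 * norm w)" using e by simp
    then show "0 < \<eta>" "\<eta> < 1" by (auto simp: \<eta>_def)
    have "norm w * \<eta> \<le> norm w * (e / (2 * norm w))" by (intro mult_left_mono) (auto simp: \<eta>_def)
    also have "\<dots> < e" using e \<open>0 < norm w\<close> by simp
    finally show "norm w * \<eta> < e" .
  qed
  define w' where "w' = of_real (1 - \<eta>) * w"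
  have "w - w' = of_real \<eta> * w" by (simp add: w'_def algebra_simps)
  then have "dist w w' < e" using \<eta> by (simp add: dist_norm norm_mult mult.commute)
  then have "w' \<in> \<Phi> ` (W \<inter> - E)" using e(2) by auto
  then obtain z where z: "z \<in> W" "z \<notin> E" "\<Phi> z = w'" by auto
  have "norm w' = (1 - \<eta>) * norm w" using \<eta> by (simp only: w'_def norm_mult norm_of_real)
  also have "\<dots> < norm w"
  proof -
    have "0 < \<eta> * norm w" using \<eta> w by (intro mult_pos_pos) linarith+
    then show ?thesis by (simp add: algebra_simps)
  qed
  finally show ?thesis using that[of z] z by (auto simp: mem_D w_def)
qed

end

subsection \<open>System poles and the limit of the denominators\<close>

text \<open>The situation for n \<ge> n0, with a geometric rate \<delta> in place of the limsup. The
  exact degree of \<open>Q n\<close> and the leading coefficient of \<open>Qm\<close>, both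
  consequences of convergence, are assumed here.\<close>

locale pade_faber = exterior_map +
  fixes d :: nat and F :: "nat \<Rightarrow> complex \<Rightarrow> complex" and m :: "nat \<Rightarrow> nat"
    and Q :: "nat \<Rightarrow> complex poly" and Qm :: "complex poly" and \<delta> :: real and n0 :: nat
  assumes m_pos: "\<alpha> \<in> {1..d} \<Longrightarrow> 1 \<le> m \<alpha>"
    and F_analytic: "\<alpha> \<in> {1..d} \<Longrightarrow> F \<alpha> analytic_on E"
    and \<delta>: "0 < \<delta>" "\<delta> < 1" and n0: "1 \<le> n0"
    and denominator: "n \<ge> n0 \<Longrightarrow> monic_pade_faber_denominator E \<Phi> d F m n (Q n)"
    and unique: "\<lbrakk>n \<ge> n0; monic_pade_faber_denominator E \<Phi> d F m n q\<rbrakk> \<Longrightarrow> q = Q n"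
    and conv: "n \<ge> n0 \<Longrightarrow> norm (coeff (Q n - Qm) i) \<le> \<delta> ^ n"
    and degree_Q: "n \<ge> n0 \<Longrightarrow> degree (Q n) = mi_size d m"
    and degree_Qm: "degree Qm = mi_size d m"
    and lead_Qm: "lead_coeff Qm = 1"
begin

abbreviation N :: nat where "N \<equiv> mi_size d m"

definition I :: "(nat \<times> nat) set" where "I = (SIGMA \<alpha>:{1..d}. {..<m \<alpha>})"

text \<open>Coordinates stand in for functions because independence of the products z^k F_\<alpha>
  is not given: a nonzero combination means one with some \<open>x i0 \<noteq> 0\<close>.\<close>

definition f :: "(nat \<times> nat \<Rightarrow> complex) \<Rightarrow> complex \<Rightarrow> complex" where
  "f x z = (\<Sum>i\<in>I. x i * (z ^ snd i * F (fst i) z))"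

lemma finite_I: "finite I" and card_I: "card I = N"
  by (auto simp: I_def mi_size_def)

lemma Qm_nz: "Qm \<noteq> 0"
  using lead_Qm by auto

lemma F_analytic': "i \<in> I \<Longrightarrow> F (fst i) analytic_on E"
  by (auto simp: I_def intro!: F_analytic)

lemma f_analytic: "f x analytic_on E"
  unfolding f_def[abs_def] by (intro analytic_intros F_analytic')

lemma f_linear: "f (\<lambda>i. u * x i + v * y i) z = u * f x z + v * f y z"
  by (simp add: f_def algebra_simps sum.distrib sum_distrib_left)

lemma faber_coeff_poly_f:
  "faber_coeff E \<Phi> (\<lambda>z. poly q z * f x z) n =
     (\<Sum>i\<in>I. x i * faber_coeff E \<Phi> (\<lambda>z. poly q z * z ^ snd i * F (fst i) z) n)"
proof -
  have "(\<lambda>z. poly q z * f x z) = (\<lambda>z. \<Sum>i\<in>I. x i * (poly q z * z ^ snd i * F (fst i) z))"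
    by (simp add: f_def sum_distrib_left mult_ac fun_eq_iff)
  then show ?thesis
    using faber_coeff_sum[OF finite_I, of "\<lambda>i z. poly q z * z ^ snd i * F (fst i) z" x n]
    by (simp add: analytic_intros F_analytic')
qed

lemma denominator_iff:
  assumes "n \<ge> 1"
  shows "monic_pade_faber_denominator E \<Phi> d F m n q \<longleftrightarrow> lead_coeff q = 1 \<and> degree q \<le> N \<and>
    (\<forall>i\<in>I. faber_coeff E \<Phi> (\<lambda>z. poly q z * z ^ snd i * F (fst i) z) n = 0)"
proof -
  have "monic_pade_faber_denominator E \<Phi> d F m n q \<longleftrightarrow> lead_coeff q = 1 \<and> degree q \<le> N \<and>
    (\<forall>\<alpha>\<in>{1..d}. \<forall>k<m \<alpha>. faber_coeff E \<Phi> (\<lambda>z. poly q z * z ^ k * F \<alpha> z) n = 0)"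
    by (rule monic_denominator_iff[OF F_analytic assms])
  then show ?thesis by (auto simp: I_def)
qed

lemma faber_coeff_Q_f: "n \<ge> n0 \<Longrightarrow> faber_coeff E \<Phi> (\<lambda>z. poly (Q n) z * f x z) n = 0"
  using denominator[of n] denominator_iff[of n "Q n"] n0 unfolding faber_coeff_poly_f by simp

text \<open>Otherwise one of the \<open>N\<close> linear equations for the denominator would be redundant for large \<open>n\<close>,
  which would leave room for a second solution, of degree less than \<open>N\<close>.\<close>
lemma not_eventually_0:
  assumes i0: "i0 \<in> I" "x i0 \<noteq> 0" and zero: "\<forall>n\<ge>n1. faber_coeff E \<Phi> (f x) n = 0"
  shows False
proof -
  define n where "n = max n0 (n1 + N)"
  have n: "n \<ge> n0" "n \<ge> 1" "n \<ge> n1 + N" using n0 by (auto simp: n_def)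
  define c where "c = (\<lambda>i l. faber_coeff E \<Phi> (\<lambda>z. z ^ l * (z ^ snd i * F (fst i) z)) n)"
  \<comment> \<open>One equation is dropped, so N - 1 equations face the N coefficients of a
    polynomial of degree below N.\<close>
  have "card (I - {i0}) < card {..<N}"
    using card_Diff1_less[OF finite_I i0(1)] card_I by simp
  then obtain y where y: "\<exists>l\<in>{..<N}. y l \<noteq> 0" "\<forall>i\<in>I - {i0}. (\<Sum>l\<in>{..<N}. c i l * y l) = 0"
    using homogeneous_system_nontrivial[of "I - {i0}" "{..<N}" c] finite_I by auto
  define R where "R = (\<Sum>l<N. monom (y l) l)"
  have cR: "coeff R l = (if l < N then y l else 0)" for l
    by (simp add: R_def coeff_sum if_distrib[of "\<lambda>f. f _"] cong: if_cong)
  then have "R \<noteq> 0" using y(1) by (metis coeff_0 lessThan_iff)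
  have "N \<noteq> 0" using y(1) by auto
  have "degree R \<le> N - 1" by (rule degree_le) (use cR in auto)
  then have degR: "degree R < N" using \<open>N \<noteq> 0\<close> by simp
  have R0: "faber_coeff E \<Phi> (\<lambda>z. poly R z * z ^ snd i * F (fst i) z) n = 0" if "i \<in> I - {i0}" for i
  proof -
    have "faber_coeff E \<Phi> (\<lambda>z. poly R z * (z ^ snd i * F (fst i) z)) n =
      (\<Sum>l\<le>N. coeff R l * c i l)"
      unfolding c_def
    proof (rule faber_coeff_poly_mult)
      show "(\<lambda>z. z ^ snd i * F (fst i) z) analytic_on E"
        using F_analytic'[of i] that by (intro analytic_intros) blast
      show "degree R \<le> N" using degR by simp
    qed
    also have "\<dots> = (\<Sum>l<N. c i l * y l)"
      unfolding lessThan_Suc_atMost[symmetric] by (simp add: cR mult.commute)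
    also have "\<dots> = 0" using y(2) that by auto
    finally show ?thesis by (simp add: mult.assoc)
  qed
  \<comment> \<open>The coefficients of \<open>f x\<close> vanish from n1 on and n \<ge> n1 + N, so
    this one vanishes as well. Expanded in the coordinates of x it is \<open>x i0\<close> times the
    left side of the dropped equation.\<close>
  have "0 = faber_coeff E \<Phi> (\<lambda>z. poly R z * f x z) n"
    using faber_coeff_poly_mult_eventually_0[OF f_analytic, of n1 x R N n] zero degR n by simp
  also have "\<dots> = x i0 * faber_coeff E \<Phi> (\<lambda>z. poly R z * z ^ snd i0 * F (fst i0) z) n"
    unfolding faber_coeff_poly_f by (subst sum.remove[OF finite_I i0(1)]) (simp add: R0)
  finally have R1: "faber_coeff E \<Phi> (\<lambda>z. poly R z * z ^ snd i0 * F (fst i0) z) n = 0"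
    using i0 by simp
  define R' where "R' = smult (inverse (lead_coeff R)) R"
  have "faber_coeff E \<Phi> (\<lambda>z. poly R' z * z ^ snd i * F (fst i) z) n = 0" if "i \<in> I" for i
  proof -
    have "(\<lambda>z. poly R' z * z ^ snd i * F (fst i) z) =
        (\<lambda>z. inverse (lead_coeff R) * (poly R z * z ^ snd i * F (fst i) z))"
      by (simp add: R'_def mult.assoc)
    moreover have "(\<lambda>z. poly R z * z ^ snd i * F (fst i) z) analytic_on E"
      using F_analytic'[OF that] by (intro analytic_intros)
    ultimately show ?thesis
      using faber_coeff_cmult R0[of i] R1 that by (cases "i = i0") simp_all
  qed
  moreover have "lead_coeff R' = 1" "degree R' < N" using \<open>R \<noteq> 0\<close> degR by (auto simp: R'_def)
  ultimately have "R' = Q n" using unique[OF n(1)] denominator_iff[OF n(2)] by (simp add: less_imp_le)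
  then show False using \<open>degree R' < N\<close> degree_Q[OF n(1)] by simp
qed

lemma f_not_entire:
  assumes "i0 \<in> I" "x i0 \<noteq> 0"
  shows "\<not> extends_to E \<Phi> (f x) \<infinity> g"
proof
  assume g: "extends_to E \<Phi> (f x) \<infinity> g"
  have "\<exists>n1. \<forall>n\<ge>n1. faber_coeff E \<Phi> (f x) n = 0"
  proof (rule entire_imp_eventually_0[OF g, where q = Q and B = N and ?n0.0 = n0
        and K = "1 + (\<Sum>l\<le>N. norm (coeff Qm l))"])
    fix n assume n: "n \<ge> n0"
    show "degree (Q n) \<le> N" using degree_Q n by simp
    show "coeff (Q n) N = 1"
      using denominator[OF n] degree_Q[OF n] by (auto simp: monic_pade_faber_denominator_def)
    show "faber_coeff E \<Phi> (\<lambda>z. poly (Q n) z * f x z) n = 0" using n by (rule faber_coeff_Q_f)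
    show "norm (coeff (Q n) i) \<le> 1 + (\<Sum>l\<le>N. norm (coeff Qm l))" for i
    proof -
      have "norm (coeff Qm i) \<le> (\<Sum>l\<le>N. norm (coeff Qm l))"
      proof (cases "i \<le> N")
        case True then show ?thesis by (intro member_le_sum) auto
      next
        case False then show ?thesis using degree_Qm by (simp add: coeff_eq_0 sum_nonneg)
      qed
      moreover have "norm (coeff (Q n - Qm) i) \<le> 1"
        using conv[OF n, of i] \<delta> power_le_one[of \<delta> n] by linarith
      moreover have eq: "coeff (Q n) i = coeff (Q n - Qm) i + coeff Qm i" by simp
      ultimately show ?thesis
        unfolding eq using norm_triangle_ineq[of "coeff (Q n - Qm) i" "coeff Qm i"] by linarith
    qed
  qed
  then show False using not_eventually_0[of i0 x] assms by blast
qed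

lemma index_of_f:
  assumes "i0 \<in> I" "x i0 \<noteq> 0"
  obtains \<rho> g where "1 < \<rho>" "extends_to E \<Phi> (f x) (ereal \<rho>) g"
    "\<And>\<rho>' g'. \<rho> < \<rho>' \<Longrightarrow> \<not> extends_to E \<Phi> (f x) (ereal \<rho>') g'"
proof -
  obtain \<rho>1 :: real where "1 < \<rho>1" "extends_to E \<Phi> (f x) (ereal \<rho>1) (f x)"
    using analytic_extends[OF f_analytic] by blast
  then obtain g where g: "extends_to E \<Phi> (f x) (rho0 E \<Phi> (f x)) g"
    using extends_to_rho0[of "f x" "ereal \<rho>1"] by auto
  have 1: "1 < rho0 E \<Phi> (f x)" using f_analytic by (rule rho0_gt_1)
  moreover have "rho0 E \<Phi> (f x) \<noteq> \<infinity>" using f_not_entire[of i0 x g] assms g by auto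
  ultimately obtain \<rho> where \<rho>: "rho0 E \<Phi> (f x) = ereal \<rho>" by (cases "rho0 E \<Phi> (f x)") auto
  show ?thesis
  proof (rule that)
    show "1 < \<rho>" using 1 \<rho> by simp
    show "extends_to E \<Phi> (f x) (ereal \<rho>) g" using g \<rho> by simp
    show "\<not> extends_to E \<Phi> (f x) (ereal \<rho>') g'" if "\<rho> < \<rho>'" for \<rho>' g'
      using rho0_ge[of "f x" "ereal \<rho>'" g'] that \<rho> \<open>1 < \<rho>\<close> by auto
  qed
qed

lemma wider_index_exists:
  assumes "1 < \<rho>"
  shows "\<exists>s>\<rho>. \<forall>x g. extends_to E \<Phi> (f x) (ereal \<rho>) g \<longrightarrow>
    (\<exists>h. extends_to E \<Phi> (\<lambda>z. poly Qm z * f x z) (ereal s) h)"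
proof (rule limit_denominator_extends[OF assms \<delta>, where B = N])
  fix s assume s: "\<rho> < s" and *: "\<And>G g n0 qn q. \<lbrakk>G analytic_on E; extends_to E \<Phi> G (ereal \<rho>) g;
        \<And>n. n \<ge> n0 \<Longrightarrow> degree (qn n - q) \<le> N;
        \<And>n i. n \<ge> n0 \<Longrightarrow> norm (coeff (qn n - q) i) \<le> \<delta> ^ n;
        \<And>n. n \<ge> n0 \<Longrightarrow> faber_coeff E \<Phi> (\<lambda>z. poly (qn n) z * G z) n = 0\<rbrakk>
      \<Longrightarrow> \<exists>g'. extends_to E \<Phi> (\<lambda>z. poly q z * G z) (ereal s) g'"
  have "\<exists>h. extends_to E \<Phi> (\<lambda>z. poly Qm z * f x z) (ereal s) h"
    if "extends_to E \<Phi> (f x) (ereal \<rho>) g" for x g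
    by (rule *[OF f_analytic that, of n0 Q Qm])
       (use degree_Q degree_Qm conv faber_coeff_Q_f in \<open>auto intro!: degree_diff_le\<close>)
  with s show ?thesis by blast
qed

definition wider :: "real \<Rightarrow> real" where
  "wider \<rho> = (SOME s. \<rho> < s \<and> (\<forall>x g. extends_to E \<Phi> (f x) (ereal \<rho>) g \<longrightarrow>
    (\<exists>h. extends_to E \<Phi> (\<lambda>z. poly Qm z * f x z) (ereal s) h)))"

text \<open>All \<open>Qf \<rho> x\<close> with x in \<open>extendable \<rho>\<close> are extensions
  to the same domain, of index \<open>wider \<rho>\<close>. This is what allows linearity in x to
  follow from uniqueness of extensions.\<close>

definition Qf :: "real \<Rightarrow> (nat \<times> nat \<Rightarrow> complex) \<Rightarrow> complex \<Rightarrow> complex" where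
  "Qf \<rho> x = (SOME h. extends_to E \<Phi> (\<lambda>z. poly Qm z * f x z) (ereal (wider \<rho>)) h)"

lemma wider_gt: "1 < \<rho> \<Longrightarrow> \<rho> < wider \<rho>"
  and Qf: "\<lbrakk>1 < \<rho>; extends_to E \<Phi> (f x) (ereal \<rho>) g\<rbrakk> \<Longrightarrow>
    extends_to E \<Phi> (\<lambda>z. poly Qm z * f x z) (ereal (wider \<rho>)) (Qf \<rho> x)"
proof -
  have *: "\<rho> < wider \<rho> \<and> (\<forall>x g. extends_to E \<Phi> (f x) (ereal \<rho>) g \<longrightarrow>
    (\<exists>h. extends_to E \<Phi> (\<lambda>z. poly Qm z * f x z) (ereal (wider \<rho>)) h))" if "1 < \<rho>"
    unfolding wider_def by (rule someI_ex) (use wider_index_exists[OF that] in blast)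
  then show "1 < \<rho> \<Longrightarrow> \<rho> < wider \<rho>" by blast
  assume "1 < \<rho>" "extends_to E \<Phi> (f x) (ereal \<rho>) g"
  with * have "\<exists>h. extends_to E \<Phi> (\<lambda>z. poly Qm z * f x z) (ereal (wider \<rho>)) h" by blast
  then show "extends_to E \<Phi> (\<lambda>z. poly Qm z * f x z) (ereal (wider \<rho>)) (Qf \<rho> x)"
    unfolding Qf_def by (rule someI_ex)
qed

section \<open>Linear forms attached to the zeros of the limit polynomial\<close>

definition extendable :: "real \<Rightarrow> (nat \<times> nat \<Rightarrow> complex) set" where
  "extendable \<rho> = {x. \<exists>g. extends_to E \<Phi> (f x) (ereal \<rho>) g}"

lemma extendable_linear:
  assumes "x \<in> extendable \<rho>" "y \<in> extendable \<rho>"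
  shows "(\<lambda>i. u * x i + v * y i) \<in> extendable \<rho>"
proof -
  obtain g h where g: "extends_to E \<Phi> (f x) (ereal \<rho>) g" "extends_to E \<Phi> (f y) (ereal \<rho>) h"
    using assms by (auto simp: extendable_def)
  obtain U V where "open U" "E \<subseteq> U" "\<forall>z\<in>U. g z = f x z" "open V" "E \<subseteq> V" "\<forall>z\<in>V. h z = f y z"
    using g unfolding extends_to_def agree_near_def by blast
  then have "agree_near E (\<lambda>z. u * g z + v * h z) (f (\<lambda>i. u * x i + v * y i))"
    unfolding agree_near_def f_linear by (intro exI[of _ "U \<inter> V"]) auto
  moreover have "(\<lambda>z. u * g z + v * h z) holomorphic_on D (ereal \<rho>)"
    using g by (auto simp: extends_to_def intro!: holomorphic_intros)
  ultimately show ?thesis unfolding extendable_def extends_to_def by blast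
qed

lemma Qf_linear:
  assumes "1 < \<rho>" "x \<in> extendable \<rho>" "y \<in> extendable \<rho>" "z \<in> D (ereal (wider \<rho>))"
  shows "Qf \<rho> (\<lambda>i. u * x i + v * y i) z = u * Qf \<rho> x z + v * Qf \<rho> y z"
proof -
  have ex: "extends_to E \<Phi> (\<lambda>z. poly Qm z * f x z) (ereal (wider \<rho>)) (Qf \<rho> x)"
    "extends_to E \<Phi> (\<lambda>z. poly Qm z * f y z) (ereal (wider \<rho>)) (Qf \<rho> y)"
    "extends_to E \<Phi> (\<lambda>z. poly Qm z * f (\<lambda>i. u * x i + v * y i) z) (ereal (wider \<rho>)) (Qf \<rho> (\<lambda>i. u * x i + v * y i))"
    using assms extendable_linear[OF assms(2,3)] Qf unfolding extendable_def by blast+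
  obtain U V where "open U" "E \<subseteq> U" "\<forall>z\<in>U. Qf \<rho> x z = poly Qm z * f x z"
     "open V" "E \<subseteq> V" "\<forall>z\<in>V. Qf \<rho> y z = poly Qm z * f y z"
    using ex(1,2) unfolding extends_to_def agree_near_def by blast
  then have "agree_near E (\<lambda>z. u * Qf \<rho> x z + v * Qf \<rho> y z) (\<lambda>z. poly Qm z * f (\<lambda>i. u * x i + v * y i) z)"
    unfolding agree_near_def f_linear by (intro exI[of _ "U \<inter> V"]) (auto simp: algebra_simps)
  moreover have "(\<lambda>z. u * Qf \<rho> x z + v * Qf \<rho> y z) holomorphic_on D (ereal (wider \<rho>))"
    using ex by (auto simp: extends_to_def intro!: holomorphic_intros)
  ultimately have "extends_to E \<Phi> (\<lambda>z. poly Qm z * f (\<lambda>i. u * x i + v * y i) z) (ereal (wider \<rho>))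
      (\<lambda>z. u * Qf \<rho> x z + v * Qf \<rho> y z)"
    unfolding extends_to_def by blast
  from extends_to_unique[OF ex(3) this] show ?thesis
    using assms wider_gt[OF assms(1)] by auto
qed

lemma functional_exists:
  assumes "\<zeta> \<notin> E"
  shows "\<exists>a. \<forall>x\<in>extendable (norm (\<Phi> \<zeta>)). (\<forall>i. i \<notin> I \<longrightarrow> x i = 0) \<longrightarrow>
    taylor_coeff (Qf (norm (\<Phi> \<zeta>)) x) \<zeta> j = (\<Sum>i\<in>I. a i * x i)"
proof (rule subspace_functional_coefficients[OF finite_I extendable_linear])
  define \<rho> where "\<rho> = norm (\<Phi> \<zeta>)"
  have \<rho>: "1 < \<rho>" using norm_Phi assms by (simp add: \<rho>_def)
  have in_D: "\<zeta> \<in> D (ereal (wider \<rho>))" using wider_gt[OF \<rho>] by (auto simp: mem_D \<rho>_def)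
  have op: "open (D (ereal (wider \<rho>)))" using wider_gt[OF \<rho>] \<rho> by (intro open_D) auto
  fix x y u v assume xy: "x \<in> extendable (norm (\<Phi> \<zeta>))" "y \<in> extendable (norm (\<Phi> \<zeta>))"
  have an: "Qf \<rho> x analytic_on {\<zeta>}" if "x \<in> extendable \<rho>" for x
    using that Qf[OF \<rho>] in_D op analytic_at unfolding extends_to_def extendable_def by blast
  have "\<forall>\<^sub>F w in nhds \<zeta>. Qf \<rho> (\<lambda>i. u * x i + v * y i) w = u * Qf \<rho> x w + v * Qf \<rho> y w"
    by (rule eventually_mono[OF eventually_nhds_in_open[OF op in_D]])
       (use Qf_linear[OF \<rho>] xy \<rho>_def in blast)
  from taylor_coeff_linear[OF an an this]
  show "taylor_coeff (Qf (norm (\<Phi> \<zeta>)) (\<lambda>i. u * x i + v * y i)) \<zeta> j =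
     u * taylor_coeff (Qf (norm (\<Phi> \<zeta>)) x) \<zeta> j + v * taylor_coeff (Qf (norm (\<Phi> \<zeta>)) y) \<zeta> j"
    using xy unfolding \<rho>_def by blast
qed

text \<open>The Taylor coefficients are defined only for \<open>x\<close> in the subspace \<open>extendable (norm (\<Phi> \<zeta>))\<close>; elsewhere
  the linear form given by \<open>functional\<close> is an arbitrary extension.\<close>
definition functional :: "complex \<times> nat \<Rightarrow> nat \<times> nat \<Rightarrow> complex" where
  "functional p = (SOME a. \<forall>x\<in>extendable (norm (\<Phi> (fst p))). (\<forall>i. i \<notin> I \<longrightarrow> x i = 0) \<longrightarrow>
    taylor_coeff (Qf (norm (\<Phi> (fst p))) x) (fst p) (snd p) = (\<Sum>i\<in>I. a i * x i))"

lemma functional_eq: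
  assumes "\<zeta> \<notin> E" "x \<in> extendable (norm (\<Phi> \<zeta>))" "\<forall>i. i \<notin> I \<longrightarrow> x i = 0"
  shows "(\<Sum>i\<in>I. functional (\<zeta>, j) i * x i) = taylor_coeff (Qf (norm (\<Phi> \<zeta>)) x) \<zeta> j"
  by (rule sym, rule someI_ex[OF functional_exists[OF assms(1), of j],
        folded functional_def[of "(\<zeta>, j)", unfolded fst_conv snd_conv], rule_format])
     (use assms in auto)

text \<open>Zeros in E are left out because \<Phi> assigns them no level; that there are none is a
  result of the count.\<close>

definition J :: "(complex \<times> nat) set" where
  "J = (SIGMA \<zeta>:{\<zeta>. poly Qm \<zeta> = 0 \<and> \<zeta> \<notin> E}. {..<order \<zeta> Qm})"

text \<open>If all functionals on level \<rho> vanished, \<open>extend_quotient\<close> without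
  exceptional points would continue \<open>f x\<close> beyond its index. On this level x is
  extendable, so the functionals there are genuine Taylor coefficients.\<close>

lemma functional_detects:
  assumes "i0 \<in> I" "x i0 \<noteq> 0" and supp: "\<forall>i. i \<notin> I \<longrightarrow> x i = 0"
    and g: "1 < \<rho>" "extends_to E \<Phi> (f x) (ereal \<rho>) g" "\<And>\<rho>' g'. \<rho> < \<rho>' \<Longrightarrow> \<not> extends_to E \<Phi> (f x) (ereal \<rho>') g'"
  shows "\<exists>\<zeta> j. (\<zeta>, j) \<in> J \<and> norm (\<Phi> \<zeta>) = \<rho> \<and> (\<Sum>i\<in>I. functional (\<zeta>, j) i * x i) \<noteq> 0"
proof (rule ccontr)
  assume neg: "\<not> ?thesis"
  have x: "x \<in> extendable \<rho>" using g by (auto simp: extendable_def)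
  have zero: "taylor_coeff (Qf \<rho> x) \<zeta> j = 0" if "\<zeta> \<notin> E" "norm (\<Phi> \<zeta>) = \<rho>" "j < order \<zeta> Qm" for \<zeta> j
  proof -
    have "(\<zeta>, j) \<in> J" using that Qm_nz by (auto simp: J_def order_root)
    then show ?thesis using neg functional_eq[of \<zeta> x j] that x supp by auto
  qed
  obtain \<rho>' k where "\<rho> < \<rho>'" "k holomorphic_on D (ereal \<rho>') - {}" "agree_near E k (f x)"
  proof (rule extend_quotient[OF g(2) Qf[OF g(1,2)] g(1) wider_gt[OF g(1)] Qm_nz, of "{}"])
    show "taylor_coeff (Qf \<rho> x) \<zeta> j = 0" if "\<zeta> \<notin> E" "norm (\<Phi> \<zeta>) = \<rho>" "\<zeta> \<notin> {}" "j < order \<zeta> Qm" for \<zeta> j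
      using zero that by blast
  qed auto
  then show False using g(3) unfolding extends_to_def by auto
qed

lemma card_J: "card J = N" and zeros_outside: "poly Qm \<zeta> = 0 \<Longrightarrow> \<zeta> \<notin> E" and finite_J: "finite J"
proof -
  have fin: "finite {\<zeta>. poly Qm \<zeta> = 0}" using Qm_nz by (rule poly_roots_finite)
  then have fin': "finite {\<zeta>. poly Qm \<zeta> = 0 \<and> \<zeta> \<notin> E}" by (rule rev_finite_subset) auto
  show finJ: "finite J" unfolding J_def using fin' by auto
  have cardJ: "card J = (\<Sum>\<zeta> | poly Qm \<zeta> = 0 \<and> \<zeta> \<notin> E. order \<zeta> Qm)"
    unfolding J_def using fin' by (subst card_SigmaI) auto
  have deg: "(\<Sum>\<zeta> | poly Qm \<zeta> = 0. order \<zeta> Qm) = N"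
    using sum_order_eq_degree[OF Qm_nz] degree_Qm by simp
  have "N \<le> card J"
  proof (rule ccontr)
    assume "\<not> N \<le> card J"
    then obtain x where x: "\<exists>i\<in>I. x i \<noteq> 0" "\<forall>i. i \<notin> I \<longrightarrow> x i = 0" "\<forall>p\<in>J. (\<Sum>i\<in>I. functional p i * x i) = 0"
      using homogeneous_system_nontrivial[OF finJ finite_I, of functional] card_I by auto
    then obtain i0 where i0: "i0 \<in> I" "x i0 \<noteq> 0" by blast
    obtain \<rho> g where "1 < \<rho>" "extends_to E \<Phi> (f x) (ereal \<rho>) g"
      "\<And>\<rho>' g'. \<rho> < \<rho>' \<Longrightarrow> \<not> extends_to E \<Phi> (f x) (ereal \<rho>') g'"
      using index_of_f[of i0 x] i0 by blast
    from functional_detects[OF i0 x(2) this] x(3) show False by blast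
  qed
  \<comment> \<open>The multiplicities of zeros in E fill the gap between \<open>card J\<close> and
    the degree, so N \<le> \<open>card J\<close> forces their sum to be 0.\<close>
  moreover have split: "N = card J + (\<Sum>\<zeta> | poly Qm \<zeta> = 0 \<and> \<zeta> \<in> E. order \<zeta> Qm)"
  proof -
    have "{\<zeta>. poly Qm \<zeta> = 0} = {\<zeta>. poly Qm \<zeta> = 0 \<and> \<zeta> \<notin> E} \<union> {\<zeta>. poly Qm \<zeta> = 0 \<and> \<zeta> \<in> E}" by auto
    moreover have "(\<Sum>\<zeta>\<in>{\<zeta>. poly Qm \<zeta> = 0 \<and> \<zeta> \<notin> E} \<union> {\<zeta>. poly Qm \<zeta> = 0 \<and> \<zeta> \<in> E}. order \<zeta> Qm) =
        (\<Sum>\<zeta> | poly Qm \<zeta> = 0 \<and> \<zeta> \<notin> E. order \<zeta> Qm) + (\<Sum>\<zeta> | poly Qm \<zeta> = 0 \<and> \<zeta> \<in> E. order \<zeta> Qm)"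
      by (rule sum.union_disjoint) (use fin in auto)
    ultimately show ?thesis using deg cardJ by (simp only:)
  qed
  ultimately show "card J = N" by simp
  with split have "(\<Sum>\<zeta> | poly Qm \<zeta> = 0 \<and> \<zeta> \<in> E. order \<zeta> Qm) = 0" by simp
  moreover have "finite {\<zeta>. poly Qm \<zeta> = 0 \<and> \<zeta> \<in> E}" using fin by (rule rev_finite_subset) auto
  ultimately have "\<forall>\<zeta>. poly Qm \<zeta> = 0 \<and> \<zeta> \<in> E \<longrightarrow> order \<zeta> Qm = 0" by simp
  then show "\<zeta> \<notin> E" if "poly Qm \<zeta> = 0" using that Qm_nz order_root by blast
qed

section \<open>Orders of the poles of polynomial combinations\<close>

lemma f_eq_combination:
  assumes "\<And>\<alpha>. \<alpha> \<in> {1..d} \<Longrightarrow> degree (v \<alpha>) < m \<alpha>"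
    and "\<And>\<alpha> k. \<lbrakk>\<alpha> \<in> {1..d}; k < m \<alpha>\<rbrakk> \<Longrightarrow> coeff (v \<alpha>) k = x (\<alpha>, k)"
  shows "f x = (\<lambda>z. \<Sum>\<alpha>=1..d. poly (v \<alpha>) z * F \<alpha> z)"
proof
  fix z
  have "poly (v \<alpha>) z * F \<alpha> z = (\<Sum>k<m \<alpha>. x (\<alpha>, k) * (z ^ k * F \<alpha> z))" if \<alpha>: "\<alpha> \<in> {1..d}" for \<alpha>
  proof -
    have "{..m \<alpha> - 1} = {..<m \<alpha>}" using m_pos[OF \<alpha>] by auto
    then have "poly (v \<alpha>) z = (\<Sum>k<m \<alpha>. coeff (v \<alpha>) k * z ^ k)"
      using poly_eq_sum_le[of "v \<alpha>" "m \<alpha> - 1" z] assms(1)[OF \<alpha>] by simp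
    then show ?thesis using assms(2)[OF \<alpha>] by (simp add: sum_distrib_right mult.assoc)
  qed
  then show "f x z = (\<Sum>\<alpha>=1..d. poly (v \<alpha>) z * F \<alpha> z)"
    unfolding f_def I_def by (subst sum.Sigma[symmetric, where g = "\<lambda>\<alpha> k. x (\<alpha>, k) * (z ^ k * F \<alpha> z)",
          simplified case_prod_unfold prod.collapse]) auto
qed

text \<open>The functional left free is the one of index \<tau> - t at \<zeta>: the product of
  \<open>Qm\<close> and \<open>f x\<close> then vanishes at \<zeta> to order exactly \<tau> - t, and
  division by \<open>Qm\<close>, with its zero of order \<tau>, leaves a pole of order t.\<close>

lemma pole_combination_exists:
  assumes \<zeta>: "poly Qm \<zeta> = 0" and t: "1 \<le> t" "t \<le> order \<zeta> Qm"
  shows "has_pole_combination E \<Phi> d F m \<zeta> t"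
proof -
  define \<tau> where "\<tau> = order \<zeta> Qm"
  have \<zeta>E: "\<zeta> \<notin> E" using \<zeta> by (rule zeros_outside)
  define p where "p = (\<zeta>, \<tau> - t)"
  have p: "p \<in> J" using \<zeta> \<zeta>E t by (auto simp: p_def J_def \<tau>_def)
  have "card (J - {p}) < card I" using p finite_J card_J card_I by (metis card_Diff1_less)
  then obtain x where x: "\<exists>i\<in>I. x i \<noteq> 0" "\<forall>i. i \<notin> I \<longrightarrow> x i = 0"
      "\<forall>p'\<in>J - {p}. (\<Sum>i\<in>I. functional p' i * x i) = 0"
    using homogeneous_system_nontrivial[of "J - {p}" I functional] finite_J finite_I by auto
  then obtain i0 where i0: "i0 \<in> I" "x i0 \<noteq> 0" by blast
  obtain \<rho> g where g: "1 < \<rho>" "extends_to E \<Phi> (f x) (ereal \<rho>) g"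
      "\<And>\<rho>' g'. \<rho> < \<rho>' \<Longrightarrow> \<not> extends_to E \<Phi> (f x) (ereal \<rho>') g'"
    using index_of_f[of i0 x] i0 by blast
  \<comment> \<open>Some functional on the level of the index of \<open>f x\<close> is nonzero, and
    only the one at \<open>p\<close> can be; hence this level is that of \<zeta>.\<close>
  obtain \<zeta>' j' where "(\<zeta>', j') \<in> J" "norm (\<Phi> \<zeta>') = \<rho>" "(\<Sum>i\<in>I. functional (\<zeta>', j') i * x i) \<noteq> 0"
    using functional_detects[OF i0 x(2) g] by blast
  then have \<rho>: "norm (\<Phi> \<zeta>) = \<rho>" and nz: "(\<Sum>i\<in>I. functional p i * x i) \<noteq> 0"
    using x(3) by (auto simp: p_def)
  have xext: "x \<in> extendable \<rho>" using g by (auto simp: extendable_def)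
  define h where "h = Qf \<rho> x"
  have h: "extends_to E \<Phi> (\<lambda>z. poly Qm z * f x z) (ereal (wider \<rho>)) h"
    unfolding h_def by (rule Qf[OF g(1,2)])
  have tc: "(\<Sum>i\<in>I. functional (\<xi>, j) i * x i) = taylor_coeff h \<xi> j" if "\<xi> \<notin> E" "norm (\<Phi> \<xi>) = \<rho>" for \<xi> j
    using functional_eq[of \<xi> x j] that xext x(2) by (simp add: h_def)
  have zero: "taylor_coeff h \<xi> j = 0" if "\<xi> \<notin> E" "norm (\<Phi> \<xi>) = \<rho>" "j < order \<xi> Qm" "(\<xi>, j) \<noteq> p" for \<xi> j
  proof -
    have "(\<xi>, j) \<in> J - {p}" using that Qm_nz by (auto simp: J_def order_root)
    with x(3) have "(\<Sum>i\<in>I. functional (\<xi>, j) i * x i) = 0" by (rule bspec)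
    then show ?thesis using tc[OF that(1,2), of j] by simp
  qed
  \<comment> \<open>At every other zero on this level the Taylor coefficients up to its multiplicity
    vanish, so \<zeta> is the only exceptional point.\<close>
  obtain \<rho>' k where k: "\<rho> < \<rho>'" "\<rho>' \<le> wider \<rho>" "k holomorphic_on D (ereal \<rho>') - {\<zeta>}" "agree_near E k (f x)"
    "\<And>z. \<lbrakk>z \<in> D (ereal \<rho>'); poly Qm z \<noteq> 0\<rbrakk> \<Longrightarrow> k z = h z / poly Qm z"
  proof (rule extend_quotient[OF g(2) h g(1) wider_gt[OF g(1)] Qm_nz, of "{\<zeta>}"])
    show "\<zeta>' \<notin> E \<and> norm (\<Phi> \<zeta>') = \<rho>" if "\<zeta>' \<in> {\<zeta>}" for \<zeta>' using that \<zeta>E \<rho> by simp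
    show "taylor_coeff h \<zeta>' j = 0" if "\<zeta>' \<notin> E" "norm (\<Phi> \<zeta>') = \<rho>" "\<zeta>' \<notin> {\<zeta>}" "j < order \<zeta>' Qm" for \<zeta>' j
      using zero that by (auto simp: p_def)
  qed blast
  have in_D: "\<zeta> \<in> D (ereal \<rho>')" using k(1) \<rho> by (auto simp: mem_D)
  have opD: "open (D (ereal \<rho>'))" using k g by (intro open_D) auto
  have "h holomorphic_on D (ereal \<rho>')"
    using h holomorphic_on_subset[OF _ D_mono] k(2) unfolding extends_to_def by (metis ereal_less_eq(3))
  then have "h analytic_on {\<zeta>}" using in_D opD analytic_at by blast
  then obtain K where K: "K analytic_on {\<zeta>}" "\<forall>\<^sub>F w in nhds \<zeta>. h w = (w - \<zeta>) ^ (\<tau> - t) * K w"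
    "K \<zeta> = taylor_coeff h \<zeta> (\<tau> - t)"
  proof (rule taylor_factor)
    show "taylor_coeff h \<zeta> j = 0" if "j < \<tau> - t" for j
      using zero[of \<zeta> j] \<zeta>E \<rho> that by (auto simp: \<tau>_def p_def)
  qed blast
  have "K \<zeta> \<noteq> 0" using nz tc[OF \<zeta>E \<rho>] K(3) by (simp add: p_def)
  obtain R where R: "\<And>w. poly Qm w = (w - \<zeta>) ^ \<tau> * poly R w" "poly R \<zeta> \<noteq> 0"
    using poly_order_factor[OF Qm_nz, of \<zeta>] unfolding \<tau>_def by blast
  define KR where "KR = (\<lambda>w. K w / poly R w)"
  have KR: "KR analytic_on {\<zeta>}" "KR \<zeta> \<noteq> 0"
    using K(1) R(2) \<open>K \<zeta> \<noteq> 0\<close> by (auto simp: KR_def intro!: analytic_intros)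
  obtain V1 where V1: "open V1" "\<zeta> \<in> V1" "KR holomorphic_on V1" using KR(1) analytic_at by metis
  have "\<forall>\<^sub>F w in nhds \<zeta>. poly R w \<noteq> 0"
  proof -
    have "isCont (poly R) \<zeta>" by simp
    then have "(poly R \<longlongrightarrow> poly R \<zeta>) (nhds \<zeta>)" by (simp add: isCont_def tendsto_at_iff_tendsto_nhds)
    then show ?thesis using R(2) tendsto_imp_eventually_ne by blast
  qed
  with K(2) have "\<forall>\<^sub>F w in nhds \<zeta>. w \<in> D (ereal \<rho>') \<longrightarrow> w \<noteq> \<zeta> \<longrightarrow> k w = KR w / (w - \<zeta>) ^ t"
  proof eventually_elim
    case (elim w)
    show ?case
    proof (intro impI)
      assume w: "w \<in> D (ereal \<rho>')" "w \<noteq> \<zeta>"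
      then have "k w = h w / poly Qm w" using k(5) R elim by auto
      also have "\<dots> = ((w - \<zeta>) ^ (\<tau> - t) * K w) / (((w - \<zeta>) ^ (\<tau> - t) * (w - \<zeta>) ^ t) * poly R w)"
        using elim t by (simp add: R(1) \<tau>_def flip: power_add)
      also have "\<dots> = KR w / (w - \<zeta>) ^ t" using w elim by (simp add: KR_def)
      finally show "k w = KR w / (w - \<zeta>) ^ t" .
    qed
  qed
  then obtain V2 where V2: "open V2" "\<zeta> \<in> V2"
    "\<And>w. \<lbrakk>w \<in> V2; w \<in> D (ereal \<rho>'); w \<noteq> \<zeta>\<rbrakk> \<Longrightarrow> k w = KR w / (w - \<zeta>) ^ t"
    unfolding eventually_nhds by blast
  define V where "V = V1 \<inter> V2 \<inter> D (ereal \<rho>')"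
  have V: "open V" "\<zeta> \<in> V" "KR holomorphic_on V" "\<And>w. \<lbrakk>w \<in> V; w \<noteq> \<zeta>\<rbrakk> \<Longrightarrow> k w = KR w / (w - \<zeta>) ^ t"
    using V1 V2 opD in_D by (auto simp: V_def intro: holomorphic_on_subset)
  have "is_pole k \<zeta>"
  proof (rule is_pole_transform)
    show "is_pole (\<lambda>w. KR w / (w - \<zeta>) ^ t) \<zeta>"
      by (rule is_pole_basic[OF V(3,1,2) KR(2)]) (use t in auto)
    show "\<forall>\<^sub>F w in at \<zeta>. KR w / (w - \<zeta>) ^ t = k w"
      using V unfolding eventually_at_topological by metis
  qed simp
  moreover have "zorder k \<zeta> = - int t"
  proof (rule zorder_eqI[OF V(1,2,3) KR(2)])
    fix w assume "w \<in> V" "w \<noteq> \<zeta>"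
    then show "k w = KR w * (w - \<zeta>) powi (- int t)"
      using V(4) by (simp add: power_int_minus divide_inverse)
  qed
  moreover define v where "v = (\<lambda>\<alpha>. \<Sum>l<m \<alpha>. monom (x (\<alpha>, l)) l)"
  have cv: "coeff (v \<alpha>) l = (if l < m \<alpha> then x (\<alpha>, l) else 0)" for \<alpha> l
    by (simp add: v_def coeff_sum if_distrib[of "\<lambda>f. f _"] cong: if_cong)
  have dv: "degree (v \<alpha>) < m \<alpha>" if "\<alpha> \<in> {1..d}" for \<alpha>
  proof -
    have "degree (v \<alpha>) \<le> m \<alpha> - 1" using m_pos[OF that] by (intro degree_le) (auto simp: cv)
    then show ?thesis using m_pos[OF that] by simp
  qed
  moreover have "f x = (\<lambda>z. \<Sum>\<alpha>=1..d. poly (v \<alpha>) z * F \<alpha> z)"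
    by (rule f_eq_combination) (use dv cv in auto)
  moreover have "closure (D (ereal (norm (\<Phi> \<zeta>)))) \<subseteq> D (ereal \<rho>')"
    unfolding \<rho> using k(1) by (rule closure_D_subset)
  ultimately show ?thesis
    unfolding has_pole_combination_def using opD k(3,4)
    by (intro exI[of _ v] exI[of _ "D (ereal \<rho>')"] exI[of _ k] conjI ballI) simp_all
qed

text \<open>Near \<xi> the product \<open>Qm * g\<close> coincides with the holomorphic function
  \<open>h\<close>; a pole of g of order t above the multiplicity would leave \<open>h\<close> with
  a pole. Multiplicity 0 is included, which rules out system poles away from the zeros of
  \<open>Qm\<close>.\<close>

lemma pole_combination_order:
  assumes \<xi>: "\<xi> \<notin> E" and t: "1 \<le> t" and "has_pole_combination E \<Phi> d F m \<xi> t"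
  shows "t \<le> order \<xi> Qm"
proof (rule ccontr)
  assume less: "\<not> t \<le> order \<xi> Qm"
  define \<rho> where "\<rho> = norm (\<Phi> \<xi>)"
  have \<rho>: "1 < \<rho>" using norm_Phi[OF \<xi>] by (simp add: \<rho>_def)
  obtain v U g where v: "\<And>\<alpha>. \<alpha> \<in> {1..d} \<Longrightarrow> degree (v \<alpha>) < m \<alpha>"
    and U: "open U" "closure (D (ereal \<rho>)) \<subseteq> U"
    and g: "g holomorphic_on U - {\<xi>}" "agree_near E g (\<lambda>z. \<Sum>\<alpha>=1..d. poly (v \<alpha>) z * F \<alpha> z)"
      "is_pole g \<xi>" "zorder g \<xi> = - int t"
    using assms(3) unfolding has_pole_combination_def \<rho>_def by blast
  define x where "x = (\<lambda>i. coeff (v (fst i)) (snd i))"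
  have fx: "f x = (\<lambda>z. \<Sum>\<alpha>=1..d. poly (v \<alpha>) z * F \<alpha> z)"
    by (rule f_eq_combination) (use v in \<open>auto simp: x_def\<close>)
  have \<xi>D: "\<xi> \<notin> D (ereal \<rho>)" using \<xi> by (auto simp: mem_D \<rho>_def)
  then have sub: "D (ereal \<rho>) \<subseteq> U - {\<xi>}" using U(2) closure_subset by blast
  have gext: "extends_to E \<Phi> (f x) (ereal \<rho>) g"
    unfolding extends_to_def fx using holomorphic_on_subset[OF g(1) sub] g(2) by blast
  define h where "h = Qf \<rho> x"
  define s where "s = wider \<rho>"
  have h: "extends_to E \<Phi> (\<lambda>z. poly Qm z * f x z) (ereal s) h"
    unfolding h_def s_def by (rule Qf[OF \<rho> gext])
  have s: "\<rho> < s" unfolding s_def by (rule wider_gt[OF \<rho>])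
  have hg: "h z = poly Qm z * g z" if "z \<in> D (ereal \<rho>)" for z
    by (rule extends_to_unique[OF h poly_mult_extends[OF gext]])
       (use \<rho> s that D_mono[of "ereal \<rho>" "ereal s"] in auto)
  have \<xi>s: "\<xi> \<in> D (ereal s)" using s by (auto simp: mem_D \<rho>_def)
  have opD: "open (D (ereal s))" "open (D (ereal \<rho>))" using \<rho> s by (auto intro!: open_D)
  \<comment> \<open>U is only known to contain the closure of the canonical domain; \<xi>, on the
    level curve, belongs to that closure.\<close>
  have \<xi>U: "\<xi> \<in> U"
  proof -
    have "\<exists>z\<in>D (ereal \<rho>). z \<in> W" if "open W" "\<xi> \<in> W" for W
      using level_point_in_closure[OF \<xi> that] unfolding \<rho>_def by blast
    then have "\<xi> \<in> closure (D (ereal \<rho>))" unfolding closure_iff_nhds_not_empty by blast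
    then show ?thesis using U(2) by blast
  qed
  have "open (U \<inter> D (ereal s))" "\<xi> \<in> U \<inter> D (ereal s)" using \<xi>U \<xi>s U(1) opD(1) by auto
  then obtain e where e: "e > 0" "ball \<xi> e \<subseteq> U \<inter> D (ereal s)"
    using open_contains_ball by blast
  \<comment> \<open>The identity is known inside the canonical domain, which does not contain \<xi>.
    The punctured disc is connected and meets that domain, so the identity theorem extends
    it.\<close>
  have eq: "h z = poly Qm z * g z" if "z \<in> ball \<xi> e - {\<xi>}" for z
  proof (rule analytic_continuation_open[of "ball \<xi> e \<inter> D (ereal \<rho>)" "ball \<xi> e - {\<xi>}" h "\<lambda>z. poly Qm z * g z" z])
    obtain z0 where "z0 \<in> ball \<xi> e" "z0 \<in> D (ereal (norm (\<Phi> \<xi>)))"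
      by (rule level_point_in_closure[OF \<xi>, of "ball \<xi> e"]) (use e(1) in auto)
    then show "ball \<xi> e \<inter> D (ereal \<rho>) \<noteq> {}" unfolding \<rho>_def by blast
    show "connected (ball \<xi> e - {\<xi>})" by (rule connected_punctured_ball) (simp add: DIM_complex)
    show "h holomorphic_on ball \<xi> e - {\<xi>}"
      using h e(2) unfolding extends_to_def by (auto intro: holomorphic_on_subset)
    show "(\<lambda>z. poly Qm z * g z) holomorphic_on ball \<xi> e - {\<xi>}"
      using e(2) by (intro holomorphic_intros holomorphic_on_subset[OF g(1)]) auto
  qed (use hg that opD \<xi>D in auto)
  obtain r where r: "r > 0" "cball \<xi> r \<subseteq> ball \<xi> e" "zor_poly g \<xi> holomorphic_on cball \<xi> r"
    "\<And>w. w \<in> cball \<xi> r - {\<xi>} \<Longrightarrow> g w = zor_poly g \<xi> w / (w - \<xi>) ^ t" "zor_poly g \<xi> \<xi> \<noteq> 0"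
  proof -
    have "g holomorphic_on ball \<xi> e - {\<xi>}" using e(2) by (intro holomorphic_on_subset[OF g(1)]) auto
    from zorder_exist_pole[OF this open_ball _ g(3)] e(1) g(4) that show ?thesis by auto
  qed
  define \<tau> where "\<tau> = order \<xi> Qm"
  obtain R where R: "\<And>w. poly Qm w = (w - \<xi>) ^ \<tau> * poly R w" "poly R \<xi> \<noteq> 0"
    using poly_order_factor[OF Qm_nz, of \<xi>] unfolding \<tau>_def by blast
  have "is_pole h \<xi>"
  proof (rule is_pole_transform)
    show "is_pole (\<lambda>w. poly R w * zor_poly g \<xi> w / (w - \<xi>) ^ (t - \<tau>)) \<xi>"
      by (rule is_pole_basic[of _ "ball \<xi> r"])
         (use r R less in \<open>auto simp: \<tau>_def intro!: holomorphic_intros elim: holomorphic_on_subset\<close>)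
    show "\<forall>\<^sub>F w in at \<xi>. poly R w * zor_poly g \<xi> w / (w - \<xi>) ^ (t - \<tau>) = h w"
    proof -
      have "\<forall>\<^sub>F w in at \<xi>. w \<in> ball \<xi> r - {\<xi>}"
        using r(1) by (intro eventually_at_in_open) auto
      then show ?thesis
      proof eventually_elim
        case (elim w)
        then have w: "w \<in> ball \<xi> e - {\<xi>}" "w \<in> cball \<xi> r - {\<xi>}"
          using r(2) ball_subset_cball[of \<xi> r] by blast+
        then have "h w = (w - \<xi>) ^ \<tau> * poly R w * (zor_poly g \<xi> w / (w - \<xi>) ^ t)"
          by (simp only: eq[OF w(1)] r(4)[OF w(2)] R(1))
        moreover have "(w - \<xi>) ^ t = (w - \<xi>) ^ \<tau> * (w - \<xi>) ^ (t - \<tau>)"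
          using less by (simp add: \<tau>_def flip: power_add)
        moreover have "w \<noteq> \<xi>" using elim by simp
        ultimately show ?case by simp
      qed
    qed
  qed simp
  moreover have "h holomorphic_on D (ereal s)" using h unfolding extends_to_def by blast
  ultimately show False using not_is_pole_holomorphic[OF opD(1) \<xi>s] by blast
qed

text \<open>All orders up to the multiplicity occur and none above it, so the maximality in the
  definition singles out the multiplicity.\<close>

lemma is_system_pole_iff:
  "is_system_pole E \<Phi> d F m \<xi> \<tau> \<longleftrightarrow> poly Qm \<xi> = 0 \<and> \<tau> = order \<xi> Qm"
proof
  assume *: "is_system_pole E \<Phi> d F m \<xi> \<tau>"
  then have \<xi>: "\<xi> \<notin> E" "1 \<le> \<tau>" "has_pole_combination E \<Phi> d F m \<xi> \<tau>"
    unfolding is_system_pole_def by auto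
  then have le: "\<tau> \<le> order \<xi> Qm" by (intro pole_combination_order)
  then have 0: "poly Qm \<xi> = 0" using \<xi>(2) Qm_nz order_root by fastforce
  then have "\<forall>t\<in>{1..order \<xi> Qm}. has_pole_combination E \<Phi> d F m \<xi> t"
    using pole_combination_exists by auto
  then have "order \<xi> Qm \<le> \<tau>" using * unfolding is_system_pole_def by blast
  with le 0 show "poly Qm \<xi> = 0 \<and> \<tau> = order \<xi> Qm" by simp
next
  assume *: "poly Qm \<xi> = 0 \<and> \<tau> = order \<xi> Qm"
  then have \<xi>: "\<xi> \<notin> E" using zeros_outside by blast
  have "\<tau>' \<le> \<tau>" if "\<forall>t\<in>{1..\<tau>'}. has_pole_combination E \<Phi> d F m \<xi> t" for \<tau>'
    using that pole_combination_order[OF \<xi>, of \<tau>'] * by (cases "\<tau>' = 0") auto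
  moreover have "1 \<le> \<tau>" using * Qm_nz order_root[of Qm \<xi>] by simp
  ultimately show "is_system_pole E \<Phi> d F m \<xi> \<tau>"
    unfolding is_system_pole_def using \<xi> * pole_combination_exists[of \<xi>] by (simp add: Ball_def)
qed

theorem system_poles_eq_zeros:
  "finite (system_poles E \<Phi> d F m) \<and>
    (\<Sum>\<xi>\<in>system_poles E \<Phi> d F m. system_pole_order E \<Phi> d F m \<xi>) = mi_size d m \<and>
    Qm = system_pole_poly E \<Phi> d F m"
proof -
  have sp: "system_poles E \<Phi> d F m = {\<xi>. poly Qm \<xi> = 0}"
    unfolding system_poles_def is_system_pole_iff by auto
  have ord: "system_pole_order E \<Phi> d F m \<xi> = order \<xi> Qm" if "poly Qm \<xi> = 0" for \<xi>
    unfolding system_pole_order_def is_system_pole_iff using that by auto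
  have "system_pole_poly E \<Phi> d F m = (\<Prod>\<xi> | poly Qm \<xi> = 0. [:- \<xi>, 1:] ^ order \<xi> Qm)"
    unfolding system_pole_poly_def sp by (rule prod.cong) (auto simp: ord)
  also have "\<dots> = Qm" using complex_poly_decompose[of Qm] lead_Qm by simp
  finally have "Qm = system_pole_poly E \<Phi> d F m" by simp
  moreover have "(\<Sum>\<xi>\<in>system_poles E \<Phi> d F m. system_pole_order E \<Phi> d F m \<xi>) = N"
    unfolding sp using sum_order_eq_degree[OF Qm_nz] degree_Qm by (simp add: ord)
  moreover have "finite (system_poles E \<Phi> d F m)"
    unfolding sp using Qm_nz by (rule poly_roots_finite)
  ultimately show ?thesis by blast
qed

end

section \<open>Passage from the limsup hypothesis to a geometric rate for large n\<close>

theorem theorem1p2: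
  fixes E :: "complex set" and \<Phi> :: "complex \<Rightarrow> complex"
    and d :: nat and F :: "nat \<Rightarrow> complex \<Rightarrow> complex" and m :: "nat \<Rightarrow> nat"
    and Q :: "nat \<Rightarrow> complex poly" and Qm :: "complex poly" and \<theta> :: real
  assumes "compact E" and "\<exists>x\<in>E. \<exists>y\<in>E. x \<noteq> y" and "0 \<in> E"
    and "simply_connected_space (subtopology riemann_sphere (- Some ` E))"
    and "exterior_conformal_map E \<Phi>"
    and "d \<ge> 1" and "\<And>\<alpha>. \<alpha> \<in> {1..d} \<Longrightarrow> m \<alpha> \<ge> 1"
    and "\<And>\<alpha>. \<alpha> \<in> {1..d} \<Longrightarrow> F \<alpha> analytic_on E"
    and "\<And>n. n \<ge> 1 \<Longrightarrow> monic_pade_faber_denominator E \<Phi> d F m n (Q n)"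
    and "\<forall>\<^sub>F n in sequentially. \<exists>!q. monic_pade_faber_denominator E \<Phi> d F m n q"
    and "degree Qm = mi_size d m"
    and "limsup (\<lambda>n. ereal (root n (coeff_norm (Q n - Qm)))) = ereal \<theta>" and "\<theta> < 1"
  shows "finite (system_poles E \<Phi> d F m) \<and>
    (\<Sum>\<xi>\<in>system_poles E \<Phi> d F m. system_pole_order E \<Phi> d F m \<xi>) = mi_size d m \<and>
    Qm = system_pole_poly E \<Phi> d F m"
proof -
  define N where "N = mi_size d m"
  interpret exterior_map E \<Phi> by unfold_locales fact+
  \<comment> \<open>The midpoint of \<theta> and 1 lies strictly between them; the maximum with 1/2
    secures \<delta> > 0 without a discussion of the sign of \<theta>.\<close>
  define \<delta> where "\<delta> = max (1 / 2) ((\<theta> + 1) / 2)"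
  have \<delta>: "0 < \<delta>" "\<delta> < 1" "\<theta> < \<delta>" using \<open>\<theta> < 1\<close> by (auto simp: \<delta>_def max_def)
  have den: "lead_coeff (Q n) = 1" "degree (Q n) \<le> N" if "n \<ge> 1" for n
    using assms(9)[OF that] by (auto simp: monic_pade_faber_denominator_def pade_faber_solution_def N_def)
  have ev1: "\<forall>\<^sub>F n in sequentially. \<forall>i. norm (coeff (Q n - Qm) i) \<le> \<delta> ^ n"
  proof -
    have "\<forall>\<^sub>F n in sequentially. ereal (root n (coeff_norm (Q n - Qm))) < ereal \<delta>"
      by (rule Limsup_lessD) (use assms(12) \<delta> in simp)
    \<comment> \<open>The index 0 is discarded because \<open>root 0\<close> is constantly 0 and its
      power does not recover the norm.\<close>
    then show ?thesis using eventually_gt_at_top[of 0]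
    proof eventually_elim
      case (elim n)
      have nonneg: "0 \<le> coeff_norm (Q n - Qm)" unfolding coeff_norm_def by (intro sum_nonneg) auto
      have "coeff_norm (Q n - Qm) = root n (coeff_norm (Q n - Qm)) ^ n"
        using elim nonneg by simp
      also have "\<dots> \<le> \<delta> ^ n" using elim nonneg by (intro power_mono) auto
      finally have le: "coeff_norm (Q n - Qm) \<le> \<delta> ^ n" .
      have "norm (coeff (Q n - Qm) i) \<le> coeff_norm (Q n - Qm)" for i
      proof (cases "i \<le> degree (Q n - Qm)")
        case True then show ?thesis unfolding coeff_norm_def by (intro member_le_sum) auto
      next
        case False then show ?thesis using nonneg coeff_eq_0[of "Q n - Qm" i] by simp
      qed
      then show ?case using le order_trans by blast
    qed
  qed
  have \<delta>0: "(\<lambda>n. \<delta> ^ n) \<longlonglongrightarrow> 0" using \<delta> by (intro LIMSEQ_realpow_zero) auto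
  have conv: "(\<lambda>n. coeff (Q n - Qm) N) \<longlonglongrightarrow> 0"
  proof (rule Lim_null_comparison[OF _ \<delta>0])
    show "\<forall>\<^sub>F n in sequentially. norm (coeff (Q n - Qm) N) \<le> \<delta> ^ n" using ev1 by eventually_elim blast
  qed
  \<comment> \<open>A positive N makes \<open>Qm\<close> nonzero; in degree 0 the zero polynomial
    would satisfy the degree condition.\<close>
  have "m 1 \<le> N"
    unfolding N_def mi_size_def by (rule member_le_sum) (use assms(6) in auto)
  then have "N \<noteq> 0" using assms(6) assms(7)[of 1] by auto
  then have nz: "coeff Qm N \<noteq> 0"
    using assms(11) leading_coeff_0_iff[of Qm] by (cases "Qm = 0") (auto simp: N_def)
  \<comment> \<open>Convergence of the N-th coefficients to a nonzero limit excludes a drop in the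
    degree of \<open>Q n\<close> for large n.\<close>
  have "(\<lambda>n. coeff (Q n - Qm) N + coeff Qm N) \<longlonglongrightarrow> 0 + coeff Qm N"
    by (intro tendsto_intros conv)
  then have "(\<lambda>n. coeff (Q n) N) \<longlonglongrightarrow> coeff Qm N" by simp
  then have "\<forall>\<^sub>F n in sequentially. coeff (Q n) N \<noteq> 0" using nz tendsto_imp_eventually_ne by blast
  then have ev2: "\<forall>\<^sub>F n in sequentially. degree (Q n) = N"
    using eventually_ge_at_top[of 1] by eventually_elim (meson den(2) le_antisym le_degree)
  have "\<forall>\<^sub>F n in sequentially. coeff (Q n - Qm) N = 1 - coeff Qm N"
    using ev2 eventually_ge_at_top[of 1] by eventually_elim (use den in auto)
  \<comment> \<open>The \<open>Q n\<close> are monic of degree N for large n, so the difference of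
    the N-th coefficients is eventually constant, and its limit 0 makes \<open>Qm\<close>
    monic.\<close>
  with conv have "(\<lambda>n. 1 - coeff Qm N) \<longlonglongrightarrow> 0" by (rule Lim_transform_eventually)
  then have lead: "lead_coeff Qm = 1" using assms(11) by (simp add: LIMSEQ_const_iff N_def)
  obtain n0 where n0: "\<And>n. n \<ge> n0 \<Longrightarrow> (\<forall>i. norm (coeff (Q n - Qm) i) \<le> \<delta> ^ n) \<and> degree (Q n) = N \<and>
      (\<exists>!q. monic_pade_faber_denominator E \<Phi> d F m n q) \<and> 1 \<le> n"
    using eventually_conj[OF ev1 eventually_conj[OF ev2 eventually_conj[OF assms(10) eventually_ge_at_top[of 1]]]]
    unfolding eventually_sequentially by blast
  interpret pade_faber E \<Phi> d F m Q Qm \<delta> n0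
  proof unfold_locales
    show "q = Q n" if "n \<ge> n0" "monic_pade_faber_denominator E \<Phi> d F m n q" for n q
      using n0[OF that(1)] assms(9)[of n] that(2) by blast
    show "1 \<le> n0" using n0[of n0] by simp
  qed (use n0 assms \<delta> lead in \<open>auto simp: N_def\<close>)
  show ?thesis by (rule system_poles_eq_zeros)
qed

end
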